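(* Let $0<p<q$ be coprime integers and let $Y_{p,q}\to\mathbb C^2/\Gamma_{p,q}$ be the Hirzebruch–Jung (minimal) resolution. Then the asymptotically locally Euclidean (ALE) scalar-flat K\"ahler metric constructed by Calderbank–Singer on $Y_{p,q}$ has non-positive mass. Its mass is zero if and only if $p=q-1$, that is, if and only if $Y_{p,q}\to\mathbb C^2/\Gamma_{p,q}$ is a crepant resolution.
   Context: $\Gamma_{p,q}\subset U(2)$ is the cyclic group of order $q$ generated by $(z_1,z_2)\mapsto(\zeta z_1,\zeta^pz_2)$, $\zeta$ a primitive $q$-th root of unity. The Calderbank–Singer metric. Write $\frac pq=\cfrac1{e_1-\cfrac1{e_2-\cdots\cfrac1{e_k}}}$ with all $e_j\ge2$. Set $(m_0,n_0)=(0,-1)$, $(m_1,n_1)=(1,0)$; for $1\le j\le k$ let $(m_{j+1},n_{j+1})$ be the coprime pair with $m_{j+1}>0$ and $\frac{n_{j+1}}{m_{j+1}}=\cfrac1{e_1-\cdots\cfrac1{e_j}}$, so $(m_{k+1},n_{k+1})=(q,p)$; and set $(m_{k+2},n_{k+2})=(0,1)$. Let $(a_j,b_j)=(m_j-m_{j+1},n_j-n_{j+1})$ for $0\le j\le k+1$, and choose $\infty\ge y_0>y_1>\dots>y_{k+1}=0$. On the half-plane $\mathbb H=\{(x,y):x>0\}$ define $$v_1=\tfrac x2\sum_{j=0}^{k+1}\frac{(a_j,b_j)}{\sqrt{x^2+(y-y_j)^2}},\qquad v_2=\tfrac12\sum_{j=0}^{k+1}\frac{(y-y_j)\,(a_j,b_j)}{\sqrt{x^2+(y-y_j)^2}}$$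 (if $y_0=\infty$, the $j=0$ term of $v_1$ is $0$ and the $j=0$ contribution inside the sum for $v_2$ is $-(a_0,b_0)$). Let $\langle\cdot,\cdot\rangle$ be the $2\times2$ determinant of two row vectors; then $\langle v_1,v_2\rangle>0$ on $\mathbb H$. With $t=(t_1,t_2)$ angular coordinates of period $2\pi$ on $T^2$, define on $\mathbb H\times T^2$ $$g=\frac{x\langle v_1,v_2\rangle}{2(x^2+y^2)}\left(\frac{dx^2+dy^2}{x^2}+\frac{\langle v_1,dt\rangle^2+\langle v_2,dt\rangle^2}{\langle v_1,v_2\rangle^2}\right).$$ With $x=r^{-2}\sin2\theta$, $y=r^{-2}\cos2\theta$, $s=\sin\theta$, $c=\cos\theta$, the metric $g$ is scalar-flat K\"ahler for the complex structure with $Jdr=rsc\,\langle v_2,dt\rangle/\langle v_1,v_2\rangle$, $Jd\theta=-sc\,\langle v_1,dt\rangle/\langle v_1,v_2\rangle$. It extends smoothly to the partial compactification of $\mathbb H\times T^2$ obtained by adding $\partial\mathbb H\times T^2$ (with $\partial\mathbb H=\{x=0\}\cup\{\infty\}$), collapsing over each boundary interval $(y_j,y_{j-1})$, $1\le j\le k+1$, the circle in direction $(m_j,n_j)$, collapsing over the interval going from $y_0$ through $\infty$ to $y_{k+1}=0$ the circle in direction $(m_0,n_0)$, collapsing the whole $T^2$ over each $y_j$, and deleting the point over $y_{k+1}=0$. The result is biholomorphic to $Y_{p,q}$ and is ALE, the end being $(x,y)\to(0,0)$, i.e. $r\to\infty$. Mass. If, outside compact sets, a Riemannian 4-manifold $(Y,g)$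 is diffeomorphic to $\mathbb C^2/\Gamma_{p,q}$ with $g=g^{\mathrm{euc}}+\mathcal O(|z|^{-\tau})$, $\tau>0$ (after a constant rescaling of the metric if necessary), then $$m(g)=\frac1{4\pi^2}\lim_{R\to\infty}\int_{S_R}(\partial_ig_{ij}-\partial_jg_{ii})\nu^j\,d\mathrm{vol}_{S_R},$$ where $S_R\subset\mathbb C^2$ is the Euclidean sphere $|z|=R$ in the chart at infinity and $\nu$ its unit outer normal.
   Formalization: The mass is taken in charts at infinity where the metric is Euclidean up to O(|z|^{-τ}) with τ>1 and first derivatives decay like O(|z|^{-τ-1}), instead of any τ>0: for τ≤1 the limit depends on the chart. Such a chart is shown to exist, and the claim holds in every one. *)

theory Defs
  imports "HOL-Analysis.Analysis"
begin

section \<open>Continued fractions and the lattice vectors\<close>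

fun hj_frac :: "nat list \<Rightarrow> rat" where
  "hj_frac [] = 0"
| "hj_frac (e # es) = 1 / (of_nat e - hj_frac es)"

definition hj_expansion :: "nat \<Rightarrow> nat \<Rightarrow> nat list \<Rightarrow> bool" where
  "hj_expansion p q es \<longleftrightarrow> (\<forall>e\<in>set es. 2 \<le> e) \<and> hj_frac es = of_nat p / of_nat q"

text \<open>\<open>hj_dir es j\<close> is \<open>(m\<^sub>j, n\<^sub>j)\<close>, for \<open>0 \<le> j \<le> k + 2\<close> with \<open>k = length es\<close>.
  \<^const>\<open>quotient_of\<close> returns the coprime pair (numerator, denominator) with positive
  denominator; the empty fraction \<open>0 = 0/1\<close> gives \<open>(m\<^sub>1, n\<^sub>1) = (1, 0)\<close>.\<close>

definition hj_dir :: "nat list \<Rightarrow> nat \<Rightarrow> int \<times> int" where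
  "hj_dir es j =
     (if j = 0 then (0, -1)
      else if j = length es + 2 then (0, 1)
      else prod.swap (quotient_of (hj_frac (take (j - 1) es))))"

definition hj_vec :: "nat list \<Rightarrow> nat \<Rightarrow> real \<times> real" where
  "hj_vec es j = (of_int (fst (hj_dir es j)), of_int (snd (hj_dir es j)))"

definition cs_ab :: "nat list \<Rightarrow> nat \<Rightarrow> real \<times> real" where
  "cs_ab es j = hj_vec es j - hj_vec es (Suc j)"


section \<open>The Calderbank--Singer metric on \<open>\<H> \<times> T\<^sup>2\<close>\<close>

definition cs_points :: "nat list \<Rightarrow> (nat \<Rightarrow> ereal) \<Rightarrow> bool" where
  "cs_points es ys \<longleftrightarrow> (\<forall>j\<le>length es. ys (Suc j) < ys j) \<and> ys (Suc (length es)) = 0"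

definition det2 :: "real \<times> real \<Rightarrow> real \<times> real \<Rightarrow> real" where
  "det2 a b = fst a * snd b - snd a * fst b"

definition cs_v1 :: "nat list \<Rightarrow> (nat \<Rightarrow> ereal) \<Rightarrow> real \<times> real \<Rightarrow> real \<times> real" where
  "cs_v1 es ys = (\<lambda>(x, y). (x / 2) *\<^sub>R (\<Sum>j=0..length es + 1.
     if ys j = \<infinity> then 0
     else (1 / sqrt (x\<^sup>2 + (y - real_of_ereal (ys j))\<^sup>2)) *\<^sub>R cs_ab es j))"

definition cs_v2 :: "nat list \<Rightarrow> (nat \<Rightarrow> ereal) \<Rightarrow> real \<times> real \<Rightarrow> real \<times> real" where
  "cs_v2 es ys = (\<lambda>(x, y). (1 / 2) *\<^sub>R (\<Sum>j=0..length es + 1.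
     if ys j = \<infinity> then - cs_ab es j
     else ((y - real_of_ereal (ys j)) / sqrt (x\<^sup>2 + (y - real_of_ereal (ys j))\<^sup>2)) *\<^sub>R cs_ab es j))"

text \<open>The metric does not depend on the point of \<open>T\<^sup>2\<close>. A tangent vector is a pair of its
  \<open>(dx, dy)\<close> and \<open>(dt\<^sub>1, dt\<^sub>2)\<close> components.\<close>

definition cs_metric ::
  "nat list \<Rightarrow> (nat \<Rightarrow> ereal) \<Rightarrow> real \<times> real \<Rightarrow>
    (real \<times> real) \<times> (real \<times> real) \<Rightarrow> (real \<times> real) \<times> (real \<times> real) \<Rightarrow> real" where
  "cs_metric es ys P = (\<lambda>(a, s) (b, t).
     let x = fst P; y = snd P; v1 = cs_v1 es ys P; v2 = cs_v2 es ys P in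
       x * det2 v1 v2 / (2 * (x\<^sup>2 + y\<^sup>2)) *
         (a \<bullet> b / x\<^sup>2 + (det2 v1 s * det2 v1 t + det2 v2 s * det2 v2 t) / (det2 v1 v2)\<^sup>2))"


section \<open>The end of \<open>Y\<^sub>p\<^sub>,\<^sub>q\<close>\<close>

type_synonym C2 = "complex \<times> complex"

definition same_orbit :: "nat \<Rightarrow> nat \<Rightarrow> C2 \<Rightarrow> C2 \<Rightarrow> bool" where
  "same_orbit p q z w \<longleftrightarrow>
     (\<exists>l::nat. w = (cis (2 * pi / real q) ^ l * fst z, cis (2 * pi / real q) ^ (p * l) * snd z))"

text \<open>The end of the compactified \<open>\<H> \<times> T\<^sup>2\<close> over a half-disc about the deleted point \<open>(0, 0)\<close>
  contains two boundary intervals: \<open>(0, y\<^sub>k)\<close>, over which the circle \<open>(m\<^sub>k\<^sub>+\<^sub>1, n\<^sub>k\<^sub>+\<^sub>1) = (q, p)\<close>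
  is collapsed, and an interval in \<open>y < 0\<close>, over which \<open>(m\<^sub>0, n\<^sub>0) = (0, -1)\<close> is collapsed. These
  two vectors span a sublattice of index \<open>q\<close>, so, with \<open>x = r\<^sup>-\<^sup>2 sin 2\<theta>\<close>, \<open>y = r\<^sup>-\<^sup>2 cos 2\<theta>\<close>,
    \<open>z = (r sin \<theta> exp (i \<phi>\<^sub>1), r cos \<theta> exp (i \<phi>\<^sub>2))\<close>,  \<open>t = \<phi>\<^sub>1 (q, p) + \<phi>\<^sub>2 (0, -1)\<close>,
  is a smooth covering of that end by \<open>{z \<noteq> 0. 1 / |z|\<^sup>2 < y\<^sub>k}\<close>, whose fibres are the orbits of
  the group \<open>\<Gamma>\<^sub>p\<^sub>,\<^sub>q\<close>; the collapsed boundary is covered by the two axes. The end is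
  therefore \<open>cs_end es ys / \<Gamma>\<^sub>p\<^sub>,\<^sub>q\<close>, also as a smooth manifold, and \<open>cs_end_metric\<close> is its metric
  lifted to \<open>cs_end es ys\<close>. Off the axes, \<open>d\<phi>\<^sub>i = Im (dz\<^sub>i / z\<^sub>i)\<close>. On the axes, the smooth
  extension of the metric is necessarily given by the limit from off the axes.\<close>

definition cs_end :: "nat list \<Rightarrow> (nat \<Rightarrow> ereal) \<Rightarrow> C2 set" where
  "cs_end es ys = {z. z \<noteq> 0 \<and> ereal (1 / (norm z)\<^sup>2) < ys (length es)}"

definition off_axes :: "C2 set" where
  "off_axes = {z. fst z \<noteq> 0 \<and> snd z \<noteq> 0}"

definition end_xy :: "C2 \<Rightarrow> real \<times> real" where
  "end_xy z = (2 * cmod (fst z) * cmod (snd z) / norm z ^ 4,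
               ((cmod (snd z))\<^sup>2 - (cmod (fst z))\<^sup>2) / norm z ^ 4)"

definition end_dt :: "nat list \<Rightarrow> C2 \<Rightarrow> C2 \<Rightarrow> real \<times> real" where
  "end_dt es z u = Im (fst u / fst z) *\<^sub>R hj_vec es (length es + 1) + Im (snd u / snd z) *\<^sub>R hj_vec es 0"

definition end_push :: "nat list \<Rightarrow> C2 \<Rightarrow> C2 \<Rightarrow> (real \<times> real) \<times> (real \<times> real)" where
  "end_push es z u = (frechet_derivative end_xy (at z) u, end_dt es z u)"

definition cs_end_metric :: "nat list \<Rightarrow> (nat \<Rightarrow> ereal) \<Rightarrow> C2 \<Rightarrow> C2 \<Rightarrow> C2 \<Rightarrow> real" where
  "cs_end_metric es ys z u v =
     Lim (at z within off_axes)
       (\<lambda>w. cs_metric es ys (end_xy w) (end_push es w u) (end_push es w v))"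


section \<open>Charts at infinity and mass\<close>

primrec Ck_on :: "nat \<Rightarrow> ('a::euclidean_space \<Rightarrow> 'b::euclidean_space) \<Rightarrow> 'a set \<Rightarrow> bool" where
  "Ck_on 0 f S \<longleftrightarrow> continuous_on S f"
| "Ck_on (Suc k) f S \<longleftrightarrow>
     (\<forall>x\<in>S. f differentiable (at x)) \<and> (\<forall>v. Ck_on k (\<lambda>x. frechet_derivative f (at x) v) S)"

text \<open>A diffeomorphism from the quotient by \<open>\<Gamma>\<^sub>p\<^sub>,\<^sub>q\<close> of the exterior of a ball in \<open>\<complex>\<^sup>2\<close> to the
  complement of a compact set in \<open>Y\<^sub>p\<^sub>,\<^sub>q\<close>, contained in the end above and taking infinity to infinity.
  It is represented by its lift \<open>F\<close> to the simply connected coverings.\<close>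

definition chart_at_infinity ::
  "nat \<Rightarrow> nat \<Rightarrow> nat list \<Rightarrow> (nat \<Rightarrow> ereal) \<Rightarrow> (C2 \<Rightarrow> C2) \<Rightarrow> bool" where
  "chart_at_infinity p q es ys F \<longleftrightarrow>
     (\<exists>R0>0. let D = {w. R0 < norm w} in
        (\<forall>k. Ck_on k F D) \<and> inj_on F D \<and> (\<forall>w\<in>D. inj (frechet_derivative F (at w))) \<and>
        F ` D \<subseteq> cs_end es ys \<and> (\<exists>R1. {z. R1 < norm z} \<subseteq> F ` D) \<and>
        (\<forall>w\<in>D. \<forall>w'\<in>D. same_orbit p q w w' \<longleftrightarrow> same_orbit p q (F w) (F w'))) \<and>
     filterlim F at_infinity at_infinity"

text \<open>The metric, rescaled by a constant \<open>c\<close>, read in the chart \<open>F\<close>.\<close>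

definition chart_metric ::
  "nat list \<Rightarrow> (nat \<Rightarrow> ereal) \<Rightarrow> real \<Rightarrow> (C2 \<Rightarrow> C2) \<Rightarrow> C2 \<Rightarrow> C2 \<Rightarrow> C2 \<Rightarrow> real" where
  "chart_metric es ys c F w u v =
     c * cs_end_metric es ys (F w) (frechet_derivative F (at w) u) (frechet_derivative F (at w) v)"

definition partial :: "C2 \<Rightarrow> (C2 \<Rightarrow> real) \<Rightarrow> C2 \<Rightarrow> real" where
  "partial i f w = frechet_derivative f (at w) i"

definition asymp_euclidean :: "real \<Rightarrow> (C2 \<Rightarrow> C2 \<Rightarrow> C2 \<Rightarrow> real) \<Rightarrow> bool" where
  "asymp_euclidean \<tau> H \<longleftrightarrow>
     (\<forall>i\<in>Basis. \<forall>j\<in>Basis.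
        (\<lambda>w. H w i j - i \<bullet> j) \<in> O[at_infinity](\<lambda>w. norm w powr (-\<tau>)) \<and>
        (\<forall>k\<in>Basis. partial k (\<lambda>w. H w i j) \<in> O[at_infinity](\<lambda>w. norm w powr (-\<tau> - 1))))"

text \<open>\<open>\<integral>\<^bsub>|w|=R\<^esub> f dvol\<close>, by integrating the radially constant extension of \<open>f\<close> in polar coordinates
  in real dimension 4: \<open>\<integral>\<^bsub>|w|<R\<^esub> f (R w / |w|) dw = (R / 4) \<integral>\<^bsub>|w|=R\<^esub> f dvol\<close>.\<close>

definition sphere_integral :: "real \<Rightarrow> (C2 \<Rightarrow> real) \<Rightarrow> real" where
  "sphere_integral R f = (4 / R) * (LINT w:ball 0 R|lborel. f ((R / norm w) *\<^sub>R w))"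

definition mass_flux :: "(C2 \<Rightarrow> C2 \<Rightarrow> C2 \<Rightarrow> real) \<Rightarrow> C2 \<Rightarrow> real" where
  "mass_flux H w =
     (\<Sum>i\<in>Basis. \<Sum>j\<in>Basis.
        (partial i (\<lambda>w. H w i j) w - partial j (\<lambda>w. H w i i) w) * ((w /\<^sub>R norm w) \<bullet> j))"

definition has_mass :: "(C2 \<Rightarrow> C2 \<Rightarrow> C2 \<Rightarrow> real) \<Rightarrow> real \<Rightarrow> bool" where
  "has_mass H m \<longleftrightarrow> ((\<lambda>R. 1 / (4 * pi\<^sup>2) * sphere_integral R (mass_flux H)) \<longlongrightarrow> m) at_top"


section \<open>Crepancy of the Hirzebruch--Jung resolution\<close>

definition holomorphic2_on :: "(C2 \<Rightarrow> complex) \<Rightarrow> C2 set \<Rightarrow> bool" where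
  "holomorphic2_on f U \<longleftrightarrow>
     (\<forall>w\<in>U. \<exists>a b. (f has_derivative (\<lambda>h. a * fst h + b * snd h)) (at w))"

definition jacobian2 :: "(C2 \<Rightarrow> C2) \<Rightarrow> C2 \<Rightarrow> complex" where
  "jacobian2 Z w =
     deriv (\<lambda>s. fst (Z (s, snd w))) (fst w) * deriv (\<lambda>s. snd (Z (fst w, s))) (snd w) -
     deriv (\<lambda>s. fst (Z (fst w, s))) (snd w) * deriv (\<lambda>s. snd (Z (s, snd w))) (fst w)"

text \<open>\<open>Y\<^sub>p\<^sub>,\<^sub>q\<close> is the toric surface of the fan with rays \<open>(m\<^sub>j, n\<^sub>j)\<close>, \<open>0 \<le> j \<le> k + 1\<close>. It is covered by
  charts \<open>\<complex>\<^sup>2\<close>, one for each \<open>0 \<le> j \<le> k\<close>, in which the torus point with coordinates \<open>w\<close> is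
  \<open>(w\<^sub>1^m\<^sub>j w\<^sub>2^m\<^sub>j\<^sub>+\<^sub>1, w\<^sub>1^n\<^sub>j w\<^sub>2^n\<^sub>j\<^sub>+\<^sub>1)\<close>. The quotient map of \<open>\<complex>\<^sup>2\<close> by \<open>\<Gamma>\<^sub>p\<^sub>,\<^sub>q\<close> takes \<open>z\<close> with
  \<open>z\<^sub>1 z\<^sub>2 \<noteq> 0\<close> to the torus point \<open>(z\<^sub>1^q, z\<^sub>1^p / z\<^sub>2)\<close>. Hence \<open>resolves p q es j w z\<close> holds if and only
  if the resolution takes \<open>w\<close> to the orbit of \<open>z\<close>.\<close>

definition resolves :: "nat \<Rightarrow> nat \<Rightarrow> nat list \<Rightarrow> nat \<Rightarrow> C2 \<Rightarrow> C2 \<Rightarrow> bool" where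
  "resolves p q es j w z \<longleftrightarrow> w \<in> off_axes \<and> z \<in> off_axes \<and>
     fst z ^ q = fst w powi fst (hj_dir es j) * snd w powi fst (hj_dir es (Suc j)) \<and>
     fst z ^ p / snd z = fst w powi snd (hj_dir es j) * snd w powi snd (hj_dir es (Suc j))"

text \<open>The \<open>q\<close>-canonical sheaf of \<open>\<complex>\<^sup>2 / \<Gamma>\<^sub>p\<^sub>,\<^sub>q\<close> is generated by the invariant form
  \<open>(dz\<^sub>1 \<and> dz\<^sub>2)\<^bsup>\<otimes>q\<^esup>\<close>. The resolution is crepant, \<open>K\<^sub>Y = \<pi>\<^sup>*K\<close>, if and only if the pull-back of this
  form, \<open>J(w) (dw\<^sub>1 \<and> dw\<^sub>2)\<^bsup>\<otimes>q\<^esup>\<close> in each chart, generates the \<open>q\<close>-canonical sheaf of \<open>Y\<^sub>p\<^sub>,\<^sub>q\<close>, i.e. if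
  \<open>J\<close> extends to a nowhere vanishing holomorphic function on each chart. The pull-back is computed
  with local holomorphic lifts \<open>Z\<close> of the resolution to \<open>\<complex>\<^sup>2\<close>.\<close>

definition crepant :: "nat \<Rightarrow> nat \<Rightarrow> nat list \<Rightarrow> bool" where
  "crepant p q es \<longleftrightarrow>
     (\<forall>j\<le>length es. \<exists>J. holomorphic2_on J UNIV \<and> (\<forall>w. J w \<noteq> 0) \<and>
        (\<forall>U Z. open U \<and> holomorphic2_on (fst \<circ> Z) U \<and> holomorphic2_on (snd \<circ> Z) U \<and>
               (\<forall>w\<in>U. resolves p q es j w (Z w))
           \<longrightarrow> (\<forall>w\<in>U. jacobian2 Z w ^ q = J w)))"

end

theory Submission
  imports Defs
begin

text \<open>On the end, in the coordinate \<open>z\<close>, the Calderbank--Singer metric is \<open>q (|dz|\<^sup>2 + h)\<close>, where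
  \<open>h(u, v) = |z|\<^sup>-\<^sup>4 (\<langle>Jz, Mz\<rangle> \<langle>u, v\<rangle> - \<langle>Jz, u\<rangle> \<langle>Mz, v\<rangle> - \<langle>Mz, u\<rangle> \<langle>Jz, v\<rangle>) + O(|z|\<^sup>-\<^sup>4)\<close>,
  \<open>J = i\<close>, \<open>M = diag (i \<omega>\<^sub>1, i \<omega>\<^sub>2)\<close>, and \<open>\<omega>\<^sub>1\<close>, \<open>\<omega>\<^sub>2\<close> are the components of \<open>\<Sum>\<^sub>j (a\<^sub>j, b\<^sub>j) / y\<^sub>j\<close>,
  \<open>j \<le> k\<close>, in the basis \<open>(q, p)\<close>, \<open>(0, -1)\<close>. The flux of the leading term through \<open>|z| = r\<close> has density
  \<open>4 r\<^sup>-\<^sup>5 \<langle>Jz, Mz\<rangle>\<close>, so the mass is a positive multiple of \<open>\<omega>\<^sub>1 + \<omega>\<^sub>2\<close>. Summation by parts gives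
  \<open>q (\<omega>\<^sub>1 + \<omega>\<^sub>2) = \<Sum>\<^sub>j (1 / y\<^sub>j - 1 / y\<^sub>j\<^sub>-\<^sub>1) (l\<^sub>j - q)\<close>, \<open>1 \<le> j \<le> k\<close>, where \<open>l\<close> is the linear form with value \<open>q\<close>
  at \<open>(0, -1)\<close> and \<open>(q, p)\<close>. As \<open>l\<^sub>j\<close> is convex in \<open>j\<close>, \<open>l\<^sub>j \<le> q\<close>; all are equalities if \<open>p = q - 1\<close>, and
  otherwise \<open>l\<^sub>1 = p + 1 < q\<close>.

  In another asymptotically Euclidean chart, the Koszul identity shows that the transition map is
  asymptotic to an orthogonal map \<open>A\<close>. To the order relevant for the mass this conjugates \<open>J\<close> and \<open>M\<close>
  by \<open>A\<close> and adds a deformation term whose flux is the divergence of an antisymmetric tensor.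

  The pulled-back \<open>q\<close>-canonical generator is, up to a constant, \<open>w\<^sub>1 ^ (l\<^sub>j - q) w\<^sub>2 ^ (l\<^sub>j\<^sub>+\<^sub>1 - q)\<close> in the
  \<open>j\<close>-th chart, so crepancy also means that all \<open>l\<^sub>j\<close> are equal to \<open>q\<close>.\<close>

section \<open>Functions decaying with their derivatives\<close>

text \<open>The threshold in every estimate is decay of order greater than 2: the mass integrand
  contains first derivatives of the metric and the sphere has volume of order R^3, so an error
  O(|w|^-\<mu>) with derivatives one order better contributes O(R^(2-\<mu>)). In an arbitrary chart
  the metric is Euclidean only to order \<tau>. Terms quadratic in the deviation are negligible
  because 2 \<tau> > 2, but the linear deformation term is not small and must be removed through its
  structure. The chart comes with no quantitative growth bound and no bound on its second
  derivatives; both are recovered from comparing the two metrics. A second obstacle is that the end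
  metric is given off the axes in polar-type coordinates, whereas decay of derivatives is needed
  across the axes. For this reason its coefficients are rewritten algebraically through functions
  that are smooth there, such as |z_1|^2 d\<phi>_1 and the squared sine and cosine of \<theta>. The
  divergence theorem is replaced by the invariance of sphere integrals under rotations.\<close>

definition decays :: "real \<Rightarrow> ('a::euclidean_space \<Rightarrow> real) \<Rightarrow> bool" where
  "decays m f \<longleftrightarrow> (\<exists>C f'. \<forall>\<^sub>F w in at_infinity. (f has_derivative f' w) (at w) \<and>
     \<bar>f w\<bar> \<le> C * norm w powr (-m) \<and> (\<forall>v. \<bar>f' w v\<bar> \<le> C * norm w powr (-m-1) * norm v))"

lemma decaysI:
  assumes "\<forall>\<^sub>F w in at_infinity. (f has_derivative f' w) (at w)"
    and "\<forall>\<^sub>F w in at_infinity. \<bar>f w\<bar> \<le> C * norm w powr (-m)"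
    and "\<forall>\<^sub>F w in at_infinity. \<forall>v. \<bar>f' w v\<bar> \<le> D * norm w powr (-m-1) * norm v"
  shows "decays m f"
  unfolding decays_def
proof (intro exI)
  show "\<forall>\<^sub>F w in at_infinity. (f has_derivative f' w) (at w) \<and>
     \<bar>f w\<bar> \<le> max C D * norm w powr (-m) \<and> (\<forall>v. \<bar>f' w v\<bar> \<le> max C D * norm w powr (-m-1) * norm v)"
    using assms
  proof eventually_elim
    case (elim w)
    have "C * norm w powr (-m) \<le> max C D * norm w powr (-m)"
      by (intro mult_right_mono) auto
    moreover have "D * norm w powr (-m-1) * norm v \<le> max C D * norm w powr (-m-1) * norm v" for v
      by (intro mult_right_mono) auto
    ultimately show ?case using elim by (meson order_trans)
  qed
qed

lemma decaysE:
  assumes "decays m f"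
  obtains C R f' where "C > 0" "R \<ge> 1" "\<And>w. norm w > R \<Longrightarrow> (f has_derivative f' w) (at w)"
    "\<And>w. norm w > R \<Longrightarrow> \<bar>f w\<bar> \<le> C * norm w powr (-m)"
    "\<And>w v. norm w > R \<Longrightarrow> \<bar>f' w v\<bar> \<le> C * norm w powr (-m-1) * norm v"
proof -
  obtain C f' where ev: "\<forall>\<^sub>F w in at_infinity. (f has_derivative f' w) (at w) \<and>
     \<bar>f w\<bar> \<le> C * norm w powr (-m) \<and> (\<forall>v. \<bar>f' w v\<bar> \<le> C * norm w powr (-m-1) * norm v)"
    using assms unfolding decays_def by blast
  then obtain b where b: "\<And>w. b \<le> norm w \<Longrightarrow> (f has_derivative f' w) (at w) \<and>
     \<bar>f w\<bar> \<le> C * norm w powr (-m) \<and> (\<forall>v. \<bar>f' w v\<bar> \<le> C * norm w powr (-m-1) * norm v)"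
    unfolding eventually_at_infinity by blast
  have le: "C * norm w powr (-m) \<le> max C 1 * norm w powr (-m)" for w :: 'a
      by (intro mult_right_mono) auto
  have le2: "C * norm w powr (-m-1) * norm v \<le> max C 1 * norm w powr (-m-1) * norm v" for v w :: 'a
      by (intro mult_right_mono) auto
  show thesis
  proof (rule that[of "max C 1" "max b 1" f'])
    fix w v :: 'a assume "norm w > max b 1"
    then have "b \<le> norm w" by simp
    note b[OF this]
    then show "(f has_derivative f' w) (at w)" "\<bar>f w\<bar> \<le> max C 1 * norm w powr (-m)"
      "\<bar>f' w v\<bar> \<le> max C 1 * norm w powr (-m-1) * norm v"
      using le[of w] le2[of w v] by (auto intro: order_trans)
  qed auto
qed

lemma eventually_norm_gt: "\<forall>\<^sub>F w in at_infinity. norm (w::'a::real_normed_vector) > R"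
  unfolding eventually_at_infinity by (rule exI[of _ "R+1"]) auto

text \<open>Neighbourhoods of infinity contain open exteriors of balls, so an identity valid near
  infinity may be differentiated there.\<close>

lemma eventually_at_infinity_open:
  assumes "\<forall>\<^sub>F w in at_infinity. P (w::'a::real_normed_vector)"
  shows "\<forall>\<^sub>F w in at_infinity. \<forall>\<^sub>F x in nhds w. P x"
proof -
  obtain b where b: "\<And>w. b \<le> norm w \<Longrightarrow> P w"
    using assms unfolding eventually_at_infinity by blast
  show ?thesis using eventually_norm_gt[of b]
  proof eventually_elim
    case (elim w)
    have "open {x::'a. b < norm x}" by (intro open_Collect_less continuous_intros)
    then have "\<forall>\<^sub>F x in nhds w. x \<in> {x. b < norm x}"
      using elim by (intro eventually_nhds_in_open) auto
    then show ?case by eventually_elim (auto intro: b)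
  qed
qed

lemma has_derivative_cong_nhds:
  assumes "(f has_derivative f') (at w)" "\<forall>\<^sub>F x in nhds w. f x = g x"
  shows "(g has_derivative f') (at w)"
proof -
  have "f w = g w" using assms(2) by (rule eventually_nhds_x_imp_x)
  moreover have "\<forall>\<^sub>F x in at w. f x = g x"
    using assms(2) by (rule eventually_at_filter[THEN iffD2, OF eventually_mono]) auto
  ultimately show ?thesis
    using has_derivative_transform_eventually[OF assms(1)] by auto
qed

lemma decays_cong:
  assumes "decays m f" "\<forall>\<^sub>F w in at_infinity. f w = g w"
  shows "decays m g"
proof -
  obtain C f' where ev: "\<forall>\<^sub>F w in at_infinity. (f has_derivative f' w) (at w) \<and>
     \<bar>f w\<bar> \<le> C * norm w powr (-m) \<and> (\<forall>v. \<bar>f' w v\<bar> \<le> C * norm w powr (-m-1) * norm v)"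
    using assms unfolding decays_def by blast
  show ?thesis unfolding decays_def
  proof (intro exI)
    show "\<forall>\<^sub>F w in at_infinity. (g has_derivative f' w) (at w) \<and>
      \<bar>g w\<bar> \<le> C * norm w powr (-m) \<and> (\<forall>v. \<bar>f' w v\<bar> \<le> C * norm w powr (-m-1) * norm v)"
      using ev eventually_at_infinity_open[OF assms(2)] assms(2)
      by eventually_elim (simp add: has_derivative_cong_nhds[of f])
  qed
qed

lemma decays_mono:
  assumes "decays m f" "n \<le> m" shows "decays n f"
proof -
  from decaysE[OF assms(1)] obtain C R f' where f: "C > 0" "R \<ge> 1" "\<And>w. norm w > R \<Longrightarrow> (f has_derivative f' w) (at w)"
    "\<And>w. norm w > R \<Longrightarrow> \<bar>f w\<bar> \<le> C * norm w powr (-m)"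
    "\<And>w v. norm w > R \<Longrightarrow> \<bar>f' w v\<bar> \<le> C * norm w powr (-m-1) * norm v" by metis
  have le: "norm w powr (-m) \<le> norm w powr (-n)" "norm w powr (-m-1) \<le> norm w powr (-n-1)"
    if "norm w > R" for w :: 'a
    using that f(2) assms(2) by (intro powr_mono; simp)+
  show ?thesis
  proof (rule decaysI[of f f' C _ C])
    show "\<forall>\<^sub>F w in at_infinity. \<bar>f w\<bar> \<le> C * norm w powr (-n)"
      using eventually_norm_gt[of R]
    proof eventually_elim
      case (elim w) show ?case using f(4)[OF elim] le(1)[OF elim] f(1)
        by (meson less_imp_le mult_left_mono order_trans)
    qed
    show "\<forall>\<^sub>F w in at_infinity. \<forall>v. \<bar>f' w v\<bar> \<le> C * norm w powr (-n-1) * norm v"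
      using eventually_norm_gt[of R]
    proof (eventually_elim, intro allI)
      fix w v :: 'a assume w: "norm w > R"
      have "C * norm w powr (-m-1) * norm v \<le> C * norm w powr (-n-1) * norm v"
        using le(2)[OF w] f(1) by (intro mult_right_mono mult_left_mono) auto
      then show "\<bar>f' w v\<bar> \<le> C * norm w powr (-n-1) * norm v" using f(5)[OF w, of v] by simp
    qed
    show "\<forall>\<^sub>F w in at_infinity. (f has_derivative f' w) (at w)"
      using eventually_norm_gt[of R] by eventually_elim (rule f(3))
  qed
qed

lemma decays_const: "decays 0 (\<lambda>_. c)"
proof (rule decaysI[of _ "\<lambda>_ _. 0" "\<bar>c\<bar>" _ 0])
  show "\<forall>\<^sub>F w in at_infinity. \<bar>c\<bar> \<le> \<bar>c\<bar> * norm (w::'a) powr (-0)"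
    using eventually_norm_gt[of 0] by eventually_elim auto
qed (auto)

lemma decays_zero: "decays m (\<lambda>_. 0)"
  by (rule decaysI[of _ "\<lambda>_ _. 0" 0 _ 0]) auto

lemma decays_coord:
  fixes b :: "'a::euclidean_space"
  shows "decays (-1) (\<lambda>w. w \<bullet> b)"
proof (rule decaysI[of _ "\<lambda>_ v. v \<bullet> b" "norm b" _ "norm b"])
  show "\<forall>\<^sub>F w in at_infinity. \<bar>w \<bullet> b\<bar> \<le> norm b * norm w powr (-(-1))"
    by (intro always_eventually allI) (use Cauchy_Schwarz_ineq2 in \<open>auto simp: mult.commute\<close>)
  show "\<forall>\<^sub>F w::'a in at_infinity. \<forall>v. \<bar>v \<bullet> b\<bar> \<le> norm b * norm w powr (-(-1)-1) * norm v"
    using eventually_norm_gt[of 0]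
    by eventually_elim (use Cauchy_Schwarz_ineq2 in \<open>auto simp: mult.commute\<close>)
qed (auto intro!: always_eventually derivative_eq_intros)

lemma decays_add:
  assumes "decays m f" "decays m g" shows "decays m (\<lambda>w. f w + g w)"
proof -
  from decaysE[OF assms(1)] obtain C R f' where f: "C > 0" "R \<ge> 1" "\<And>w. norm w > R \<Longrightarrow> (f has_derivative f' w) (at w)"
    "\<And>w. norm w > R \<Longrightarrow> \<bar>f w\<bar> \<le> C * norm w powr (-m)"
    "\<And>w v. norm w > R \<Longrightarrow> \<bar>f' w v\<bar> \<le> C * norm w powr (-m-1) * norm v" by metis
  from decaysE[OF assms(2)] obtain D S g' where g: "D > 0" "S \<ge> 1" "\<And>w. norm w > S \<Longrightarrow> (g has_derivative g' w) (at w)"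
    "\<And>w. norm w > S \<Longrightarrow> \<bar>g w\<bar> \<le> D * norm w powr (-m)"
    "\<And>w v. norm w > S \<Longrightarrow> \<bar>g' w v\<bar> \<le> D * norm w powr (-m-1) * norm v" by metis
  show ?thesis
  proof (rule decaysI[of _ "\<lambda>w v. f' w v + g' w v" "C+D" _ "C+D"])
    show "\<forall>\<^sub>F w in at_infinity. ((\<lambda>w. f w + g w) has_derivative (\<lambda>v. f' w v + g' w v)) (at w)"
      using eventually_norm_gt[of R] eventually_norm_gt[of S]
      by eventually_elim (intro has_derivative_add f g)
    show "\<forall>\<^sub>F w in at_infinity. \<bar>f w + g w\<bar> \<le> (C + D) * norm w powr - m"
      using eventually_norm_gt[of R] eventually_norm_gt[of S]
    proof eventually_elim
      case (elim w)
      show ?case using f(4)[OF elim(1)] g(4)[OF elim(2)] by (simp add: algebra_simps)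
    qed
    show "\<forall>\<^sub>F w in at_infinity. \<forall>v. \<bar>f' w v + g' w v\<bar> \<le> (C + D) * norm w powr (- m - 1) * norm v"
      using eventually_norm_gt[of R] eventually_norm_gt[of S]
    proof (eventually_elim, intro allI)
      fix w v :: 'a assume w: "norm w > R" "norm w > S"
      show "\<bar>f' w v + g' w v\<bar> \<le> (C + D) * norm w powr (- m - 1) * norm v"
        using f(5)[OF w(1), of v] g(5)[OF w(2), of v] by (simp add: algebra_simps)
    qed
  qed
qed

lemma decays_mult:
  assumes "decays m f" "decays n g" shows "decays (m + n) (\<lambda>w. f w * g w)"
proof -
  from decaysE[OF assms(1)] obtain C R f' where f: "C > 0" "R \<ge> 1" "\<And>w. norm w > R \<Longrightarrow> (f has_derivative f' w) (at w)"
    "\<And>w. norm w > R \<Longrightarrow> \<bar>f w\<bar> \<le> C * norm w powr (-m)"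
    "\<And>w v. norm w > R \<Longrightarrow> \<bar>f' w v\<bar> \<le> C * norm w powr (-m-1) * norm v" by metis
  from decaysE[OF assms(2)] obtain D S g' where g: "D > 0" "S \<ge> 1" "\<And>w. norm w > S \<Longrightarrow> (g has_derivative g' w) (at w)"
    "\<And>w. norm w > S \<Longrightarrow> \<bar>g w\<bar> \<le> D * norm w powr (-n)"
    "\<And>w v. norm w > S \<Longrightarrow> \<bar>g' w v\<bar> \<le> D * norm w powr (-n-1) * norm v" by metis
  show ?thesis
  proof (rule decaysI[of _ "\<lambda>w v. f w * g' w v + f' w v * g w" "C*D" _ "2*C*D"])
    show "\<forall>\<^sub>F w in at_infinity. ((\<lambda>w. f w * g w) has_derivative (\<lambda>v. f w * g' w v + f' w v * g w)) (at w)"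
      using eventually_norm_gt[of R] eventually_norm_gt[of S]
      by eventually_elim (intro has_derivative_mult f g)
    show "\<forall>\<^sub>F w in at_infinity. \<bar>f w * g w\<bar> \<le> (C * D) * norm w powr - (m+n)"
      using eventually_norm_gt[of R] eventually_norm_gt[of S]
    proof eventually_elim
      case (elim w)
      have "\<bar>f w\<bar> * \<bar>g w\<bar> \<le> (C * norm w powr -m) * (D * norm w powr -n)"
        using f(4)[OF elim(1)] g(4)[OF elim(2)] f(1) by (intro mult_mono) auto
      then show ?case by (simp add: abs_mult powr_add[symmetric] mult_ac)
    qed
    show "\<forall>\<^sub>F w in at_infinity. \<forall>v. \<bar>f w * g' w v + f' w v * g w\<bar> \<le> 2*C * D * norm w powr (- (m+n) - 1) * norm v"
      using eventually_norm_gt[of R] eventually_norm_gt[of S]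
    proof (eventually_elim, intro allI)
      fix w v :: 'a assume elim: "norm w > R" "norm w > S"
      have "\<bar>f w\<bar> * \<bar>g' w v\<bar> \<le> (C * norm w powr -m) * (D * norm w powr (-n-1) * norm v)"
        using f(4)[OF elim(1)] g(5)[OF elim(2)] f(1) by (intro mult_mono) auto
      moreover have "\<bar>f' w v\<bar> * \<bar>g w\<bar> \<le> (C * norm w powr (-m-1) * norm v) * (D * norm w powr (-n))"
        using f(5)[OF elim(1)] g(4)[OF elim(2)] f(1) by (intro mult_mono) auto
      moreover have "norm w powr -m * norm w powr (-n-1) = norm w powr (-(m+n)-1)"
        "norm w powr (-m-1) * norm w powr (-n) = norm w powr (-(m+n)-1)"
        by (simp_all add: powr_add[symmetric] algebra_simps)
      moreover have "(C * norm w powr -m) * (D * norm w powr (-n-1) * norm v) = C * D * (norm w powr -m * norm w powr (-n-1)) * norm v"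
        "(C * norm w powr (-m-1) * norm v) * (D * norm w powr (-n)) = C * D * (norm w powr (-m-1) * norm w powr (-n)) * norm v"
        by (simp_all only: mult_ac)
      ultimately have "\<bar>f w\<bar> * \<bar>g' w v\<bar> \<le> C * D * norm w powr (- (m+n) - 1) * norm v"
        "\<bar>f' w v\<bar> * \<bar>g w\<bar> \<le> C * D * norm w powr (- (m+n) - 1) * norm v" by simp_all
      then have "\<bar>f w * g' w v\<bar> + \<bar>f' w v * g w\<bar> \<le> 2 * (C * D * norm w powr (- (m+n) - 1) * norm v)"
        by (simp only: abs_mult)
      then show "\<bar>f w * g' w v + f' w v * g w\<bar> \<le> 2*C * D * norm w powr (- (m+n) - 1) * norm v"
        using abs_triangle_ineq[of "f w * g' w v" "f' w v * g w"] by (simp only: mult.assoc)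
    qed
  qed
qed

lemma decays_cmult: "decays m f \<Longrightarrow> decays m (\<lambda>w. c * f w)"
  using decays_mult[OF decays_const, of m f c] by simp

lemma decays_minus: "decays m f \<Longrightarrow> decays m (\<lambda>w. - f w)"
  using decays_cmult[of m f "-1"] by simp

lemma decays_diff: "decays m f \<Longrightarrow> decays m g \<Longrightarrow> decays m (\<lambda>w. f w - g w)"
  using decays_add[OF _ decays_minus, of m f g] by simp

lemma decays_sum: "(\<And>i. i \<in> I \<Longrightarrow> decays m (f i)) \<Longrightarrow> decays m (\<lambda>w. \<Sum>i\<in>I. f i w)"
  by (induction I rule: infinite_finite_induct) (auto intro: decays_zero decays_add)

lemma decays_mult':
  assumes "decays m f" "decays n g" "l \<le> m + n" shows "decays l (\<lambda>w. f w * g w)"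
  by (rule decays_mono[OF decays_mult[OF assms(1,2)] assms(3)])

text \<open>The lower bound has the same order as the upper one, so the weight is exact: f' / f^2
  has order (m + 1) - 2m, one better than 1 / f.\<close>

lemma decays_inverse:
  assumes "decays m f" "c > 0" "\<forall>\<^sub>F w in at_infinity. \<bar>f w\<bar> \<ge> c * norm w powr (-m)"
  shows "decays (-m) (\<lambda>w. inverse (f w))"
proof -
  from decaysE[OF assms(1)] obtain C R f' where f: "C > 0" "R \<ge> 1" "\<And>w. norm w > R \<Longrightarrow> (f has_derivative f' w) (at w)"
    "\<And>w. norm w > R \<Longrightarrow> \<bar>f w\<bar> \<le> C * norm w powr (-m)"
    "\<And>w v. norm w > R \<Longrightarrow> \<bar>f' w v\<bar> \<le> C * norm w powr (-m-1) * norm v" by metis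
  have inv: "\<bar>inverse (f w)\<bar> \<le> 1/c * norm w powr (-(-m))" and nz: "f w \<noteq> 0"
    if "\<bar>f w\<bar> \<ge> c * norm w powr (-m)" "norm w > R" for w
  proof -
    have "norm w > 0" using that(2) f(2) by linarith
    then have pos: "c * norm w powr (-m) > 0" using assms(2) by simp
    then show "f w \<noteq> 0" using that(1) by auto
    have "\<bar>inverse (f w)\<bar> = inverse \<bar>f w\<bar>" by simp
    also have "\<dots> \<le> inverse (c * norm w powr (-m))" using that(1) pos by (rule le_imp_inverse_le)
    also have "\<dots> = 1/c * norm w powr (-(-m))" by (simp add: powr_minus field_simps)
    finally show "\<bar>inverse (f w)\<bar> \<le> 1/c * norm w powr (-(-m))" .
  qed
  show ?thesis
  proof (rule decaysI[of _ "\<lambda>w v. - (inverse (f w) * f' w v * inverse (f w))" "1/c" _ "1/c*C*(1/c)"])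
    show "\<forall>\<^sub>F w in at_infinity. ((\<lambda>w. inverse (f w)) has_derivative (\<lambda>v. - (inverse (f w) * f' w v * inverse (f w)))) (at w)"
      using eventually_norm_gt[of R] assms(3)
      by eventually_elim (rule Deriv.has_derivative_inverse[OF nz f(3)])
    show "\<forall>\<^sub>F w in at_infinity. \<bar>inverse (f w)\<bar> \<le> 1/c * norm w powr (-(-m))"
      using eventually_norm_gt[of R] assms(3) by eventually_elim (rule inv)
    show "\<forall>\<^sub>F w in at_infinity. \<forall>v. \<bar>- (inverse (f w) * f' w v * inverse (f w))\<bar> \<le> 1/c*C*(1/c) * norm w powr (- (-m) - 1) * norm v"
      using eventually_norm_gt[of R] assms(3)
    proof (eventually_elim, intro allI)
      fix w v :: 'a assume w: "norm w > R" "\<bar>f w\<bar> \<ge> c * norm w powr (-m)"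
      have "\<bar>inverse (f w)\<bar> * \<bar>f' w v\<bar> * \<bar>inverse (f w)\<bar> \<le>
         (1/c * norm w powr (-(-m))) * (C * norm w powr (-m-1) * norm v) * (1/c * norm w powr (-(-m)))"
        using inv[OF w(2,1)] f(5)[OF w(1), of v] f(1) assms(2)
        by (intro mult_mono mult_nonneg_nonneg) auto
      also have "\<dots> = 1/c*C*(1/c) * (norm w powr (-(-m)) * norm w powr (-m-1) * norm w powr (-(-m))) * norm v"
        by (simp add: mult_ac)
      also have "norm w powr (-(-m)) * norm w powr (-m-1) * norm w powr (-(-m)) = norm w powr (- (-m) - 1)"
        by (simp only: powr_add[symmetric]) (simp add: algebra_simps)
      finally show "\<bar>- (inverse (f w) * f' w v * inverse (f w))\<bar> \<le> 1/c*C*(1/c) * norm w powr (- (-m) - 1) * norm v"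
        by (simp add: abs_mult)
    qed
  qed
qed

lemma decays_tendsto:
  assumes "decays m f" "m > 0" shows "(f \<longlongrightarrow> 0) at_infinity"
proof -
  from decaysE[OF assms(1)] obtain C R f' where f: "C > 0" "R \<ge> 1"
    "\<And>w. norm w > R \<Longrightarrow> \<bar>f w\<bar> \<le> C * norm w powr (-m)" by metis
  have "((\<lambda>w::'a. C * norm w powr (-m)) \<longlongrightarrow> C * 0) at_infinity"
    using assms(2) by (intro tendsto_mult tendsto_const tendsto_neg_powr filterlim_norm_at_top) auto
  moreover have "\<forall>\<^sub>F w in at_infinity. norm (f w) \<le> C * norm w powr (-m)"
    using eventually_norm_gt[of R] by eventually_elim (simp add: f(3))
  ultimately show ?thesis
    by (intro Lim_null_comparison[of f "\<lambda>w. C * norm w powr (-m)"]) auto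
qed

lemma decays_sqrt:
  assumes "decays 0 f" "c > 0" "\<forall>\<^sub>F w in at_infinity. f w \<ge> c"
  shows "decays 0 (\<lambda>w. sqrt (f w))"
proof -
  from decaysE[OF assms(1)] obtain C R f' where f: "C > 0" "R \<ge> 1" "\<And>w. norm w > R \<Longrightarrow> (f has_derivative f' w) (at w)"
    "\<And>w. norm w > R \<Longrightarrow> \<bar>f w\<bar> \<le> C * norm w powr (-0)"
    "\<And>w v. norm w > R \<Longrightarrow> \<bar>f' w v\<bar> \<le> C * norm w powr (-0-1) * norm v" by metis
  show ?thesis
  proof (rule decaysI[of _ "\<lambda>w v. f' w v * (inverse (sqrt (f w)) / 2)" "sqrt C" _ "C * (inverse (sqrt c) / 2)"])
    show "\<forall>\<^sub>F w in at_infinity. ((\<lambda>w. sqrt (f w)) has_derivative (\<lambda>v. f' w v * (inverse (sqrt (f w)) / 2))) (at w)"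
      using eventually_norm_gt[of R] assms(3)
    proof eventually_elim
      case (elim w)
      have "(sqrt has_derivative (\<lambda>v. v * (inverse (sqrt (f w)) / 2))) (at (f w))"
        using DERIV_real_sqrt[of "f w"] elim assms(2) by (simp add: has_field_derivative_def mult.commute[of _ "inverse (sqrt (f w)) / 2"] del: times_divide_eq_right times_divide_eq_left)
      from has_derivative_compose[OF f(3)[OF elim(1)] this] show ?case .
    qed
    show "\<forall>\<^sub>F w in at_infinity. \<bar>sqrt (f w)\<bar> \<le> sqrt C * norm w powr (-0)"
      using eventually_norm_gt[of R] assms(3)
    proof eventually_elim
      case (elim w)
      have "norm w \<noteq> 0" using elim(1) f(2) by linarith
      then show ?case using f(4)[OF elim(1)] elim(2) assms(2) by simp
    qed
    show "\<forall>\<^sub>F w in at_infinity. \<forall>v. \<bar>f' w v * (inverse (sqrt (f w)) / 2)\<bar> \<le> C * (inverse (sqrt c) / 2) * norm w powr (-0-1) * norm v"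
      using eventually_norm_gt[of R] assms(3)
    proof (eventually_elim, intro allI)
      fix w v :: 'a assume w: "norm w > R" "f w \<ge> c"
      have "\<bar>f' w v\<bar> * \<bar>inverse (sqrt (f w)) / 2\<bar> \<le> (C * norm w powr (-0-1) * norm v) * (inverse (sqrt c) / 2)"
        using f(5)[OF w(1), of v] w assms(2) f(1)
        by (intro mult_mono) (auto simp: field_simps)
      then show "\<bar>f' w v * (inverse (sqrt (f w)) / 2)\<bar> \<le> C * (inverse (sqrt c) / 2) * norm w powr (-0-1) * norm v"
        by (simp add: abs_mult mult_ac)
    qed
  qed
qed

lemma decays_inner_self:
  "decays 2 (\<lambda>w::'a::euclidean_space. inverse (w \<bullet> w))"
proof -
  have "decays (-2) (\<lambda>w::'a. \<Sum>i\<in>Basis. (w \<bullet> i) * (w \<bullet> i))"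
    by (intro decays_sum decays_mult'[OF decays_coord decays_coord]) simp
  then have "decays (-2) (\<lambda>w::'a. w \<bullet> w)"
    by (simp add: euclidean_inner[symmetric])
  moreover have "\<forall>\<^sub>F w::'a in at_infinity. \<bar>w \<bullet> w\<bar> \<ge> 1 * norm w powr (-(-2))"
    by (simp add: power2_norm_eq_inner[symmetric] powr_numeral)
  ultimately have "decays (-(-2)) (\<lambda>w::'a. inverse (w \<bullet> w))"
    by (rule decays_inverse[OF _ zero_less_one])
  then show ?thesis by simp
qed

text \<open>For \<open>m \<ge> 0\<close> the weight decreases with the norm, so a linear lower bound
  on |G| suffices to compare the weights at G w and at w; the bound on \<open>G'\<close> serves the
  chain rule.\<close>

lemma decays_compose:
  fixes G :: "'a::euclidean_space \<Rightarrow> 'b::euclidean_space"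
  assumes f: "decays m f" and m: "m \<ge> 0" and c: "c > 0"
    and lower: "\<forall>\<^sub>F w in at_infinity. norm (G w) \<ge> c * norm w"
    and der: "\<forall>\<^sub>F w in at_infinity. (G has_derivative G' w) (at w)"
    and bd: "\<forall>\<^sub>F w in at_infinity. \<forall>v. norm (G' w v) \<le> K * norm v"
  shows "decays m (\<lambda>w. f (G w))"
proof -
  from decaysE[OF f] obtain C R f' where f: "C > 0" "R \<ge> 1" "\<And>w. norm w > R \<Longrightarrow> (f has_derivative f' w) (at w)"
    "\<And>w. norm w > R \<Longrightarrow> \<bar>f w\<bar> \<le> C * norm w powr (-m)"
    "\<And>w v. norm w > R \<Longrightarrow> \<bar>f' w v\<bar> \<le> C * norm w powr (-m-1) * norm v" by metis
  have large: "\<forall>\<^sub>F w in at_infinity. norm (G w) > R"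
    using lower eventually_norm_gt[of "R/c"]
    by eventually_elim (use c in \<open>auto simp: field_simps intro: less_le_trans\<close>)
  have pw: "norm (G w) powr (-l) \<le> c powr (-l) * norm w powr (-l)"
    if "norm (G w) \<ge> c * norm w" "norm w > 0" "l \<ge> 0" for w l
  proof -
    have "norm (G w) powr (-l) \<le> (c * norm w) powr (-l)"
      using that c by (intro powr_mono2') auto
    then show ?thesis using c by (simp add: powr_mult)
  qed
  show ?thesis
  proof (rule decaysI[of _ "\<lambda>w v. f' (G w) (G' w v)" "C * c powr (-m)" _ "C * c powr (-m-1) * \<bar>K\<bar>"])
    show "\<forall>\<^sub>F w in at_infinity. ((\<lambda>w. f (G w)) has_derivative (\<lambda>v. f' (G w) (G' w v))) (at w)"
      using large der by eventually_elim (rule has_derivative_compose, auto intro: f)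
    show "\<forall>\<^sub>F w in at_infinity. \<bar>f (G w)\<bar> \<le> C * c powr (-m) * norm w powr (-m)"
      using large lower eventually_norm_gt[of 0]
    proof eventually_elim
      case (elim w)
      have "C * norm (G w) powr (-m) \<le> C * (c powr (-m) * norm w powr (-m))"
        using elim m f(1) by (intro mult_left_mono pw) auto
      then show ?case using f(4)[OF elim(1)] by (simp add: mult.assoc)
    qed
    show "\<forall>\<^sub>F w in at_infinity. \<forall>v. \<bar>f' (G w) (G' w v)\<bar> \<le> C * c powr (-m-1) * \<bar>K\<bar> * norm w powr (-m-1) * norm v"
      using large lower eventually_norm_gt[of 0] bd
    proof (eventually_elim, intro allI)
      fix w v assume w: "norm (G w) > R" "norm (G w) \<ge> c * norm w" "norm w > 0" "\<forall>v. norm (G' w v) \<le> K * norm v"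
      have "\<bar>f' (G w) (G' w v)\<bar> \<le> C * norm (G w) powr (-m-1) * norm (G' w v)"
        by (rule f(5)[OF w(1)])
      also have "\<dots> \<le> C * (c powr (-m-1) * norm w powr (-m-1)) * (\<bar>K\<bar> * norm v)"
      proof (intro mult_mono mult_left_mono)
        show "norm (G w) powr (-m-1) \<le> c powr (-m-1) * norm w powr (-m-1)"
          using pw[OF w(2,3), of "m+1"] m by simp
        show "norm (G' w v) \<le> \<bar>K\<bar> * norm v"
          using w(4) by (smt (verit) abs_ge_self mult_right_mono norm_ge_zero)
      qed (use f(1) in auto)
      finally show "\<bar>f' (G w) (G' w v)\<bar> \<le> C * c powr (-m-1) * \<bar>K\<bar> * norm w powr (-m-1) * norm v"
        by (simp add: mult_ac)
    qed
  qed
qed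

lemma decays_imp_partial:
  assumes "decays m f"
  obtains C R where "C > 0" "R \<ge> 1" "\<And>w. norm w > R \<Longrightarrow> f differentiable (at w)"
    "\<And>w. norm w > R \<Longrightarrow> \<bar>f w\<bar> \<le> C * norm w powr (-m)"
    "\<And>w v. norm w > R \<Longrightarrow> \<bar>frechet_derivative f (at w) v\<bar> \<le> C * norm w powr (-m-1) * norm v"
proof -
  from decaysE[OF assms(1)] obtain C R f' where f: "C > 0" "R \<ge> 1" "\<And>w. norm w > R \<Longrightarrow> (f has_derivative f' w) (at w)"
    "\<And>w. norm w > R \<Longrightarrow> \<bar>f w\<bar> \<le> C * norm w powr (-m)"
    "\<And>w v. norm w > R \<Longrightarrow> \<bar>f' w v\<bar> \<le> C * norm w powr (-m-1) * norm v" by metis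
  show thesis
  proof (rule that[of C R])
    fix w v :: 'a assume w: "norm w > R"
    show "\<bar>frechet_derivative f (at w) v\<bar> \<le> C * norm w powr (-m-1) * norm v"
      using f(5)[OF w, of v] frechet_derivative_at[OF f(3)[OF w]] by simp
  qed (use f in \<open>auto simp: differentiable_def\<close>)
qed

section \<open>Hirzebruch--Jung continued fractions\<close>

text \<open>A continued fraction with a free innermost entry: appending a partial quotient at the
  end becomes a substitution for \<open>t\<close>, whereas \<open>hj_frac\<close> unfolds from the
  front.\<close>

fun hj_tail :: "nat list \<Rightarrow> rat \<Rightarrow> rat" where
  "hj_tail [] t = t"
| "hj_tail (e # es) t = 1 / (of_nat e - hj_tail es t)"

lemma hj_frac_eq_tail: "hj_frac es = hj_tail es 0"
  by (induction es) auto

lemma hj_tail_append: "hj_tail (es @ [e]) t = hj_tail es (1 / (of_nat e - t))"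
  by (induction es) auto

text \<open>Three-term recurrence of the convergents. The list is indexed from 0, so
  \<open>es ! j\<close> is the entry e_(j+1); the start values 0, 1 and -1, 0 encode (m_0, n_0) =
  (0, -1) and (m_1, n_1) = (1, 0).\<close>

fun hj_rec :: "nat list \<Rightarrow> int \<Rightarrow> int \<Rightarrow> nat \<Rightarrow> int" where
  "hj_rec es a b 0 = a"
| "hj_rec es a b (Suc 0) = b"
| "hj_rec es a b (Suc (Suc j)) = int (es ! j) * hj_rec es a b (Suc j) - hj_rec es a b j"

abbreviation hj_m :: "nat list \<Rightarrow> nat \<Rightarrow> int" where "hj_m es \<equiv> hj_rec es 0 1"
abbreviation hj_n :: "nat list \<Rightarrow> nat \<Rightarrow> int" where "hj_n es \<equiv> hj_rec es (-1) 0"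

text \<open>The recurrence preserves determinants: neighbouring rays form a lattice basis, which is
  smoothness of the toric charts.\<close>

lemma hj_det: "hj_m es j * hj_n es (Suc j) - hj_m es (Suc j) * hj_n es j = 1"
  by (induction j) (auto simp: algebra_simps)

lemma hj_m_mono:
  assumes "\<forall>e\<in>set es. 2 \<le> e" "j \<le> length es"
  shows "0 \<le> hj_m es j \<and> hj_m es j < hj_m es (Suc j)"
  using assms(2)
proof (induction j)
  case (Suc j)
  then have "2 \<le> es ! j" using assms(1) by simp
  then have "2 * hj_m es (Suc j) \<le> int (es ! j) * hj_m es (Suc j)"
    using Suc by (intro mult_right_mono) auto
  moreover have "hj_m es (Suc (Suc j)) = int (es ! j) * hj_m es (Suc j) - hj_m es j" by simp
  moreover have "0 \<le> hj_m es j" "hj_m es j < hj_m es (Suc j)" using Suc by auto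
  ultimately show ?case by (intro conjI; linarith)
qed simp

text \<open>A finite continued fraction is a Moebius transformation of its tail, whose matrix
  consists of two consecutive convergents.\<close>

lemma hj_tail_take:
  assumes "\<forall>e\<in>set es. 2 \<le> e" "j \<le> length es" "0 \<le> t" "t < 1"
  shows "hj_tail (take j es) t =
    (of_int (hj_n es (Suc j)) - t * of_int (hj_n es j)) / (of_int (hj_m es (Suc j)) - t * of_int (hj_m es j))"
  using assms(2-4)
proof (induction j arbitrary: t)
  case (Suc j)
  let ?e = "of_nat (es ! j) :: rat"
  have "2 \<le> es ! j" using assms(1) Suc.prems by simp
  then have e: "2 \<le> ?e" by (metis of_nat_le_iff of_nat_numeral)
  \<comment> \<open>From e >= 2 and t < 1 the new tail 1 / (e - t) is again in [0, 1), so the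
    hypothesis on t is inherited.\<close>
  have pos: "?e - t > 1" using e Suc.prems by linarith
  have t: "0 \<le> 1 / (?e - t)" "1 / (?e - t) < 1" using pos by auto
  have clear: "(a - 1 / d * b) / (a' - 1 / d * b') = (d * a - b) / (d * a' - b')" if "d > 1" for a b a' b' d :: rat
  proof -
    have "d * (a - 1 / d * b) = d * a - b" "d * (a' - 1 / d * b') = d * a' - b'"
      using that by (auto simp: field_simps)
    then show ?thesis using that
      by (metis less_irrefl mult_divide_mult_cancel_left not_one_less_zero)
  qed
  have "hj_tail (take (Suc j) es) t = hj_tail (take j es) (1 / (?e - t))"
    using Suc.prems by (simp add: take_Suc_conv_app_nth hj_tail_append)
  also have "\<dots> = ((?e - t) * of_int (hj_n es (Suc j)) - of_int (hj_n es j)) /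
     ((?e - t) * of_int (hj_m es (Suc j)) - of_int (hj_m es j))"
    by (subst Suc.IH) (use Suc.prems t clear[OF pos] in auto)
  finally show ?case by (simp add: algebra_simps)
qed simp

text \<open>A common divisor of numerator and denominator divides the determinant 1 of
  \<open>hj_det\<close>, so the fraction is already reduced.\<close>

lemma quotient_of_hj_frac_take:
  assumes "\<forall>e\<in>set es. 2 \<le> e" "j \<le> length es"
  shows "quotient_of (hj_frac (take j es)) = (hj_n es (Suc j), hj_m es (Suc j))"
proof -
  have "hj_frac (take j es) = Fract (hj_n es (Suc j)) (hj_m es (Suc j))"
    using hj_tail_take[OF assms, of 0] by (simp add: hj_frac_eq_tail Fract_of_int_quotient)
  moreover have "coprime (hj_n es (Suc j)) (hj_m es (Suc j))"
  proof (rule coprimeI)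
    fix d assume "d dvd hj_n es (Suc j)" "d dvd hj_m es (Suc j)"
    then have "d dvd hj_m es j * hj_n es (Suc j) - hj_m es (Suc j) * hj_n es j" by simp
    then show "is_unit d" by (simp add: hj_det)
  qed
  moreover have "0 < hj_m es (Suc j)" using hj_m_mono[OF assms] by simp
  ultimately show ?thesis by (simp add: quotient_of_Fract normalize_stable)
qed

lemma hj_dir_eq:
  assumes "\<forall>e\<in>set es. 2 \<le> e" "j \<le> length es + 1"
  shows "hj_dir es j = (hj_m es j, hj_n es j)"
proof (cases j)
  case (Suc i)
  then show ?thesis using assms quotient_of_hj_frac_take[of es i] by (simp add: hj_dir_def)
qed (simp add: hj_dir_def)

locale hirzebruch_jung =
  fixes p q :: nat and es :: "nat list"
  assumes p: "0 < p" and pq: "p < q" and cop: "coprime p q" and exp: "hj_expansion p q es"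
begin

lemma two_le: "\<forall>e\<in>set es. 2 \<le> e"
  using exp by (simp add: hj_expansion_def)

lemma es_nonempty: "0 < length es"
  using exp p pq by (auto simp: hj_expansion_def)

lemma last_dir: "hj_m es (Suc (length es)) = int q" "hj_n es (Suc (length es)) = int p"
proof -
  have "quotient_of (hj_frac es) = (int p, int q)"
  proof -
    have "hj_frac es = Fract (int p) (int q)"
      using exp by (simp add: hj_expansion_def Fract_of_int_quotient)
    then show ?thesis using cop p pq by (simp add: quotient_of_Fract normalize_stable coprime_int_iff)
  qed
  then show "hj_m es (Suc (length es)) = int q" "hj_n es (Suc (length es)) = int p"
    using quotient_of_hj_frac_take[OF two_le, of "length es"] by auto
qed

text \<open>\<open>level j\<close> is \<open>q\<close> times the value at \<open>(m\<^sub>j, n\<^sub>j)\<close> of the linear form taking the value 1 at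
  both \<open>(0, -1)\<close> and \<open>(q, p)\<close>; \<open>level j / q - 1\<close> is the discrepancy of the \<open>j\<close>-th exceptional curve.\<close>

definition level :: "nat \<Rightarrow> int" where
  "level j = (int p + 1) * hj_m es j - int q * hj_n es j"

section \<open>Convexity of the discrepancies\<close>

lemma level_0: "level 0 = int q" and level_1: "level 1 = int p + 1"
  and level_last: "level (Suc (length es)) = int q"
  by (simp_all add: level_def last_dir algebra_simps)

lemma level_rec: "level (Suc (Suc j)) = int (es ! j) * level (Suc j) - level j"
  by (simp add: level_def algebra_simps)

text \<open>\<open>d j\<close> is the determinant of (m_j, n_j) and (q, p). It obeys the same
  recurrence and takes the values 1 and 0 at the last two indices, so the argument for
  \<open>hj_m\<close> runs backwards from the far end.\<close>

lemma dual_mono: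
  fixes d :: "nat \<Rightarrow> int"
  defines "d \<equiv> \<lambda>j. int p * hj_m es j - int q * hj_n es j"
  assumes "j \<le> length es"
  shows "0 \<le> d (Suc j) \<and> d (Suc j) \<le> d j"
  using assms(2)
proof (induction rule: inc_induct)
  case base
  have "hj_m es (length es) * hj_n es (Suc (length es)) - hj_m es (Suc (length es)) * hj_n es (length es) = 1"
    by (rule hj_det)
  then show ?case by (simp add: d_def last_dir mult.commute)
next
  case (step j)
  have rec: "d (Suc (Suc j)) = int (es ! j) * d (Suc j) - d j" by (simp add: d_def algebra_simps)
  have "2 \<le> es ! j" using two_le step by simp
  moreover have "0 \<le> d (Suc j)" using step.IH by linarith
  ultimately have "2 * d (Suc j) \<le> int (es ! j) * d (Suc j)" by (intro mult_right_mono) auto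
  then show ?case using step.IH rec by linarith
qed

text \<open>\<open>level\<close> is the sum of \<open>hj_m\<close> and the sequence of
  \<open>dual_mono\<close>, both nonnegative. The sign is what turns e >= 2 into convexity.\<close>

lemma level_nonneg: "j \<le> length es \<Longrightarrow> 0 \<le> level (Suc j)"
  using dual_mono[of j] hj_m_mono[OF two_le, of j] by (simp add: level_def algebra_simps)

lemma level_convex:
  assumes "j < length es" shows "2 * level (Suc j) \<le> level j + level (Suc (Suc j))"
proof -
  have "2 \<le> es ! j" using two_le assms by simp
  then have "2 * level (Suc j) \<le> int (es ! j) * level (Suc j)"
    using level_nonneg[of j] assms by (intro mult_right_mono) auto
  then show ?thesis by (simp add: level_rec)
qed

text \<open>Maximum principle for a convex sequence whose two end values are q.\<close>

lemma level_le: "j \<le> length es \<Longrightarrow> level (Suc j) \<le> int q"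
proof (rule ccontr)
  assume j: "j \<le> length es" "\<not> level (Suc j) \<le> int q"
  \<comment> \<open>A value above q is reached by an upward step; by convexity the sequence keeps
    increasing from there and cannot return to q at the end.\<close>
  have "\<exists>i\<le>j. level i < level (Suc i) \<and> int q < level (Suc i)"
    using j
  proof (induction j)
    case (Suc j)
    show ?case
    proof (cases "level (Suc j) \<le> int q")
      case True
      then show ?thesis using Suc.prems by (intro exI[of _ "Suc j"]) auto
    next
      case False
      then obtain i where "i \<le> j" "level i < level (Suc i)" "int q < level (Suc i)"
        using Suc by auto
      then show ?thesis by (intro exI[of _ i]) auto
    qed
  qed (auto simp: level_0)
  then obtain i where i: "i \<le> length es" "level i < level (Suc i)" "int q < level (Suc i)"
    using j(1) order_trans by blast
  have "level l < level (Suc l) \<and> int q < level (Suc l)" if "i \<le> l" "l \<le> length es" for l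
    using that
  proof (induction rule: dec_induct)
    case (step l)
    then show ?case using level_convex[of l] by auto
  qed (use i in auto)
  from this[of "length es"] i(1) show False by (simp add: level_last)
qed

text \<open>The values at 0 and 1 are both q; convexity together with the upper bound q then forces
  each next value.\<close>

lemma level_eq:
  assumes "p = q - 1" "j \<le> Suc (length es)" shows "level j = int q"
proof -
  have q1: "int p + 1 = int q" using assms(1) p pq by linarith
  have "level j = int q \<and> (j \<le> length es \<longrightarrow> level (Suc j) = int q)" using assms(2)
  proof (induction j)
    case 0
    show ?case using level_0 level_1 q1 by simp
  next
    case (Suc j)
    then have IH: "level j = int q" "level (Suc j) = int q" by auto
    have "level (Suc (Suc j)) = int q" if "Suc j \<le> length es"
      using level_convex[of j] level_le[of "Suc j"] that IH by simp
    then show ?case using IH by simp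
  qed
  then show ?thesis by simp
qed

lemma level_1_less: "p \<noteq> q - 1 \<Longrightarrow> level 1 < int q"
  using level_1 pq by linarith

text \<open>Abel summation; the boundary terms combine to the telescoping sum of the increments \<open>u (Suc j) - u j\<close>.\<close>

lemma level_sum:
  fixes u :: "nat \<Rightarrow> real"
  shows "(\<Sum>j\<le>length es. u j * (level j - level (Suc j))) =
    (\<Sum>j<length es. (u (Suc j) - u j) * (level (Suc j) - real q))"
proof -
  have "(\<Sum>j\<le>k. u j * (level j - level (Suc j))) =
    (\<Sum>j<k. (u (Suc j) - u j) * (level (Suc j) - real q)) + u k * (real q - level (Suc k))" for k
    by (induction k) (auto simp: level_0 algebra_simps)
  then show ?thesis by (simp add: level_last)
qed

text \<open>After summation by parts every term is a positive increment times a nonpositive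
  discrepancy. Strictness for p different from q - 1 comes from the term j = 0 alone, where the
  level is p + 1 < q.\<close>

lemma level_sum_nonpos:
  fixes u :: "nat \<Rightarrow> real"
  assumes "\<And>j. j < length es \<Longrightarrow> u j < u (Suc j)"
  shows "(\<Sum>j\<le>length es. u j * (level j - level (Suc j))) \<le> 0"
    and "(\<Sum>j\<le>length es. u j * (level j - level (Suc j))) = 0 \<longleftrightarrow> p = q - 1"
proof -
  have le: "(u (Suc j) - u j) * (level (Suc j) - real q) \<le> 0" if "j < length es" for j
    using assms[OF that] level_le[of j] that
    by (intro mult_nonneg_nonpos) auto
  then show "(\<Sum>j\<le>length es. u j * (level j - level (Suc j))) \<le> 0"
    unfolding level_sum by (intro sum_nonpos) auto
  show "(\<Sum>j\<le>length es. u j * (level j - level (Suc j))) = 0 \<longleftrightarrow> p = q - 1"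
  proof
    assume "p = q - 1"
    then show "(\<Sum>j\<le>length es. u j * (level j - level (Suc j))) = 0"
      using level_eq by (intro sum.neutral) (metis (no_types, lifting) Suc_le_mono atMost_iff diff_self le_SucI mult_zero_right of_int_diff of_int_0)
  next
    assume eq: "(\<Sum>j\<le>length es. u j * (level j - level (Suc j))) = 0"
    show "p = q - 1"
    proof (rule ccontr)
      assume "p \<noteq> q - 1"
      then have l1: "real_of_int (level (Suc 0)) < real q" using level_1_less by simp
      have "(\<Sum>j<length es. (u (Suc j) - u j) * (level (Suc j) - real q)) < 0"
      proof -
        have "(\<Sum>j<length es. (u (Suc j) - u j) * (level (Suc j) - real q)) \<le>
            (\<Sum>j\<in>{0}. (u (Suc j) - u j) * (level (Suc j) - real q))"
          using le es_nonempty by (subst sum.remove[of _ 0]) (auto intro!: sum_nonpos)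
        also have "\<dots> < 0" using assms[OF es_nonempty] l1 by (auto intro: mult_pos_neg)
        finally show ?thesis .
      qed
      then show False using eq level_sum by simp
    qed
  qed
qed

end

section \<open>Crepancy\<close>

text \<open>Logarithmic differentiation without a logarithm: the lifts are known only through
  monomial relations, which determine F'/F and G'/G linearly.\<close>

lemma log_derivative_relation:
  fixes F G :: "complex \<Rightarrow> complex"
  assumes F: "(F has_field_derivative a) (at x)" and G: "(G has_field_derivative c) (at x)"
    and nz: "F x \<noteq> 0" "G x \<noteq> 0" "x \<noteq> 0" "K \<noteq> 0"
    and rel: "\<forall>\<^sub>F s in nhds x. F s ^ p = G s * (s powi n * K)"
  shows "of_nat p * a / F x = c / G x + of_int n / x"
proof -
  have rel': "F x ^ p = G x * (x powi n * K)"
    using rel by (rule eventually_nhds_x_imp_x)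
  have "((\<lambda>s. F s ^ p) has_field_derivative of_nat p * (a * F x ^ (p - Suc 0))) (at x)"
    using DERIV_power[OF F, of p] by simp
  then have "((\<lambda>s. G s * (s powi n * K)) has_field_derivative of_nat p * (a * F x ^ (p - Suc 0))) (at x)"
    by (subst DERIV_cong_ev[OF refl eventually_mono[OF rel] refl, symmetric]) auto
  moreover have "((\<lambda>s. G s * (s powi n * K)) has_field_derivative
      c * (x powi n * K) + (of_int n * x powi (n - 1)) * K * G x) (at x)"
    using nz by (auto intro!: derivative_eq_intros G simp: algebra_simps)
  ultimately have eq: "of_nat p * (a * F x ^ (p - Suc 0)) = c * (x powi n * K) + (of_int n * x powi (n - 1)) * K * G x"
    by (rule DERIV_unique)
  have "of_nat p * a / F x * F x ^ p = of_nat p * (a * F x ^ (p - Suc 0))"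
    using nz by (cases p) auto
  also have "\<dots> = (c / G x + of_int n / x) * (G x * (x powi n * K))"
    using nz unfolding eq by (simp add: power_int_diff field_simps)
  finally have "of_nat p * a / F x * F x ^ p = (c / G x + of_int n / x) * F x ^ p"
    unfolding rel' .
  then show ?thesis using nz(1) by (simp only: mult_cancel_right power_eq_0_iff) simp
qed

lemma has_field_derivative_slices:
  fixes f :: "C2 \<Rightarrow> complex"
  assumes "(f has_derivative (\<lambda>h. a * fst h + b * snd h)) (at w)"
  shows "((\<lambda>s. f (s, snd w)) has_field_derivative a) (at (fst w))"
    and "((\<lambda>s. f (fst w, s)) has_field_derivative b) (at (snd w))"
proof -
  have "((\<lambda>s. f (s, snd w)) has_derivative (\<lambda>h. a * fst (h, 0::complex) + b * snd (h, 0::complex))) (at (fst w))"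
    by (rule has_derivative_compose[of "\<lambda>s. (s, snd w)" "\<lambda>h. (h, 0)" _ UNIV f])
       (use assms in \<open>auto intro!: derivative_eq_intros\<close>)
  then show "((\<lambda>s. f (s, snd w)) has_field_derivative a) (at (fst w))"
    by (simp add: has_field_derivative_def)
  have "((\<lambda>s. f (fst w, s)) has_derivative (\<lambda>h. a * fst (0::complex, h) + b * snd (0::complex, h))) (at (snd w))"
    by (rule has_derivative_compose[of "\<lambda>s. (fst w, s)" "\<lambda>h. (0, h)" _ UNIV f])
       (use assms in \<open>auto intro!: derivative_eq_intros\<close>)
  then show "((\<lambda>s. f (fst w, s)) has_field_derivative b) (at (snd w))"
    by (simp add: has_field_derivative_def)
qed

context hirzebruch_jung
begin

text \<open>In logarithmic coordinates the lift is linear: dlog z_1 = (m dlog w_1 + m' dlog w_2) / q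
  and dlog z_2 = p dlog z_1 - n dlog w_1 - n' dlog w_2. By \<open>hj_det\<close> the determinant is
  -1/q, so the Jacobian is - z_1 z_2 / (q w_1 w_2); its q-th power is a monomial in w, with
  exponents read off the definition of \<open>level\<close>.\<close>

lemma jacobian2_lift:
  assumes j: "j \<le> length es" and U: "open U" "w \<in> U"
    and hol: "holomorphic2_on (fst \<circ> Z) U" "holomorphic2_on (snd \<circ> Z) U"
    and res: "\<And>w. w \<in> U \<Longrightarrow> resolves p q es j w (Z w)"
  shows "jacobian2 Z w ^ q = (- 1 / of_nat q) ^ q *
     (fst w powi (level j - int q) * snd w powi (level (Suc j) - int q))"
proof -
  define m n m' n' where mn: "m = hj_m es j" "n = hj_n es j" "m' = hj_m es (Suc j)" "n' = hj_n es (Suc j)"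
  have det: "m * n' - m' * n = 1" unfolding mn by (rule hj_det)
  have dir: "hj_dir es j = (m, n)" "hj_dir es (Suc j) = (m', n')"
    using j hj_dir_eq[OF two_le] by (auto simp: mn)
  have r: "fst u \<noteq> 0" "snd u \<noteq> 0" "fst (Z u) \<noteq> 0" "snd (Z u) \<noteq> 0"
    "fst (Z u) ^ q = fst u powi m * snd u powi m'"
    "fst (Z u) ^ p = snd (Z u) * (fst u powi n * snd u powi n')" if "u \<in> U" for u
    using res[OF that] by (auto simp: resolves_def off_axes_def dir field_simps)
  obtain a b where ab: "((fst \<circ> Z) has_derivative (\<lambda>h. a * fst h + b * snd h)) (at w)"
    using hol(1) U unfolding holomorphic2_on_def by blast
  obtain c d where cd: "((snd \<circ> Z) has_derivative (\<lambda>h. c * fst h + d * snd h)) (at w)"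
    using hol(2) U unfolding holomorphic2_on_def by blast
  note D1 = has_field_derivative_slices[OF ab, unfolded o_def]
  note D2 = has_field_derivative_slices[OF cd, unfolded o_def]
  obtain w1 w2 where w: "w = (w1, w2)" by (cases w)
  define f g where "f = fst (Z w)" "g = snd (Z w)"
  have nz: "f \<noteq> 0" "g \<noteq> 0" "w1 \<noteq> 0" "w2 \<noteq> 0" using r[OF U(2)] by (auto simp: w f_g_def)
  have ev1: "\<forall>\<^sub>F s in nhds w1. (s, w2) \<in> U"
  proof -
    have "((\<lambda>s. (s, w2)) \<longlongrightarrow> (w1, w2)) (nhds w1)" by (intro tendsto_intros) (simp add: filterlim_ident)
    then show ?thesis using U w topological_tendstoD by blast
  qed
  have ev2: "\<forall>\<^sub>F s in nhds w2. (w1, s) \<in> U"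
  proof -
    have "((\<lambda>s. (w1, s)) \<longlongrightarrow> (w1, w2)) (nhds w2)" by (intro tendsto_intros) (simp add: filterlim_ident)
    then show ?thesis using U w topological_tendstoD by blast
  qed
  \<comment> \<open>The relation for z_1^q fits the general form with G constantly 1.\<close>
  have e1: "\<forall>\<^sub>F s in nhds w1. fst (Z (s, w2)) ^ q = 1 * (s powi m * w2 powi m')"
    and e1': "\<forall>\<^sub>F s in nhds w1. fst (Z (s, w2)) ^ p = snd (Z (s, w2)) * (s powi n * w2 powi n')"
    using ev1 by (eventually_elim, use r in fastforce)+
  have e2: "\<forall>\<^sub>F s in nhds w2. fst (Z (w1, s)) ^ q = 1 * (s powi m' * w1 powi m)"
    and e2': "\<forall>\<^sub>F s in nhds w2. fst (Z (w1, s)) ^ p = snd (Z (w1, s)) * (s powi n' * w1 powi n)"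
    using ev2 by (eventually_elim, use r in \<open>fastforce simp: mult.commute\<close>)+
  have A: "of_nat q * a / f = of_int m / w1"
    using log_derivative_relation[OF D1(1)[unfolded w fst_conv snd_conv] DERIV_const _ _ _ _ e1] nz
    by (simp add: w f_g_def)
  have B: "of_nat q * b / f = of_int m' / w2"
    using log_derivative_relation[OF D1(2)[unfolded w fst_conv snd_conv] DERIV_const _ _ _ _ e2] nz
    by (simp add: w f_g_def)
  have C: "of_nat p * a / f = c / g + of_int n / w1"
    using log_derivative_relation[OF D1(1)[unfolded w fst_conv snd_conv] D2(1)[unfolded w fst_conv snd_conv] _ _ _ _ e1'] nz
    by (simp add: w f_g_def)
  have D: "of_nat p * b / f = d / g + of_int n' / w2"
    using log_derivative_relation[OF D1(2)[unfolded w fst_conv snd_conv] D2(2)[unfolded w fst_conv snd_conv] _ _ _ _ e2'] nz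
    by (simp add: w f_g_def)
  have q0: "(of_nat q :: complex) \<noteq> 0" using p pq by simp
  have jac: "jacobian2 Z w = a * d - b * c"
    using D1 D2 by (simp add: jacobian2_def DERIV_imp_deriv)
  have "a * d - b * c = f * g * ((a / f) * (d / g) - (b / f) * (c / g))"
    using nz by (simp add: field_simps)
  also have "d / g = of_nat p * (b / f) - of_int n' / w2" using D by simp
  also have "c / g = of_nat p * (a / f) - of_int n / w1" using C by simp
  also have "a / f = of_int m / (of_nat q * w1)" using A q0 nz by (simp add: field_simps)
  also have "b / f = of_int m' / (of_nat q * w2)" using B q0 nz by (simp add: field_simps)
  also have "f * g * (of_int m / (of_nat q * w1) * (of_nat p * (of_int m' / (of_nat q * w2)) - of_int n' / w2) -
     of_int m' / (of_nat q * w2) * (of_nat p * (of_int m / (of_nat q * w1)) - of_int n / w1)) =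
     - (of_int (m * n' - m' * n)) / of_nat q * (f * g) / (w1 * w2)"
    using q0 nz by (simp add: field_simps)
  finally have J: "jacobian2 Z w = (- 1 / of_nat q) * (f * g / (w1 * w2))"
    unfolding jac det by simp
  have fq: "f ^ q = w1 powi m * w2 powi m'" using r(5)[OF U(2)] by (simp add: w f_g_def)
  have g: "g = f ^ p * (w1 powi (-n) * w2 powi (-n'))"
    using r(6)[OF U(2)] nz by (simp add: w f_g_def power_int_minus field_simps)
  \<comment> \<open>With g eliminated, the q-th power depends on the lift only through f^q, a
    monomial in w; hence the choice of branch disappears.\<close>
  have "(f ^ p) ^ q = (f ^ q) ^ p" by (metis mult.commute power_mult)
  then have "(f * g / (w1 * w2)) ^ q = (f ^ q) ^ Suc p * ((w1 powi (-n) * w2 powi (-n')) / (w1 * w2)) ^ q"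
    unfolding g by (simp add: power_mult_distrib power_divide)
  also have "\<dots> = (w1 powi m) ^ Suc p * (w1 powi (-n)) ^ q * w1 powi (- int q) *
      ((w2 powi m') ^ Suc p * (w2 powi (-n')) ^ q * w2 powi (- int q))"
    unfolding fq by (simp add: power_mult_distrib power_divide power_int_minus field_simps)
  also have "(w1 powi m) ^ Suc p * (w1 powi (-n)) ^ q * w1 powi (- int q) = w1 powi (level j - int q)"
    using nz by (simp only: power_int_power' power_int_add[symmetric] simp_thms)
      (simp add: level_def mn algebra_simps)
  also have "(w2 powi m') ^ Suc p * (w2 powi (-n')) ^ q * w2 powi (- int q) = w2 powi (level (Suc j) - int q)"
    using nz by (simp only: power_int_power' power_int_add[symmetric] simp_thms)
      (simp add: level_def mn algebra_simps)
  finally show ?thesis unfolding J power_mult_distrib by (simp add: w)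
qed

text \<open>If all levels are q, the Jacobian power is the nonzero constant (-1/q)^q in every chart.
  Otherwise the chart j = 0 already obstructs: there the power has a pole of order q - (p + 1) along
  w_2 = 0, seen by an explicit lift.\<close>

lemma crepant_iff: "p = q - 1 \<longleftrightarrow> crepant p q es"
proof
  assume pq1: "p = q - 1"
  show "crepant p q es" unfolding crepant_def
  proof (intro allI impI)
    fix j assume j: "j \<le> length es"
    have "level j = int q" "level (Suc j) = int q" using level_eq[OF pq1] j by auto
    then have "\<forall>U Z. open U \<and> holomorphic2_on (fst \<circ> Z) U \<and> holomorphic2_on (snd \<circ> Z) U \<and>
               (\<forall>w\<in>U. resolves p q es j w (Z w))
           \<longrightarrow> (\<forall>w\<in>U. jacobian2 Z w ^ q = (- 1 / of_nat q) ^ q)"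
    proof (intro allI impI ballI)
      fix U Z w assume *: "open U \<and> holomorphic2_on (fst \<circ> Z) U \<and> holomorphic2_on (snd \<circ> Z) U \<and>
               (\<forall>w\<in>U. resolves p q es j w (Z w))" "w \<in> U"
      show "jacobian2 Z w ^ q = (- 1 / of_nat q) ^ q"
        using jacobian2_lift[OF j, of U w Z] * \<open>level j = int q\<close> \<open>level (Suc j) = int q\<close> by simp
    qed
    moreover have "holomorphic2_on (\<lambda>_. (- 1 / of_nat q) ^ q) UNIV"
      unfolding holomorphic2_on_def by (auto intro!: exI[of _ 0])
    moreover have "(- 1 / of_nat q :: complex) ^ q \<noteq> 0" using p pq by simp
    ultimately show "\<exists>J. holomorphic2_on J UNIV \<and> (\<forall>w. J w \<noteq> 0) \<and>
        (\<forall>U Z. open U \<and> holomorphic2_on (fst \<circ> Z) U \<and> holomorphic2_on (snd \<circ> Z) U \<and>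
               (\<forall>w\<in>U. resolves p q es j w (Z w))
           \<longrightarrow> (\<forall>w\<in>U. jacobian2 Z w ^ q = J w))"
      by (intro exI[of _ "\<lambda>_. (- 1 / of_nat q) ^ q"]) simp
  qed
next
  assume "crepant p q es"
  then obtain J where J: "holomorphic2_on J UNIV"
    "\<And>U Z. open U \<and> holomorphic2_on (fst \<circ> Z) U \<and> holomorphic2_on (snd \<circ> Z) U \<and>
               (\<forall>w\<in>U. resolves p q es 0 w (Z w)) \<Longrightarrow> (\<forall>w\<in>U. jacobian2 Z w ^ q = J w)"
    unfolding crepant_def by blast
  show "p = q - 1"
  proof (rule ccontr)
    assume "p \<noteq> q - 1"
    then have l1: "level 1 < int q" by (rule level_1_less)
    have q0: "(of_nat q :: complex) \<noteq> 0" using p pq by simp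
    define U :: "C2 set" where "U = {w. 0 < Re (fst w) \<and> 0 < Re (snd w)}"
    define \<rho> where "\<rho> z = exp (Ln z / of_nat q)" for z
    \<comment> \<open>In the chart j = 0 the relations read z_1^q = w_2 and z_1^p / z_2 = 1 / w_1.
      On the right half-planes the principal q-th root is holomorphic.\<close>
    define Z :: "C2 \<Rightarrow> C2" where "Z w = (\<rho> (snd w), fst w * \<rho> (snd w) ^ p)" for w
    have "open U" unfolding U_def by (intro open_Collect_conj open_Collect_less continuous_intros)
    have notneg: "z \<notin> \<real>\<^sub>\<le>\<^sub>0" "z \<noteq> 0" if "0 < Re z" for z
      using that by (auto simp: complex_nonpos_Reals_iff)
    have \<rho>_pow: "\<rho> z ^ q = z" if "z \<noteq> 0" for z
      using that q0 by (simp add: \<rho>_def exp_of_nat_mult[symmetric])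
    have \<rho>': "(\<rho> has_field_derivative \<rho> z / (z * of_nat q)) (at z)" if "0 < Re z" for z
      unfolding \<rho>_def using notneg[OF that] q0
      by (auto intro!: derivative_eq_intros simp: field_simps)
    have \<rho>D: "((\<lambda>w. \<rho> (snd w)) has_derivative (\<lambda>h. \<rho> (snd w) / (snd w * of_nat q) * snd h)) (at w)"
      if "w \<in> U" for w :: C2
    proof -
      have "(\<rho> has_derivative (\<lambda>h. \<rho> (snd w) / (snd w * of_nat q) * h)) (at (snd w))"
        using \<rho>'[of "snd w"] that by (simp only: has_field_derivative_def U_def mem_Collect_eq)
      then show ?thesis
        by (rule has_derivative_compose[OF has_derivative_snd[OF has_derivative_ident]])
    qed
    have "holomorphic2_on (fst \<circ> Z) U" unfolding holomorphic2_on_def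
    proof
      fix w assume "w \<in> U"
      from \<rho>D[OF this] show "\<exists>a b. ((fst \<circ> Z) has_derivative (\<lambda>h. a * fst h + b * snd h)) (at w)"
        by (intro exI[of _ 0] exI[of _ "\<rho> (snd w) / (snd w * of_nat q)"]) (simp add: Z_def o_def)
    qed
    moreover have "holomorphic2_on (snd \<circ> Z) U" unfolding holomorphic2_on_def
    proof
      fix w assume w: "w \<in> U"
      let ?r = "\<rho> (snd w)" and ?r' = "\<rho> (snd w) / (snd w * of_nat q)"
      have "((\<lambda>w. fst w * \<rho> (snd w) ^ p) has_derivative
         (\<lambda>h. ?r ^ p * fst h + (fst w * (of_nat p * ?r ^ (p - 1) * ?r')) * snd h)) (at w)"
        by (rule has_derivative_eq_rhs, rule has_derivative_mult[OF has_derivative_fst[OF has_derivative_ident] has_derivative_power[OF \<rho>D[OF w]]])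
           (auto simp: fun_eq_iff algebra_simps)
      then show "\<exists>a b. ((snd \<circ> Z) has_derivative (\<lambda>h. a * fst h + b * snd h)) (at w)"
        unfolding Z_def o_def snd_conv by blast
    qed
    moreover have "resolves p q es 0 w (Z w)" if "w \<in> U" for w
      using that \<rho>_pow[of "snd w"] notneg by (auto simp: resolves_def Z_def off_axes_def U_def hj_dir_eq[OF two_le] \<rho>_def power_int_minus field_simps)
    ultimately have jac: "J w = (- 1 / of_nat q) ^ q *
     (fst w powi (level 0 - int q) * snd w powi (level (Suc 0) - int q))" if "w \<in> U" for w
      using J(2)[of U Z] jacobian2_lift[OF _ \<open>open U\<close> that, of 0 Z] \<open>open U\<close> that by auto
    define d where "d = nat (int q - level 1)"
    have d: "d > 0" "level (Suc 0) - int q = - int d" using l1 by (auto simp: d_def)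
    \<comment> \<open>Along (1, t) the factor t^d cancels the pole, so the product is a nonzero
      constant, while continuity of J at (1, 0) makes it tend to 0.\<close>
    have const: "of_real t ^ d * J (1, of_real t) = (- 1 / of_nat q) ^ q" if "0 < t" for t :: real
      using that jac[of "(1, of_real t)"] d(2) by (simp add: U_def power_int_minus field_simps)
    have "isCont J (1, 0)"
      using J(1) unfolding holomorphic2_on_def by (meson UNIV_I has_derivative_continuous)
    then have "((\<lambda>t. J (1, of_real t)) \<longlongrightarrow> J (1, 0)) (at_right 0)"
      by (rule isCont_tendsto_compose) (auto intro!: tendsto_eq_intros)
    then have "((\<lambda>t. of_real t ^ d * J (1, of_real t)) \<longlongrightarrow> of_real 0 ^ d * J (1, 0)) (at_right 0)"
      by (intro tendsto_intros)
    moreover have "\<forall>\<^sub>F t in at_right 0. of_real t ^ d * J (1, of_real t) = (- 1 / of_nat q) ^ q"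
      unfolding eventually_at_right_field using const by (intro exI[of _ 1]) simp
    ultimately have "((\<lambda>t::real. (- 1 / of_nat q :: complex) ^ q) \<longlongrightarrow> of_real 0 ^ d * J (1, 0)) (at_right 0)"
      by (rule Lim_transform_eventually)
    then have "((\<lambda>t::real. (- 1 / of_nat q :: complex) ^ q) \<longlongrightarrow> 0) (at_right 0)"
      using d(1) by (simp add: power_0_left)
    then show False using q0 by (simp add: tendsto_const_iff)
  qed
qed

end

section \<open>Integrals over spheres\<close>

lemma distr_lborel_orthogonal_cart:
  fixes T :: "real^'n::{finite,wellorder} \<Rightarrow> real^'n::{finite,wellorder}"
  assumes T: "orthogonal_transformation T"
  shows "distr lborel borel T = lborel"
proof (rule lborel_eqI[symmetric])
  fix l u :: "real^'n::_" assume le: "\<And>b. b \<in> Basis \<Longrightarrow> l \<bullet> b \<le> u \<bullet> b"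
  have bij: "bij T" by (rule orthogonal_transformation_bij[OF T])
  have inv: "orthogonal_transformation (inv T)" by (rule orthogonal_transformation_inv[OF T])
  have [measurable]: "T \<in> borel \<rightarrow>\<^sub>M borel"
    by (intro borel_measurable_continuous_onI linear_continuous_on orthogonal_transformation_linear[OF T, THEN linear_conv_bounded_linear[THEN iffD1]])
  \<comment> \<open>The preimage of a box is its image under the inverse orthogonal map and so has
    the same volume; boxes determine the measure.\<close>
  have vim: "T -` box l u = inv T ` box l u" by (rule bij_vimage_eq_inv_image[OF bij])
  have meas: "T -` box l u \<in> sets borel"
    using measurable_sets_borel[of T borel "box l u"] by simp
  have lm: "T -` box l u \<in> lmeasurable"
    unfolding vim by (rule measurable_orthogonal_image[OF inv]) simp
  have "emeasure (distr lborel borel T) (box l u) = emeasure lebesgue (T -` box l u)"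
    using meas by (simp add: emeasure_distr)
  also have "\<dots> = ennreal (measure lebesgue (T -` box l u))"
    using lm by (simp add: emeasure_eq_measure2)
  also have "measure lebesgue (T -` box l u) = measure lebesgue (box l u)"
    unfolding vim by (rule measure_orthogonal_image[OF inv]) simp
  also have "ennreal (measure lebesgue (box l u)) = emeasure lborel (box l u)"
    by (simp add: emeasure_eq_measure2 fmeasurableD[of "box l u" lebesgue] flip: emeasure_completion)
  also have "\<dots> = (\<Prod>b\<in>Basis. (u - l) \<bullet> b)" using le by (intro emeasure_lborel_box) auto
  finally show "emeasure (distr lborel borel T) (box l u) = (\<Prod>b\<in>Basis. (u - l) \<bullet> b)" .
qed simp

text \<open>An isometry with \<open>real^4\<close> that carries the invariance of Lebesgue measure
  over to \<open>C2\<close>.\<close>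

definition C2_of_vec :: "real^4 \<Rightarrow> C2" where
  "C2_of_vec x = (Complex (x$1) (x$2), Complex (x$3) (x$4))"

definition vec_of_C2 :: "C2 \<Rightarrow> real^4" where
  "vec_of_C2 z = vector [Re (fst z), Im (fst z), Re (snd z), Im (snd z)]"

lemma vector_4 [simp]:
  "(vector [a, b, c, d] :: 'a::zero ^ 4) $ 1 = a"
  "(vector [a, b, c, d] :: 'a ^ 4) $ 2 = b"
  "(vector [a, b, c, d] :: 'a ^ 4) $ 3 = c"
  "(vector [a, b, c, d] :: 'a ^ 4) $ 4 = d"
  unfolding vector_def by simp_all

lemma C2_of_vec_of_C2 [simp]: "C2_of_vec (vec_of_C2 z) = z"
  by (simp add: C2_of_vec_def vec_of_C2_def)

lemma vec_of_C2_of_vec [simp]: "vec_of_C2 (C2_of_vec x) = x"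
  by (simp add: C2_of_vec_def vec_of_C2_def vec_eq_iff forall_4)

lemma inner_vec_of_C2: "vec_of_C2 z \<bullet> vec_of_C2 w = z \<bullet> w"
  by (simp add: vec_of_C2_def inner_vec_def sum_4 inner_prod_def inner_complex_def)

lemma linear_C2_of_vec: "linear C2_of_vec"
  by (auto simp: linear_iff C2_of_vec_def complex_eq_iff)

lemma linear_vec_of_C2: "linear vec_of_C2"
  by (auto simp: linear_iff vec_of_C2_def vec_eq_iff forall_4)

lemma Basis_C2: "(Basis :: C2 set) = {(1, 0), (\<i>, 0), (0, 1), (0, \<i>)}"
  by (auto simp: Basis_prod_def Basis_complex_def)

lemma distr_lborel_C2_of_vec: "distr lborel borel C2_of_vec = lborel"
proof (rule lborel_eqI[symmetric])
  fix l u :: C2 assume le: "\<And>b. b \<in> Basis \<Longrightarrow> l \<bullet> b \<le> u \<bullet> b"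
  have [measurable]: "C2_of_vec \<in> borel \<rightarrow>\<^sub>M borel"
    by (intro borel_measurable_continuous_onI linear_continuous_on linear_C2_of_vec[THEN linear_conv_bounded_linear[THEN iffD1]])
  have le': "Re (fst l) \<le> Re (fst u)" "Im (fst l) \<le> Im (fst u)" "Re (snd l) \<le> Re (snd u)" "Im (snd l) \<le> Im (snd u)"
    using le[of "(1,0)"] le[of "(\<i>,0)"] le[of "(0,1)"] le[of "(0,\<i>)"]
    by (simp_all add: Basis_C2 inner_prod_def inner_complex_def)
  have B: "(Basis :: (real^4) set) = {axis 1 1, axis 2 1, axis 3 1, axis 4 1}"
    by (auto simp: Basis_vec_def UNIV_4)
  have vim: "C2_of_vec -` box l u = box (vec_of_C2 l) (vec_of_C2 u)"
    by (auto simp: mem_box Basis_C2 B C2_of_vec_def vec_of_C2_def inner_axis inner_prod_def inner_complex_def)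
  have "emeasure (distr lborel borel C2_of_vec) (box l u) = emeasure lborel (box (vec_of_C2 l) (vec_of_C2 u))"
    by (simp add: emeasure_distr vim)
  also have "\<dots> = (\<Prod>b\<in>Basis. (vec_of_C2 u - vec_of_C2 l) \<bullet> b)"
    using le' by (intro emeasure_lborel_box) (auto simp: B vec_of_C2_def inner_axis)
  also have "(\<Prod>b\<in>Basis. (vec_of_C2 u - vec_of_C2 l) \<bullet> b) = (\<Prod>b\<in>Basis. (u - l) \<bullet> b)"
    by (simp add: B Basis_C2 axis_eq_axis vec_of_C2_def inner_axis inner_prod_def inner_complex_def complex_eq_iff)
  finally show "emeasure (distr lborel borel C2_of_vec) (box l u) = (\<Prod>b\<in>Basis. (u - l) \<bullet> b)" .
qed simp

lemma distr_lborel_orthogonal: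
  fixes T :: "C2 \<Rightarrow> C2"
  assumes T: "orthogonal_transformation T"
  shows "distr lborel borel T = lborel"
proof -
  let ?T = "\<lambda>x. vec_of_C2 (T (C2_of_vec x))"
  have linT: "linear T" using T by (rule orthogonal_transformation_linear)
  have "linear ?T"
    using linear_compose[OF linear_compose[OF linear_C2_of_vec linT] linear_vec_of_C2] by (simp add: o_def)
  moreover have "C2_of_vec x \<bullet> C2_of_vec y = x \<bullet> y" for x y
    by (simp flip: inner_vec_of_C2)
  ultimately have "orthogonal_transformation ?T"
    using T by (simp only: orthogonal_transformation_def inner_vec_of_C2 simp_thms)
  then have inv: "distr lborel borel ?T = lborel" by (rule distr_lborel_orthogonal_cart)
  have [measurable]: "T \<in> borel \<rightarrow>\<^sub>M borel" "C2_of_vec \<in> borel \<rightarrow>\<^sub>M borel" "vec_of_C2 \<in> borel \<rightarrow>\<^sub>M borel"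
    by (intro borel_measurable_continuous_onI linear_continuous_on
         linT[THEN linear_conv_bounded_linear[THEN iffD1]] linear_C2_of_vec[THEN linear_conv_bounded_linear[THEN iffD1]]
         linear_vec_of_C2[THEN linear_conv_bounded_linear[THEN iffD1]])+
  have "distr lborel borel T = distr (distr lborel borel C2_of_vec) borel T"
    by (simp add: distr_lborel_C2_of_vec)
  also have "\<dots> = distr lborel borel (\<lambda>x. C2_of_vec (?T x))"
    by (simp add: distr_distr o_def)
  also have "\<dots> = distr (distr lborel borel ?T) borel C2_of_vec"
    by (subst distr_distr) (auto simp: o_def)
  finally show ?thesis by (simp only: inv distr_lborel_C2_of_vec)
qed

text \<open>Boundedness and Borel measurability on the sphere take the place of continuity, because
  the integrands are derivatives about which only existence and bounds are recorded. Extension by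
  zero makes values off the sphere irrelevant.\<close>

definition sphere_measurable :: "real \<Rightarrow> (C2 \<Rightarrow> real) \<Rightarrow> bool" where
  "sphere_measurable R g \<longleftrightarrow> (\<lambda>w. indicator (sphere 0 R) w * g w) \<in> borel_measurable borel \<and>
     (\<exists>B. \<forall>w\<in>sphere 0 R. \<bar>g w\<bar> \<le> B)"

lemma sphere_measurable_radial:
  assumes "sphere_measurable R g" "R > 0"
  shows "(\<lambda>w. g ((R / norm w) *\<^sub>R w)) \<in> borel_measurable borel"
proof -
  have [measurable]: "(\<lambda>w. indicator (sphere 0 R) w * g w) \<in> borel_measurable borel"
    using assms by (simp add: sphere_measurable_def)
  have "(\<lambda>w::C2. (R / norm w) *\<^sub>R w) \<in> borel \<rightarrow>\<^sub>M borel" by measurable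
  from measurable_compose[OF this, of "\<lambda>w. indicator (sphere 0 R) w * g w" borel]
  have [measurable]: "(\<lambda>w. indicator (sphere 0 R) ((R / norm w) *\<^sub>R w) * g ((R / norm w) *\<^sub>R w)) \<in> borel_measurable borel"
    by measurable
  \<comment> \<open>At the origin \<open>R / 0 = 0\<close>, so the radial extension takes the value
    \<open>g 0\<close> there, which is not a value on the sphere.\<close>
  have "(\<lambda>w. g ((R / norm w) *\<^sub>R w)) = (\<lambda>w. if w = 0 then g 0 else
      indicator (sphere 0 R) ((R / norm w) *\<^sub>R w) * g ((R / norm w) *\<^sub>R w))"
    by (rule ext) (use assms(2) in \<open>simp add: indicator_def\<close>)
  also have "\<dots> \<in> borel_measurable borel" by measurable
  finally show ?thesis .
qed

lemma sphere_measurable_integrable: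
  assumes "sphere_measurable R g" "R > 0"
  shows "set_integrable lborel (ball 0 R) (\<lambda>w. g ((R / norm w) *\<^sub>R w))"
proof -
  obtain B where B: "\<And>w. w \<in> sphere 0 R \<Longrightarrow> \<bar>g w\<bar> \<le> B"
    using assms(1) unfolding sphere_measurable_def by blast
  have m[measurable]: "(\<lambda>w. g ((R / norm w) *\<^sub>R w)) \<in> borel_measurable borel"
    by (rule sphere_measurable_radial[OF assms])
  have bd: "\<bar>g ((R / norm w) *\<^sub>R w)\<bar> \<le> max B \<bar>g 0\<bar>" for w
    using B[of "(R / norm w) *\<^sub>R w"] assms(2) by (cases "w = 0") auto
  have "integrable lborel (\<lambda>w::C2. max B \<bar>g 0\<bar> * indicator (ball 0 R) w)"
    by (intro integrable_mult_right integrable_real_indicator) (use emeasure_lborel_ball_finite[of "0::C2" R] in auto)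
  then show ?thesis unfolding set_integrable_def
    by (rule Bochner_Integration.integrable_bound) (use bd in \<open>auto simp: indicator_def\<close>)
qed

text \<open>The origin is the only point that radial projection does not send to the sphere, and it
  is a null set.\<close>

lemma sphere_integral_cong:
  assumes "\<And>w. norm w = R \<Longrightarrow> g w = g' w" "sphere_measurable R g" "R > 0"
  shows "sphere_measurable R g'" "sphere_integral R g' = sphere_integral R g"
proof -
  have "(\<lambda>w. indicator (sphere 0 R) w * g w) = (\<lambda>w. indicator (sphere 0 R) w * g' w)"
    by (rule ext) (use assms(1) in \<open>simp add: indicator_def\<close>)
  then show g': "sphere_measurable R g'"
    using assms unfolding sphere_measurable_def by auto
  have [measurable]: "(\<lambda>w. g ((R / norm w) *\<^sub>R w)) \<in> borel_measurable borel"
     "(\<lambda>w. g' ((R / norm w) *\<^sub>R w)) \<in> borel_measurable borel"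
    using sphere_measurable_radial assms(2,3) g' by auto
  have "AE w in lborel. w \<noteq> (0::C2)" by (rule AE_lborel_singleton)
  then have "AE w in lborel. w \<in> ball 0 R \<longrightarrow> g' ((R / norm w) *\<^sub>R w) = g ((R / norm w) *\<^sub>R w)"
    by eventually_elim (use assms(1,3) in auto)
  then show "sphere_integral R g' = sphere_integral R g"
    unfolding sphere_integral_def by (subst set_lebesgue_integral_cong_AE[of "ball 0 R"]) auto
qed

lemma sphere_measurable_add:
  assumes "sphere_measurable R f" "sphere_measurable R g"
  shows "sphere_measurable R (\<lambda>w. f w + g w)"
proof -
  obtain B where B: "\<And>w. w \<in> sphere 0 R \<Longrightarrow> \<bar>f w\<bar> \<le> B"
    using assms(1) unfolding sphere_measurable_def by blast
  obtain C where C: "\<And>w. w \<in> sphere 0 R \<Longrightarrow> \<bar>g w\<bar> \<le> C"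
    using assms(2) unfolding sphere_measurable_def by blast
  have "\<And>w. w \<in> sphere 0 R \<Longrightarrow> \<bar>f w + g w\<bar> \<le> B + C"
    using B C by (meson abs_triangle_ineq add_mono order_trans)
  moreover have "(\<lambda>w. indicator (sphere 0 R) w * (f w + g w)) \<in> borel_measurable borel"
    unfolding distrib_left using assms by (intro borel_measurable_add) (auto simp: sphere_measurable_def)
  ultimately show ?thesis unfolding sphere_measurable_def by blast
qed

lemma sphere_measurable_mult:
  assumes "sphere_measurable R f" "sphere_measurable R g"
  shows "sphere_measurable R (\<lambda>w. f w * g w)"
proof -
  obtain B where B: "\<And>w. w \<in> sphere 0 R \<Longrightarrow> \<bar>f w\<bar> \<le> B"
    using assms(1) unfolding sphere_measurable_def by blast
  obtain C where C: "\<And>w. w \<in> sphere 0 R \<Longrightarrow> \<bar>g w\<bar> \<le> C"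
    using assms(2) unfolding sphere_measurable_def by blast
  have "\<bar>f w * g w\<bar> \<le> \<bar>B\<bar> * \<bar>C\<bar>" if w: "w \<in> sphere 0 R" for w
    using B[OF w] C[OF w] unfolding abs_mult by (intro mult_mono) linarith+
  moreover have "(\<lambda>w. (indicator (sphere 0 R) w * f w) * (indicator (sphere 0 R) w * g w)) \<in> borel_measurable borel"
    by (rule borel_measurable_times; use assms sphere_measurable_def in blast)
  then have "(\<lambda>w. indicator (sphere 0 R) w * (f w * g w)) \<in> borel_measurable borel"
    by (rule back_subst[of "\<lambda>f. f \<in> _"]) (auto simp: fun_eq_iff indicator_def)
  ultimately show ?thesis unfolding sphere_measurable_def by blast
qed

lemma sphere_measurable_continuous:
  assumes "continuous_on (sphere 0 R) g" shows "sphere_measurable R g"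
  unfolding sphere_measurable_def
proof
  show "(\<lambda>w. indicator (sphere 0 R) w * g w) \<in> borel_measurable borel"
    using borel_measurable_continuous_on_indicator[OF _ assms] by simp
  have "bounded (g ` sphere 0 R)" by (intro compact_imp_bounded compact_continuous_image assms) simp
  then show "\<exists>B. \<forall>w\<in>sphere 0 R. \<bar>g w\<bar> \<le> B" by (auto simp: bounded_iff)
qed

lemma sphere_measurable_const: "sphere_measurable R (\<lambda>_. c)"
  by (rule sphere_measurable_continuous) simp

lemma sphere_measurable_cmult: "sphere_measurable R g \<Longrightarrow> sphere_measurable R (\<lambda>w. c * g w)"
  by (rule sphere_measurable_mult[OF sphere_measurable_const])

lemma sphere_measurable_diff:
  "sphere_measurable R f \<Longrightarrow> sphere_measurable R g \<Longrightarrow> sphere_measurable R (\<lambda>w. f w - g w)"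
  using sphere_measurable_add[OF _ sphere_measurable_cmult[of R g "-1"]] by simp

lemma sphere_measurable_sum:
  "(\<And>i. i \<in> I \<Longrightarrow> sphere_measurable R (f i)) \<Longrightarrow> sphere_measurable R (\<lambda>w. \<Sum>i\<in>I. f i w)"
  by (induction I rule: infinite_finite_induct) (auto intro: sphere_measurable_const sphere_measurable_add)

lemma sphere_integral_add:
  assumes "sphere_measurable R f" "sphere_measurable R g" "R > 0"
  shows "sphere_integral R (\<lambda>w. f w + g w) = sphere_integral R f + sphere_integral R g"
  unfolding sphere_integral_def
  using sphere_measurable_integrable[OF assms(1,3)] sphere_measurable_integrable[OF assms(2,3)]
  by (simp add: set_integral_add distrib_left)

lemma sphere_integral_cmult: "sphere_integral R (\<lambda>w. c * g w) = c * sphere_integral R g"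
  unfolding sphere_integral_def by simp

lemma sphere_integral_zero: "sphere_integral R (\<lambda>w. 0) = 0"
  unfolding sphere_integral_def by (simp add: set_lebesgue_integral_def)

lemma sphere_integral_sum:
  assumes "\<And>i. i \<in> I \<Longrightarrow> sphere_measurable R (f i)" "R > 0"
  shows "sphere_integral R (\<lambda>w. \<Sum>i\<in>I. f i w) = (\<Sum>i\<in>I. sphere_integral R (f i))"
  using assms(1)
proof (induction I rule: infinite_finite_induct)
  case (insert i I)
  then show ?case
    using sphere_integral_add[of R "f i" "\<lambda>w. \<Sum>i\<in>I. f i w"] sphere_measurable_sum[of I R f] assms(2) by simp
qed (auto simp: sphere_integral_zero)

lemma content_ball_C2: "R \<ge> 0 \<Longrightarrow> measure lborel (ball (0::C2) R) = pi\<^sup>2 / 2 * R ^ 4"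
  using content_ball[of R "0::C2"] unit_ball_vol_even[of 2] by (simp add: fact_numeral)

lemma sphere_integral_const:
  assumes "R > 0" shows "sphere_integral R (\<lambda>_. c) = 2 * pi\<^sup>2 * R ^ 3 * c"
proof -
  have "(LINT w:ball (0::C2) R|lborel. c) = measure lborel (ball (0::C2) R) * c"
    using emeasure_lborel_ball_finite[of "0::C2" R] by (subst set_integral_const) auto
  also have "\<dots> = pi\<^sup>2 / 2 * (R * R ^ 3) * c"
    using assms by (simp only: content_ball_C2 less_imp_le power_Suc[symmetric]) simp
  finally have "sphere_integral R (\<lambda>_. c) = 4 / R * (pi\<^sup>2 / 2 * (R * R ^ 3) * c)"
    by (simp only: sphere_integral_def)
  also have "\<dots> = 2 * pi\<^sup>2 * R ^ 3 * c" using assms by simp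
  finally show ?thesis .
qed

lemma sphere_integral_bound:
  assumes "sphere_measurable R g" "R > 0" "\<And>w. norm w = R \<Longrightarrow> \<bar>g w\<bar> \<le> B"
  shows "\<bar>sphere_integral R g\<bar> \<le> 2 * pi\<^sup>2 * R ^ 3 * B"
proof -
  \<comment> \<open>Truncating to 0 off the sphere extends the bound to the value used at the
    origin.\<close>
  define g' where "g' w = (if norm w = R then g w else 0)" for w
  obtain b :: C2 where "b \<in> Basis" using nonempty_Basis by blast
  then have "B \<ge> 0" using assms(3)[of "R *\<^sub>R b"] assms(2) by (auto intro: order_trans[OF abs_ge_zero])
  have g': "sphere_measurable R g'" "sphere_integral R g' = sphere_integral R g"
    using sphere_integral_cong[of R g g'] assms by (auto simp: g'_def)
  have "\<bar>LINT w:ball 0 R|lborel. g' ((R / norm w) *\<^sub>R w)\<bar> \<le> (LINT w:ball 0 R|lborel. \<bar>g' ((R / norm w) *\<^sub>R w)\<bar>)"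
    using set_integral_norm_bound[OF sphere_measurable_integrable[OF g'(1) assms(2)]] by simp
  also have "\<dots> \<le> (LINT w:ball (0::C2) R|lborel. B)"
  proof (rule set_integral_mono)
    show "set_integrable lborel (ball 0 R) (\<lambda>w. \<bar>g' ((R / norm w) *\<^sub>R w)\<bar>)"
      using set_integrable_norm[OF sphere_measurable_integrable[OF g'(1) assms(2)]] by simp
    show "set_integrable lborel (ball (0::C2) R) (\<lambda>w. B)"
      using sphere_measurable_integrable[OF sphere_measurable_const assms(2), of B] .
    show "\<And>x. x \<in> ball 0 R \<Longrightarrow> \<bar>g' ((R / norm x) *\<^sub>R x)\<bar> \<le> B"
      using assms(3) \<open>B \<ge> 0\<close> by (auto simp: g'_def)
  qed
  finally have "\<bar>LINT w:ball 0 R|lborel. g' ((R / norm w) *\<^sub>R w)\<bar> \<le> (LINT w:ball (0::C2) R|lborel. B)" .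
  then have "\<bar>sphere_integral R g'\<bar> \<le> sphere_integral R (\<lambda>_. B)"
    unfolding sphere_integral_def using assms(2) by (simp add: abs_mult divide_simps)
  then show ?thesis using g'(2) sphere_integral_const[OF assms(2)] by simp
qed

lemma sphere_integral_dominated_convergence:
  assumes meas: "\<And>n. sphere_measurable R (f n)" and R: "R > 0"
    and bd: "\<And>n w. norm w = R \<Longrightarrow> \<bar>f n w\<bar> \<le> B"
    and lim: "\<And>w. norm w = R \<Longrightarrow> (\<lambda>n. f n w) \<longlonglongrightarrow> g w"
  shows "sphere_measurable R g" "(\<lambda>n. sphere_integral R (f n)) \<longlonglongrightarrow> sphere_integral R g"
proof -
  have "(\<lambda>w. indicator (sphere 0 R) w * g w) \<in> borel_measurable borel"
  proof (rule borel_measurable_LIMSEQ_real)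
    show "\<And>n. (\<lambda>w. indicator (sphere 0 R) w * f n w) \<in> borel_measurable borel"
      using meas by (simp add: sphere_measurable_def)
    show "\<And>w. w \<in> space borel \<Longrightarrow> (\<lambda>n. indicator (sphere 0 R) w * f n w) \<longlonglongrightarrow> indicator (sphere 0 R) w * g w"
      using lim by (auto simp: indicator_def)
  qed
  moreover have "\<bar>g w\<bar> \<le> B" if "norm w = R" for w
    by (rule LIMSEQ_le_const2[OF tendsto_rabs[OF lim[OF that]]]) (use bd that in auto)
  ultimately show g: "sphere_measurable R g" unfolding sphere_measurable_def by (intro conjI exI[of _ B]) simp_all
  define z where "z w = (R / norm w) *\<^sub>R w" for w :: C2
  have "(\<lambda>n. LINT w:ball 0 R|lborel. f n (z w)) \<longlonglongrightarrow> (LINT w:ball 0 R|lborel. g (z w))"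
    unfolding set_lebesgue_integral_def
  proof (rule integral_dominated_convergence[of _ _ _ "\<lambda>w. B * indicator (ball 0 R) w"])
    show "(\<lambda>x. indicat_real (ball 0 R) x *\<^sub>R g (z x)) \<in> borel_measurable lborel"
      unfolding z_def by (intro borel_measurable_scaleR borel_measurable_indicator)
        (use sphere_measurable_radial[OF g R] in simp_all)
    show "(\<lambda>x. indicat_real (ball 0 R) x *\<^sub>R f n (z x)) \<in> borel_measurable lborel" for n
      unfolding z_def by (intro borel_measurable_scaleR borel_measurable_indicator)
        (use sphere_measurable_radial[OF meas[of n] R] in simp_all)
    show "integrable lborel (\<lambda>w::C2. B * indicator (ball 0 R) w)"
      by (intro integrable_mult_right integrable_real_indicator) (use emeasure_lborel_ball_finite[of "0::C2" R] in auto)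
    have nz: "AE w in lborel. w \<noteq> (0::C2)" by (rule AE_lborel_singleton)
    then show "AE x in lborel. (\<lambda>n. indicat_real (ball 0 R) x *\<^sub>R f n (z x)) \<longlonglongrightarrow> indicat_real (ball 0 R) x *\<^sub>R g (z x)"
      by eventually_elim (use lim R in \<open>auto simp: z_def indicator_def\<close>)
    show "AE x in lborel. norm (indicat_real (ball 0 R) x *\<^sub>R f n (z x)) \<le> B * indicator (ball 0 R) x" for n
      using nz by eventually_elim (use bd R in \<open>auto simp: z_def indicator_def\<close>)
  qed
  then show "(\<lambda>n. sphere_integral R (f n)) \<longlonglongrightarrow> sphere_integral R g"
    unfolding sphere_integral_def z_def by (intro tendsto_intros)
qed

text \<open>An orthogonal map commutes with radial projection and preserves both the ball and
  Lebesgue measure.\<close>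

lemma sphere_integral_orthogonal:
  assumes T: "orthogonal_transformation T" and g: "sphere_measurable R g" and R: "R > 0"
  shows "sphere_measurable R (\<lambda>w. g (T w))" "sphere_integral R (\<lambda>w. g (T w)) = sphere_integral R g"
proof -
  have nT: "norm (T w) = norm w" for w by (rule orthogonal_transformation_norm[OF T])
  have linT: "linear T" using T by (rule orthogonal_transformation_linear)
  have [measurable]: "T \<in> borel \<rightarrow>\<^sub>M borel"
    by (intro borel_measurable_continuous_onI linear_continuous_on linT[THEN linear_conv_bounded_linear[THEN iffD1]])
  have [measurable]: "(\<lambda>w. indicator (sphere 0 R) w * g w) \<in> borel_measurable borel"
    using g by (simp add: sphere_measurable_def)
  have "(\<lambda>w. indicator (sphere 0 R) (T w) * g (T w)) \<in> borel_measurable borel"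
    by (rule measurable_compose[of T borel borel "\<lambda>w. indicator (sphere 0 R) w * g w"]) measurable
  moreover have "indicator (sphere 0 R) (T w) = (indicator (sphere 0 R) w :: real)" for w
    by (auto simp: indicator_def nT)
  ultimately have "(\<lambda>w. indicator (sphere 0 R) w * g (T w)) \<in> borel_measurable borel" by simp
  moreover obtain B where B: "\<And>w. w \<in> sphere 0 R \<Longrightarrow> \<bar>g w\<bar> \<le> B"
    using g unfolding sphere_measurable_def by blast
  have "\<bar>g (T w)\<bar> \<le> B" if "w \<in> sphere 0 R" for w
    using that by (intro B) (simp add: nT)
  ultimately show "sphere_measurable R (\<lambda>w. g (T w))" unfolding sphere_measurable_def by blast
  have [measurable]: "(\<lambda>w. g ((R / norm w) *\<^sub>R w)) \<in> borel_measurable borel"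
    by (rule sphere_measurable_radial[OF g R])
  define k where "k w = indicator (ball 0 R) w *\<^sub>R g ((R / norm w) *\<^sub>R w)" for w :: C2
  have [measurable]: "k \<in> borel_measurable borel"
    unfolding k_def by (intro borel_measurable_scaleR borel_measurable_indicator)
      (use sphere_measurable_radial[OF g R] in simp_all)
  have "(\<integral>w. k w \<partial>lborel) = (\<integral>w. k w \<partial>distr lborel borel T)"
    by (simp add: distr_lborel_orthogonal[OF T])
  also have "\<dots> = (\<integral>w. k (T w) \<partial>lborel)" by (rule integral_distr) measurable
  also have "(\<lambda>w. k (T w)) = (\<lambda>w. indicator (ball 0 R) w *\<^sub>R g (T ((R / norm w) *\<^sub>R w)))"
    by (rule ext) (simp add: k_def nT indicator_def linear_scale[OF linT])
  finally show "sphere_integral R (\<lambda>w. g (T w)) = sphere_integral R g"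
    unfolding sphere_integral_def set_lebesgue_integral_def k_def by simp
qed

section \<open>Limits at infinity\<close>

lemma segment_derivative_bound:
  fixes f :: "'a::euclidean_space \<Rightarrow> real"
  assumes der: "\<And>w. r \<le> norm w \<Longrightarrow> (f has_derivative f' w) (at w)"
    and bd: "\<And>w v. r \<le> norm w \<Longrightarrow> \<bar>f' w v\<bar> \<le> B * norm v"
    and seg: "\<And>z. z \<in> closed_segment x y \<Longrightarrow> r \<le> norm z"
  shows "\<bar>f x - f y\<bar> \<le> B * norm (x - y)"
proof -
  have "norm (f x - f y) \<le> B * norm (x - y)"
  proof (rule differentiable_bound[of "closed_segment x y" f f'])
    fix z assume z: "z \<in> closed_segment x y"
    show "(f has_derivative f' z) (at z within closed_segment x y)"
      using der[OF seg[OF z]] by (rule has_derivative_at_withinI)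
    show "onorm (f' z) \<le> B"
      using bd[OF seg[OF z]] by (intro onorm_le) auto
  qed auto
  then show ?thesis by simp
qed

text \<open>Dyadic telescoping gives a limit along each ray; the limit is locally constant in the
  direction since \<open>f\<close> oscillates by \<open>O(r\<^sup>-\<^sup>s)\<close> on a ball of radius comparable to \<open>r\<close>.\<close>

lemma limit_at_infinity_of_derivative_bound:
  fixes f :: "'a::euclidean_space \<Rightarrow> real"
  assumes dim: "2 \<le> DIM('a)" and s: "s > 0"
    and der: "\<forall>\<^sub>F w in at_infinity. (f has_derivative f' w) (at w)"
    and bd: "\<forall>\<^sub>F w in at_infinity. \<forall>v. \<bar>f' w v\<bar> \<le> C * norm w powr (-1-s) * norm v"
  obtains L K where "\<forall>\<^sub>F w in at_infinity. \<bar>f w - L\<bar> \<le> K * norm w powr (-s)"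
proof -
  obtain b1 where b1: "\<And>w. b1 \<le> norm w \<Longrightarrow> (f has_derivative f' w) (at w)"
    using der unfolding eventually_at_infinity by blast
  obtain b2 where b2: "\<And>w v. b2 \<le> norm w \<Longrightarrow> \<bar>f' w v\<bar> \<le> C * norm w powr (-1-s) * norm v"
    using bd unfolding eventually_at_infinity by blast
  define R where "R = max 1 (max b1 b2)"
  define D where "D = max C 0"
  have R: "R \<ge> 1" "R \<ge> b1" "R \<ge> b2" by (auto simp: R_def)
  have D: "D \<ge> 0" "C \<le> D" by (auto simp: D_def)
  have bd': "\<bar>f' w v\<bar> \<le> D * r powr (-1-s) * norm v" if "R \<le> r" "r \<le> norm w" for r w v
  proof -
    have "\<bar>f' w v\<bar> \<le> C * norm w powr (-1-s) * norm v" using that R by (intro b2) auto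
    also have "\<dots> \<le> D * r powr (-1-s) * norm v"
      using that R s D by (intro mult_right_mono mult_mono powr_mono2') auto
    finally show ?thesis .
  qed
  have seg: "\<bar>f x - f y\<bar> \<le> D * r powr (-1-s) * norm (x - y)"
    if "R \<le> r" "\<And>z. z \<in> closed_segment x y \<Longrightarrow> r \<le> norm z" for x y r
    by (rule segment_derivative_bound[of r f f' "D * r powr (-1-s)", OF _ _ that(2)]) (use that R bd' b1 in auto)
  have dbl: "\<bar>f (2 *\<^sub>R x) - f x\<bar> \<le> D * norm x powr (-s)" if "R \<le> norm x" for x
  proof -
    have "\<bar>f (2 *\<^sub>R x) - f x\<bar> \<le> D * norm x powr (-1-s) * norm (2 *\<^sub>R x - x)"
    proof (rule seg[OF that])
      fix z assume "z \<in> closed_segment (2 *\<^sub>R x) x"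
      then obtain u where "0 \<le> u" "u \<le> 1" "z = (1-u) *\<^sub>R (2 *\<^sub>R x) + u *\<^sub>R x"
        by (auto simp: in_segment)
      then have "z = (2-u) *\<^sub>R x" by (simp add: algebra_simps scaleR_2)
      then have "norm z = (2-u) * norm x" using \<open>u \<le> 1\<close> by simp
      also have "\<dots> \<ge> 1 * norm x" using \<open>u \<le> 1\<close> by (intro mult_right_mono) auto
      finally show "norm x \<le> norm z" by simp
    qed
    also have "norm (2 *\<^sub>R x - x) = norm x powr 1" using that R by (simp add: scaleR_2)
    finally show ?thesis using powr_add[of "norm x" "-1-s" 1] by (simp add: mult.assoc)
  qed
  \<comment> \<open>The sum of the geometric series of doubling errors. Since D = K (1 - 2^-s), each
    doubling step is bounded by a difference, and the bounds telescope.\<close>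
  define K where "K = D / (1 - 2 powr (-s))"
  have q: "(2::real) powr (-s) < 1" using s powr_less_mono[of "-s" 0 2] by simp
  then have K: "K \<ge> 0" "D = K * (1 - 2 powr (-s))" using D by (auto simp: K_def)
  have tele: "\<bar>f (2^n *\<^sub>R x) - f x\<bar> \<le> K * (norm x powr (-s) - norm (2^n *\<^sub>R x) powr (-s))"
    if x: "R \<le> norm x" for x n
  proof (induction n)
    case (Suc n)
    let ?y = "2^n *\<^sub>R x"
    have "1 * norm x \<le> 2^n * norm x" by (intro mult_right_mono) auto
    then have y: "R \<le> norm ?y" using x by simp
    have "\<bar>f (2 *\<^sub>R ?y) - f ?y\<bar> \<le> K * (1 - 2 powr (-s)) * norm ?y powr (-s)"
      using dbl[OF y] K by simp
    also have "\<dots> = K * (norm ?y powr (-s) - norm (2 *\<^sub>R ?y) powr (-s))"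
      by (simp add: powr_mult algebra_simps)
    finally show ?case using Suc by (simp add: algebra_simps)
  qed simp
  have tele2: "\<bar>f (2^m *\<^sub>R x) - f (2^n *\<^sub>R x)\<bar> \<le> K * norm (2^n *\<^sub>R x) powr (-s)"
    if x: "R \<le> norm x" and "n \<le> m" for x m n
  proof -
    have "1 * norm x \<le> 2^n * norm x" by (intro mult_right_mono) auto
    then have y: "R \<le> norm (2^n *\<^sub>R x)" using x by simp
    have "2^(m-n) * 2^n = (2::real)^m" using that(2) by (simp add: power_add[symmetric])
    then have "\<bar>f (2^m *\<^sub>R x) - f (2^n *\<^sub>R x)\<bar> \<le> K * (norm (2^n *\<^sub>R x) powr (-s) - norm (2^m *\<^sub>R x) powr (-s))"
      using tele[OF y, of "m-n"] by simp
    also have "\<dots> \<le> K * norm (2^n *\<^sub>R x) powr (-s)" using K by (intro mult_left_mono) auto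
    finally show ?thesis .
  qed
  have scal: "(\<lambda>n. M * norm (2^n *\<^sub>R x) powr (-t)) \<longlonglongrightarrow> 0" if "x \<noteq> 0" "t > 0" for x :: 'a and M t
  proof -
    have "filterlim (\<lambda>n. 2^n :: real) at_top sequentially"
      by (rule filterlim_at_top_mono[OF filterlim_real_sequentially])
         (auto intro!: always_eventually less_imp_le of_nat_less_two_power)
    then have "filterlim (\<lambda>n. norm x * 2^n) at_top sequentially"
      using that by (intro filterlim_tendsto_pos_mult_at_top[OF tendsto_const]) auto
    then have "filterlim (\<lambda>n. 2^n * norm x) at_top sequentially" by (simp add: mult.commute)
    then have "(\<lambda>n. M * (2^n * norm x) powr (-t)) \<longlonglongrightarrow> M * 0"
      using that by (intro tendsto_mult tendsto_const tendsto_neg_powr) auto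
    then show ?thesis by simp
  qed
  have conv: "\<exists>L. (\<lambda>n. f (2^n *\<^sub>R x)) \<longlonglongrightarrow> L" if x: "R \<le> norm x" for x
  proof -
    have "Cauchy (\<lambda>n. f (2^n *\<^sub>R x))"
    proof (rule metric_CauchyI)
      fix e :: real assume "e > 0"
      have "x \<noteq> 0" using x R by auto
      then have "\<forall>\<^sub>F n in sequentially. K * norm (2^n *\<^sub>R x) powr (-s) < e / 2"
        using order_tendstoD(2)[OF scal[of x s K], of "e/2"] s \<open>e > 0\<close> by simp
      then obtain N where N: "K * norm (2^N *\<^sub>R x) powr (-s) < e / 2"
        unfolding eventually_sequentially by blast
      have "dist (f (2^m *\<^sub>R x)) (f (2^n *\<^sub>R x)) < e" if "m \<ge> N" "n \<ge> N" for m n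
        using tele2[OF x that(1)] tele2[OF x that(2)] N unfolding dist_real_def by linarith
      then show "\<exists>M. \<forall>m\<ge>M. \<forall>n\<ge>M. dist (f (2^m *\<^sub>R x)) (f (2^n *\<^sub>R x)) < e" by blast
    qed
    then show ?thesis using Cauchy_convergent convergent_def by blast
  qed
  define L where "L x = lim (\<lambda>n. f (2^n *\<^sub>R x))" for x
  have L: "(\<lambda>n. f (2^n *\<^sub>R x)) \<longlonglongrightarrow> L x" if "R \<le> norm x" for x
    using conv[OF that] unfolding L_def by (simp add: convergent_LIMSEQ_iff[symmetric] convergent_def)
  have Lb: "\<bar>f x - L x\<bar> \<le> K * norm x powr (-s)" if x: "R \<le> norm x" for x
  proof -
    have "(\<lambda>n. \<bar>f (2^n *\<^sub>R x) - f x\<bar>) \<longlonglongrightarrow> \<bar>L x - f x\<bar>"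
      by (intro tendsto_intros L x)
    moreover have "\<And>n. \<bar>f (2^n *\<^sub>R x) - f x\<bar> \<le> K * norm x powr (-s)"
      using tele2[OF x, of 0] by simp
    ultimately have "\<bar>L x - f x\<bar> \<le> K * norm x powr (-s)"
      by (intro LIMSEQ_le_const2) auto
    then show ?thesis by (simp add: abs_minus_commute)
  qed
  \<comment> \<open>The segment from x to y stays outside radius |x| / 2, so at scale 2^n the
    derivative bound times the length is of order (2^n |x|)^-s and vanishes in the limit.\<close>
  have loc: "L x = L y" if x: "2 * R \<le> norm x" and xy: "norm (x - y) \<le> norm x / 2" for x y
  proof -
    have half: "norm x / 2 \<le> norm z" if "z \<in> closed_segment x y" for z
    proof -
      have "norm (x - z) \<le> norm (x - y)"
        using that segment_bound(1)[of z x y] by (simp add: norm_minus_commute)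
      then show ?thesis using xy norm_triangle_ineq2[of x "x - z"] by simp
    qed
    have "R \<le> norm y" using half[of y] x by simp
    have bdn: "\<bar>f (2^n *\<^sub>R x) - f (2^n *\<^sub>R y)\<bar> \<le> D * 2 powr (1+s) * norm (2^n *\<^sub>R x) powr (-s)" for n
    proof -
      have r: "R \<le> 2^n * norm x / 2"
      proof -
        have "1 * norm x \<le> 2^n * norm x" by (intro mult_right_mono) auto
        then show ?thesis using x by simp
      qed
      have "\<bar>f (2^n *\<^sub>R x) - f (2^n *\<^sub>R y)\<bar> \<le> D * (2^n * norm x / 2) powr (-1-s) * norm (2^n *\<^sub>R x - 2^n *\<^sub>R y)"
      proof (rule seg[OF r])
        fix z assume "z \<in> closed_segment (2^n *\<^sub>R x) (2^n *\<^sub>R y)"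
        then obtain z' where z': "z' \<in> closed_segment x y" "z = 2^n *\<^sub>R z'"
          using closed_segment_linear_image[of "\<lambda>x. 2^n *\<^sub>R x" x y] linear_scaleR by auto
        have "2^n * (norm x / 2) \<le> 2^n * norm z'" by (intro mult_left_mono half z') auto
        then show "2^n * norm x / 2 \<le> norm z" using z' by simp
      qed
      also have "\<dots> \<le> D * (2^n * norm x / 2) powr (-1-s) * (2^n * norm x)"
      proof (rule mult_left_mono)
        have "norm (2^n *\<^sub>R x - 2^n *\<^sub>R y) = 2^n * norm (x - y)" by (simp flip: scaleR_diff_right)
        also have "\<dots> \<le> 2^n * norm x" using xy by (intro mult_left_mono) (auto intro: order_trans[OF xy])
        finally show "norm (2^n *\<^sub>R x - 2^n *\<^sub>R y) \<le> 2^n * norm x" .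
      qed (use D in auto)
      also have "(2^n * norm x / 2) powr (-1-s) = 2 powr (1+s) * (2^n * norm x) powr (-1-s)"
        by (simp add: powr_divide powr_minus_divide[of 2 "1+s"] powr_minus[symmetric])
           (simp add: powr_diff powr_minus powr_add field_simps)
      also have "D * (2 powr (1+s) * (2^n * norm x) powr (-1-s)) * (2^n * norm x)
         = D * 2 powr (1+s) * ((2^n * norm x) powr (-1-s) * (2^n * norm x) powr 1)"
        by (simp add: mult_ac)
      also have "(2^n * norm x) powr (-1-s) * (2^n * norm x) powr 1 = (2^n * norm x) powr (-s)"
        by (simp only: powr_add[symmetric]) simp
      finally show ?thesis by simp
    qed
    have "x \<noteq> 0" using x R by auto
    have "(\<lambda>n. f (2^n *\<^sub>R x) - f (2^n *\<^sub>R y)) \<longlonglongrightarrow> 0"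
      by (rule Lim_null_comparison[OF _ scal[OF \<open>x \<noteq> 0\<close> s, of "D * 2 powr (1+s)"]])
         (use bdn in \<open>auto intro!: always_eventually\<close>)
    moreover have "R \<le> norm x" using x R by linarith
    then have "(\<lambda>n. f (2^n *\<^sub>R x) - f (2^n *\<^sub>R y)) \<longlonglongrightarrow> L x - L y"
      using \<open>R \<le> norm y\<close> by (intro tendsto_diff L)
    ultimately have "L x - L y = 0" using LIMSEQ_unique by blast
    then show ?thesis by simp
  qed
  \<comment> \<open>Connectedness of the exterior, which needs dimension at least 2, makes the
    locally constant limit constant.\<close>
  have "connected (- cball (0::'a) (2*R))"
    using dim by (intro connected_complement_bounded_convex) auto
  then have const: "L x = L y" if "norm x > 2*R" "norm y > 2*R" for x y
  proof (rule connected_local_const)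
    show "x \<in> - cball 0 (2*R)" "y \<in> - cball 0 (2*R)" using that by auto
    show "\<forall>a\<in>- cball 0 (2*R). \<forall>\<^sub>F b in at a within - cball 0 (2*R). L a = L b"
    proof
      fix a :: 'a assume "a \<in> - cball 0 (2*R)"
      then have a: "2 * R < norm a" by (simp add: not_le)
      then have "norm a / 2 > 0" using R(1) by linarith
      then have "\<forall>\<^sub>F b in at a within - cball 0 (2*R). dist b a < norm a / 2"
        unfolding eventually_at by blast
      then show "\<forall>\<^sub>F b in at a within - cball 0 (2*R). L a = L b"
        by eventually_elim (use a in \<open>auto intro!: loc simp: dist_norm norm_minus_commute\<close>)
    qed
  qed
  obtain b :: 'a where "b \<in> Basis" using nonempty_Basis by blast
  define l where "l = L ((2*R+1) *\<^sub>R b)"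
  have l: "L x = l" if "norm x > 2*R" for x
    unfolding l_def using that R \<open>b \<in> Basis\<close> by (intro const) auto
  have "\<forall>\<^sub>F w in at_infinity. \<bar>f w - l\<bar> \<le> K * norm w powr (-s)"
    using eventually_norm_gt[of "2*R"]
  proof eventually_elim
    case (elim w)
    then show ?case using Lb[of w] l[of w] R by simp
  qed
  then show thesis by (rule that)
qed

text \<open>If the conclusion fails at \<open>w\<^sub>0\<close>, then the minimum of \<open>|G w| + \<epsilon> |w - w\<^sub>0|\<close> over the exterior of
  a ball is attained in the interior, where moving along the preimage of \<open>- G w\<close> decreases it.\<close>

lemma proper_expanding_lower_bound:
  fixes G :: "'a::euclidean_space \<Rightarrow> 'a"
  assumes K: "K > 0"
    and der: "\<forall>\<^sub>F w in at_infinity. (G has_derivative DG w) (at w)"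
    and sur: "\<forall>\<^sub>F w in at_infinity. \<forall>y. \<exists>v. DG w v = y \<and> norm v \<le> K * norm y"
    and lim: "filterlim G at_infinity at_infinity"
  obtains c where "c > 0" "\<forall>\<^sub>F w in at_infinity. norm (G w) \<ge> c * norm w"
proof -
  have "\<forall>\<^sub>F w in at_infinity. norm (G w) > 0"
    using lim eventually_norm_gt[of 0] unfolding filterlim_iff by blast
  with der sur have "\<forall>\<^sub>F w in at_infinity. (G has_derivative DG w) (at w) \<and>
     (\<forall>y. \<exists>v. DG w v = y \<and> norm v \<le> K * norm y) \<and> norm (G w) > 0"
    by eventually_elim auto
  then obtain R where R: "\<And>w. R \<le> norm w \<Longrightarrow> (G has_derivative DG w) (at w)"
      "\<And>w y. R \<le> norm w \<Longrightarrow> \<exists>v. DG w v = y \<and> norm v \<le> K * norm y"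
      "\<And>w. R \<le> norm w \<Longrightarrow> norm (G w) > 0"
    unfolding eventually_at_infinity by blast
  \<comment> \<open>Moving with velocity v, |v| <= K, lowers |G| at unit rate and raises \<epsilon>
    |w - w0| at rate at most \<epsilon> K = 1/2, so the sum still decreases.\<close>
  define \<epsilon> where "\<epsilon> = 1 / (2 * K)"
  have \<epsilon>: "\<epsilon> > 0" "\<epsilon> * K = 1/2" using K by (auto simp: \<epsilon>_def)
  have main: "\<epsilon> * (norm w0 - R) \<le> norm (G w0)" if w0: "norm w0 > R" for w0
  proof -
    define \<phi> where "\<phi> w = norm (G w) + \<epsilon> * norm (w - w0)" for w
    \<comment> \<open>Compact truncation: outside this ball the term \<epsilon> |w - w0| alone
      exceeds the value of \<phi> at w0.\<close>
    define S where "S = {w. R \<le> norm w} \<inter> cball w0 (\<phi> w0 / \<epsilon>)"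
    have "closed {w::'a. R \<le> norm w}" by (intro closed_Collect_le continuous_intros)
    then have "compact S" unfolding S_def by (intro closed_Int_compact) auto
    moreover have "w0 \<in> S" using w0 \<epsilon> by (auto simp: S_def \<phi>_def)
    moreover have "continuous_on S \<phi>"
    proof -
      have "continuous_on S G"
        by (rule continuous_at_imp_continuous_on) (auto simp: S_def intro: has_derivative_continuous R(1))
      then show ?thesis unfolding \<phi>_def by (intro continuous_intros)
    qed
    ultimately obtain w where w: "w \<in> S" "\<And>x. x \<in> S \<Longrightarrow> \<phi> w \<le> \<phi> x"
      using continuous_attains_inf[of S \<phi>] by blast
    have min: "\<phi> w \<le> \<phi> x" if "R \<le> norm x" for x
    proof (cases "x \<in> S")
      case False
      then have "dist w0 x > \<phi> w0 / \<epsilon>" using that by (auto simp: S_def)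
      then have "\<phi> w0 < \<epsilon> * norm (x - w0)" using \<epsilon> by (simp add: field_simps dist_norm norm_minus_commute)
      also have "\<dots> \<le> \<phi> x" by (simp add: \<phi>_def)
      finally show ?thesis using w(2)[OF \<open>w0 \<in> S\<close>] by simp
    qed (rule w(2))
    have "norm w = R"
    proof (rule ccontr)
      assume "norm w \<noteq> R"
      with w(1) have wR: "R < norm w" by (simp add: S_def)
      let ?y = "- (G w /\<^sub>R norm (G w))"
      have G0: "G w \<noteq> 0" using R(3)[of w] wR by auto
      obtain v where v: "DG w v = ?y" "norm v \<le> K * norm ?y" using R(2)[of w ?y] wR by auto
      have nv: "norm v \<le> K" using v(2) G0 by simp
      have "((\<lambda>t. G (w + t *\<^sub>R v)) has_derivative (\<lambda>t. DG w (t *\<^sub>R v))) (at 0)"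
        by (rule has_derivative_compose[of "\<lambda>t. w + t *\<^sub>R v" _ 0 UNIV G "DG w"])
           (use R(1)[of w] wR in \<open>auto intro!: derivative_eq_intros\<close>)
      then have "((\<lambda>t. norm (G (w + t *\<^sub>R v))) has_derivative (\<lambda>t. DG w (t *\<^sub>R v) \<bullet> sgn (G w))) (at 0)"
        using has_derivative_compose[of "\<lambda>t. G (w + t *\<^sub>R v)" "\<lambda>t. DG w (t *\<^sub>R v)" 0 UNIV norm "\<lambda>h. h \<bullet> sgn (G w)"]
          has_derivative_norm[OF G0] by simp
      moreover have "DG w (t *\<^sub>R v) \<bullet> sgn (G w) = - t" for t
      proof -
        have "DG w (t *\<^sub>R v) = t *\<^sub>R ?y"
          using R(1)[of w] wR v(1) by (metis has_derivative_linear less_imp_le linear_scale)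
        then show ?thesis using G0
          by (simp add: sgn_div_norm power2_norm_eq_inner[symmetric] power2_eq_square field_simps)
      qed
      ultimately have "((\<lambda>t. norm (G (w + t *\<^sub>R v))) has_derivative (*) (-1)) (at 0)"
        by (elim has_derivative_eq_rhs) (auto simp: fun_eq_iff)
      then have "((\<lambda>t. norm (G (w + t *\<^sub>R v))) has_real_derivative -1) (at 0)"
        by (simp only: has_field_derivative_def)
      then have "((\<lambda>t. norm (G (w + t *\<^sub>R v)) + t / 2) has_real_derivative (-1 + 1/2)) (at 0)"
        by (intro derivative_intros) (auto intro!: derivative_eq_intros)
      from DERIV_neg_dec_right[OF this] obtain d where d: "d > 0"
        "\<And>h. h > 0 \<Longrightarrow> h < d \<Longrightarrow> norm (G (w + (0 + h) *\<^sub>R v)) + (0 + h) / 2 < norm (G (w + 0 *\<^sub>R v)) + 0 / 2"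
        by auto
      have "((\<lambda>h. norm (w + h *\<^sub>R v)) \<longlongrightarrow> norm (w + 0 *\<^sub>R v)) (at_right 0)"
        by (intro tendsto_intros)
      then have "\<forall>\<^sub>F h in at_right 0. R < norm (w + h *\<^sub>R v)"
        using wR by (intro order_tendstoD(1)) auto
      moreover have "\<forall>\<^sub>F h in at_right 0. 0 < h \<and> h < d"
        using d(1) by (auto simp: eventually_at_right intro!: exI[of _ d])
      ultimately have "\<forall>\<^sub>F h in at_right (0::real). False"
      proof eventually_elim
        case (elim h)
        have "norm (w + h *\<^sub>R v - w0) \<le> norm (w - w0) + h * norm v"
          using norm_triangle_ineq[of "w - w0" "h *\<^sub>R v"] elim by (simp add: algebra_simps)
        also have "\<dots> \<le> norm (w - w0) + h * K" using nv elim by simp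
        finally have "\<epsilon> * norm (w + h *\<^sub>R v - w0) \<le> \<epsilon> * (norm (w - w0) + h * K)"
          using \<epsilon> by simp
        also have "\<dots> = \<epsilon> * norm (w - w0) + h / 2" using \<epsilon>(2) by (simp add: algebra_simps)
        finally have "\<phi> (w + h *\<^sub>R v) < \<phi> w"
          using d(2)[of h] elim by (simp add: \<phi>_def)
        then show False using min[of "w + h *\<^sub>R v"] elim by simp
      qed
      then show False by simp
    qed
    \<comment> \<open>The minimum sits on the inner boundary |w| = R, so it is at least |w0| - R
      away from w0.\<close>
    then have "norm w0 - R \<le> norm (w - w0)"
      using norm_triangle_ineq2[of w0 w] by (simp add: norm_minus_commute)
    then have "\<epsilon> * (norm w0 - R) \<le> \<phi> w" using \<epsilon> by (simp add: \<phi>_def add_increasing)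
    also have "\<dots> \<le> \<phi> w0" using w0 by (intro min) auto
    finally show ?thesis by (simp add: \<phi>_def)
  qed
  show thesis
  proof (rule that[of "\<epsilon>/2"])
    show "\<forall>\<^sub>F w in at_infinity. norm (G w) \<ge> \<epsilon> / 2 * norm w"
      using eventually_norm_gt[of R] eventually_norm_gt[of "2 * R"]
    proof eventually_elim
      case (elim w)
      have "\<epsilon> * (norm w / 2) \<le> \<epsilon> * (norm w - R)" using elim \<epsilon> by (intro mult_left_mono) auto
      then show ?case using main[OF elim(1)] by simp
    qed
  qed (use \<epsilon> in auto)
qed

section \<open>Symmetry of second derivatives\<close>

lemma mixed_difference_mean_value:
  fixes f :: "'a::real_normed_vector \<Rightarrow> real"
  assumes der: "\<And>y. y \<in> S \<Longrightarrow> (f has_derivative f' y) (at y)"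
    and der2: "\<And>y. y \<in> S \<Longrightarrow> ((\<lambda>y. f' y u) has_derivative f'' y) (at y)"
    and h: "h > 0" and S: "\<And>s t. 0 \<le> s \<Longrightarrow> s \<le> h \<Longrightarrow> 0 \<le> t \<Longrightarrow> t \<le> h \<Longrightarrow> x + s *\<^sub>R u + t *\<^sub>R v \<in> S"
  obtains s t where "0 < s" "s < h" "0 < t" "t < h"
    "f (x + h *\<^sub>R u + h *\<^sub>R v) - f (x + h *\<^sub>R u) - f (x + h *\<^sub>R v) + f x = h\<^sup>2 * f'' (x + s *\<^sub>R u + t *\<^sub>R v) v"
proof -
  have line: "((\<lambda>s. g (y + s *\<^sub>R z)) has_real_derivative g' z) (at s)"
    if "(g has_derivative g') (at (y + s *\<^sub>R z))" for g :: "'a \<Rightarrow> real" and g' y s z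
  proof -
    have "((\<lambda>s. g (y + s *\<^sub>R z)) has_derivative (\<lambda>t. g' (t *\<^sub>R z))) (at s)"
      by (rule has_derivative_compose[of "\<lambda>s. y + s *\<^sub>R z" "\<lambda>t. t *\<^sub>R z" s UNIV g g'])
         (auto intro!: derivative_eq_intros that)
    moreover have "g' (t *\<^sub>R z) = g' z * t" for t
      using linear_scale[OF has_derivative_linear[OF that]] by simp
    ultimately show ?thesis by (simp add: has_field_derivative_def)
  qed
  define g where "g s = f ((x + h *\<^sub>R v) + s *\<^sub>R u) - f (x + s *\<^sub>R u)" for s
  have "\<exists>s. 0 < s \<and> s < h \<and> g h - g 0 = (h - 0) * (f' ((x + h *\<^sub>R v) + s *\<^sub>R u) u - f' (x + s *\<^sub>R u) u)"
  proof (rule MVT2[OF h])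
    fix s assume "0 \<le> s" "s \<le> h"
    then have "(x + h *\<^sub>R v) + s *\<^sub>R u \<in> S" "x + s *\<^sub>R u \<in> S"
      using S[of s h] S[of s 0] h by (auto simp: algebra_simps)
    then show "(g has_real_derivative f' ((x + h *\<^sub>R v) + s *\<^sub>R u) u - f' (x + s *\<^sub>R u) u) (at s)"
      unfolding g_def by (intro DERIV_diff line der)
  qed
  then obtain s where s: "0 < s" "s < h" "g h - g 0 = h * (f' ((x + h *\<^sub>R v) + s *\<^sub>R u) u - f' (x + s *\<^sub>R u) u)"
    by auto
  have "\<exists>t. 0 < t \<and> t < h \<and> f' ((x + s *\<^sub>R u) + h *\<^sub>R v) u - f' ((x + s *\<^sub>R u) + 0 *\<^sub>R v) u
      = (h - 0) * f'' ((x + s *\<^sub>R u) + t *\<^sub>R v) v"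
  proof (rule MVT2[OF h])
    fix t assume "0 \<le> t" "t \<le> h"
    then have "(x + s *\<^sub>R u) + t *\<^sub>R v \<in> S" using S[of s t] s by auto
    then show "((\<lambda>t. f' ((x + s *\<^sub>R u) + t *\<^sub>R v) u) has_real_derivative f'' ((x + s *\<^sub>R u) + t *\<^sub>R v) v) (at t)"
      using der2 by (intro line[of "\<lambda>y. f' y u"])
  qed
  then obtain t where t: "0 < t" "t < h"
    "f' (x + s *\<^sub>R u + h *\<^sub>R v) u - f' (x + s *\<^sub>R u) u = h * f'' (x + s *\<^sub>R u + t *\<^sub>R v) v" by auto
  show thesis
  proof (rule that[OF s(1,2) t(1,2)])
    have "f (x + h *\<^sub>R u + h *\<^sub>R v) - f (x + h *\<^sub>R u) - f (x + h *\<^sub>R v) + f x = g h - g 0"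
      by (simp add: g_def add_ac)
    then show "f (x + h *\<^sub>R u + h *\<^sub>R v) - f (x + h *\<^sub>R u) - f (x + h *\<^sub>R v) + f x = h\<^sup>2 * f'' (x + s *\<^sub>R u + t *\<^sub>R v) v"
      using s(3) t(3) by (simp add: add_ac power2_eq_square)
  qed
qed

text \<open>The second difference over a small parallelogram is symmetric in u and v, and by two
  mean value theorems it equals h^2 times either mixed derivative at a nearby point.\<close>

lemma second_derivative_symmetric:
  fixes f :: "'a::real_normed_vector \<Rightarrow> real"
  assumes S: "open S" "x \<in> S"
    and der: "\<And>y. y \<in> S \<Longrightarrow> (f has_derivative f' y) (at y)"
    and der2: "\<And>y u. y \<in> S \<Longrightarrow> ((\<lambda>y. f' y u) has_derivative f'' y u) (at y)"
    and cont: "\<And>u v. isCont (\<lambda>y. f'' y u v) x"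
  shows "f'' x u v = f'' x v u"
proof (rule ccontr)
  assume ne: "f'' x u v \<noteq> f'' x v u"
  define e where "e = \<bar>f'' x u v - f'' x v u\<bar> / 2"
  have "e > 0" using ne by (simp add: e_def)
  obtain d0 where d0: "d0 > 0" "ball x d0 \<subseteq> S" using S open_contains_ball by blast
  obtain d1 where d1: "d1 > 0" "\<And>y. dist y x < d1 \<Longrightarrow> \<bar>f'' y u v - f'' x u v\<bar> < e"
    using cont[of u v] \<open>e > 0\<close> unfolding continuous_at_eps_delta dist_real_def by blast
  obtain d2 where d2: "d2 > 0" "\<And>y. dist y x < d2 \<Longrightarrow> \<bar>f'' y v u - f'' x v u\<bar> < e"
    using cont[of v u] \<open>e > 0\<close> unfolding continuous_at_eps_delta dist_real_def by blast
  define d where "d = min d0 (min d1 d2)"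
  \<comment> \<open>The parallelogram of side factor h lies in the ball of radius d; the summand 1
    keeps the denominator positive for u = v = 0.\<close>
  define h where "h = d / (2 * (norm u + norm v + 1))"
  have "d > 0" using d0 d1 d2 by (simp add: d_def)
  then have h: "h > 0" by (simp add: h_def add_nonneg_pos)
  have near: "dist (x + s *\<^sub>R a + t *\<^sub>R b) x < d"
    if "0 \<le> s" "s \<le> h" "0 \<le> t" "t \<le> h" "norm a + norm b = norm u + norm v" for s t a b
  proof -
    have "dist (x + s *\<^sub>R a + t *\<^sub>R b) x \<le> s * norm a + t * norm b"
      using norm_triangle_ineq[of "s *\<^sub>R a" "t *\<^sub>R b"] that by (simp add: dist_norm algebra_simps)
    also have "\<dots> \<le> h * norm a + h * norm b" using that by (intro add_mono mult_right_mono) auto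
    also have "\<dots> = h * (norm u + norm v)" using that(5) by (simp flip: distrib_left)
    also have "\<dots> < h * (2 * (norm u + norm v + 1))"
      by (rule mult_strict_left_mono[OF _ h]) (smt (verit) norm_ge_zero)
    also have "\<dots> = d"
    proof -
      have "norm u + norm v + 1 > 0" by (smt (verit) norm_ge_zero)
      then show ?thesis unfolding h_def by simp
    qed
    finally show ?thesis .
  qed
  have inS: "y \<in> S" if "dist y x < d" for y
    using that d0 by (auto simp: d_def dist_commute)
  obtain s t where st: "0 < s" "s < h" "0 < t" "t < h"
    "f (x + h *\<^sub>R u + h *\<^sub>R v) - f (x + h *\<^sub>R u) - f (x + h *\<^sub>R v) + f x = h\<^sup>2 * f'' (x + s *\<^sub>R u + t *\<^sub>R v) u v"
    using mixed_difference_mean_value[of S f f' u "\<lambda>y. f'' y u" h x v, OF der der2 h] near[of _ _ u v] inS by (metis (no_types, lifting))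
  obtain s' t' where st': "0 < s'" "s' < h" "0 < t'" "t' < h"
    "f (x + h *\<^sub>R v + h *\<^sub>R u) - f (x + h *\<^sub>R v) - f (x + h *\<^sub>R u) + f x = h\<^sup>2 * f'' (x + s' *\<^sub>R v + t' *\<^sub>R u) v u"
    using mixed_difference_mean_value[of S f f' v "\<lambda>y. f'' y v" h x u, OF der der2 h] near[of _ _ v u] inS
    by (metis (no_types, lifting) add.commute)
  have "h\<^sup>2 * f'' (x + s *\<^sub>R u + t *\<^sub>R v) u v = h\<^sup>2 * f'' (x + s' *\<^sub>R v + t' *\<^sub>R u) v u"
    using st(5) st'(5) by (simp add: algebra_simps)
  then have "f'' (x + s *\<^sub>R u + t *\<^sub>R v) u v = f'' (x + s' *\<^sub>R v + t' *\<^sub>R u) v u" using h by simp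
  moreover have "\<bar>f'' (x + s *\<^sub>R u + t *\<^sub>R v) u v - f'' x u v\<bar> < e"
    using near[of s t u v] st by (intro d1) (auto simp: d_def)
  moreover have "\<bar>f'' (x + s' *\<^sub>R v + t' *\<^sub>R u) v u - f'' x v u\<bar> < e"
    using near[of s' t' v u] st' by (intro d2) (auto simp: d_def)
  ultimately have "\<bar>f'' x u v - f'' x v u\<bar> < e + e" by linarith
  then show False unfolding e_def by simp
qed

section \<open>Derivatives along rotations\<close>

text \<open>The sign makes (w . j) i - (w . i) j the generating field; the flux of the divergence of
  an antisymmetric tensor is a sum of derivatives along such fields.\<close>

definition rot :: "'a::euclidean_space \<Rightarrow> 'a \<Rightarrow> real \<Rightarrow> 'a \<Rightarrow> 'a" where
  "rot i j t w = w + (cos t - 1) *\<^sub>R ((w \<bullet> i) *\<^sub>R i + (w \<bullet> j) *\<^sub>R j) + sin t *\<^sub>R ((w \<bullet> j) *\<^sub>R i - (w \<bullet> i) *\<^sub>R j)"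

lemma rot_0 [simp]: "rot i j 0 w = w"
  by (simp add: rot_def)

lemma rot_inner:
  assumes "i \<in> Basis" "j \<in> Basis" "i \<noteq> j"
  shows "rot i j t w \<bullet> i = cos t * (w \<bullet> i) + sin t * (w \<bullet> j)"
    "rot i j t w \<bullet> j = cos t * (w \<bullet> j) - sin t * (w \<bullet> i)"
    "b \<in> Basis \<Longrightarrow> b \<noteq> i \<Longrightarrow> b \<noteq> j \<Longrightarrow> rot i j t w \<bullet> b = w \<bullet> b"
  using assms by (simp_all add: rot_def inner_simps inner_Basis algebra_simps)

lemma orthogonal_transformation_rot:
  assumes "i \<in> Basis" "j \<in> Basis" "i \<noteq> j"
  shows "orthogonal_transformation (rot i j t)"
  unfolding orthogonal_transformation_def
proof (intro conjI allI)
  show "linear (rot i j t)"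
    by (simp add: linear_iff rot_def inner_add_left scaleR_add_right scaleR_add_left scaleR_diff_right mult.left_commute)
  fix v w :: 'a
  have split: "v \<bullet> w = (v \<bullet> i) * (w \<bullet> i) + (v \<bullet> j) * (w \<bullet> j) + (\<Sum>b\<in>Basis - {i, j}. (v \<bullet> b) * (w \<bullet> b))" for v w :: 'a
  proof -
    have "Basis = {i, j} \<union> (Basis - {i, j})" using assms by auto
    then have "v \<bullet> w = (\<Sum>b\<in>{i, j} \<union> (Basis - {i, j}). (v \<bullet> b) * (w \<bullet> b))"
      by (metis euclidean_inner)
    also have "\<dots> = (\<Sum>b\<in>{i, j}. (v \<bullet> b) * (w \<bullet> b)) + (\<Sum>b\<in>Basis - {i, j}. (v \<bullet> b) * (w \<bullet> b))"
      by (intro sum.union_disjoint) auto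
    finally show ?thesis using assms(3) by simp
  qed
  have sc: "(cos t)\<^sup>2 + (sin t)\<^sup>2 = 1" by simp
  have "(cos t * a + sin t * b) * (cos t * c + sin t * d) + (cos t * b - sin t * a) * (cos t * d - sin t * c) =
    ((cos t)\<^sup>2 + (sin t)\<^sup>2) * (a * c + b * d)" for a b c d by algebra
  then have "(cos t * a + sin t * b) * (cos t * c + sin t * d) + (cos t * b - sin t * a) * (cos t * d - sin t * c) =
    a * c + b * d" for a b c d unfolding sc by simp
  then show "rot i j t v \<bullet> rot i j t w = v \<bullet> w"
    unfolding split[of "rot i j t v" "rot i j t w"] split[of v w] using rot_inner[OF assms] by simp
qed

lemma has_vector_derivative_rot:
  assumes "i \<in> Basis" "j \<in> Basis" "i \<noteq> j"
  shows "((\<lambda>t. rot i j t w) has_vector_derivative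
    ((rot i j t w \<bullet> j) *\<^sub>R i - (rot i j t w \<bullet> i) *\<^sub>R j)) (at t)"
proof -
  let ?a = "(w \<bullet> i) *\<^sub>R i + (w \<bullet> j) *\<^sub>R j" and ?b = "(w \<bullet> j) *\<^sub>R i - (w \<bullet> i) *\<^sub>R j"
  have "((\<lambda>t. w + (cos t - 1) *\<^sub>R ?a + sin t *\<^sub>R ?b) has_vector_derivative 0 + (- sin t) *\<^sub>R ?a + cos t *\<^sub>R ?b) (at t)"
    by (intro has_vector_derivative_add has_vector_derivative_const
          has_vector_derivative_scaleR[OF _ has_vector_derivative_const, simplified])
       (auto intro!: derivative_eq_intros)
  moreover have "0 + (- sin t) *\<^sub>R ?a + cos t *\<^sub>R ?b = (rot i j t w \<bullet> j) *\<^sub>R i - (rot i j t w \<bullet> i) *\<^sub>R j"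
    unfolding rot_inner[OF assms] by (simp add: scaleR_add_left scaleR_diff_left scaleR_add_right scaleR_diff_right)
  ultimately show ?thesis by (simp only: rot_def)
qed

text \<open>The integral of f composed with a rotation does not depend on the angle. Differentiating
  at angle 0 under the integral gives the claim, and continuity of \<open>f'\<close> does not
  enter.\<close>

lemma sphere_integral_rotation_derivative:
  fixes f :: "C2 \<Rightarrow> real"
  assumes ij: "i \<in> Basis" "j \<in> Basis" "i \<noteq> j" and R: "R > 0"
    and der: "\<And>w. norm w = R \<Longrightarrow> (f has_derivative f' w) (at w)"
    and bd: "\<And>w v. norm w = R \<Longrightarrow> \<bar>f' w v\<bar> \<le> B * norm v"
  shows "sphere_integral R (\<lambda>w. (w \<bullet> j) * f' w i - (w \<bullet> i) * f' w j) = 0"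
proof -
  let ?X = "\<lambda>w. (w \<bullet> j) *\<^sub>R i - (w \<bullet> i) *\<^sub>R j"
  let ?g = "\<lambda>n w. real (Suc n) * (f (rot i j (1 / real (Suc n)) w) - f w)"
  have nrot: "norm (rot i j t w) = norm w" for t w
    by (rule orthogonal_transformation_norm[OF orthogonal_transformation_rot[OF ij]])
  have cont: "continuous_on (sphere 0 R) f"
  proof (rule continuous_at_imp_continuous_on, rule ballI)
    fix w assume "w \<in> sphere (0::C2) R"
    then have "norm w = R" by simp
    then show "isCont f w" by (rule has_derivative_continuous[OF der])
  qed
  have line: "((\<lambda>t. f (rot i j t w)) has_real_derivative f' (rot i j t w) (?X (rot i j t w))) (at t)"
    if w: "norm w = R" for w t
  proof -
    have "((\<lambda>t. f (rot i j t w)) has_derivative (\<lambda>h. f' (rot i j t w) (h *\<^sub>R ?X (rot i j t w)))) (at t)"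
      by (rule has_derivative_compose[OF has_vector_derivative_rot[OF ij, unfolded has_vector_derivative_def] der])
         (simp add: nrot w)
    moreover have "f' (rot i j t w) (h *\<^sub>R v) = f' (rot i j t w) v * h" for h v
      using linear_scale[OF has_derivative_linear[OF der[of "rot i j t w"]]] nrot w by simp
    ultimately show ?thesis by (simp add: has_field_derivative_def)
  qed
  have Xb: "norm (?X w) \<le> 2 * norm w" for w
  proof -
    have "norm (?X w) \<le> \<bar>w \<bullet> j\<bar> * norm i + \<bar>w \<bullet> i\<bar> * norm j"
      using norm_triangle_ineq4[of "(w \<bullet> j) *\<^sub>R i" "(w \<bullet> i) *\<^sub>R j"] by simp
    also have "\<dots> \<le> 2 * norm w" using Basis_le_norm[OF ij(1), of w] Basis_le_norm[OF ij(2), of w] ij by simp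
    finally show ?thesis .
  qed
  have B0: "B \<ge> 0" using bd[of "R *\<^sub>R i" i] ij R by (auto intro: order_trans[OF abs_ge_zero])
  have gm: "sphere_measurable R (\<lambda>w. f (rot i j t w))"
      and gi: "sphere_integral R (\<lambda>w. f (rot i j t w)) = sphere_integral R f" for t
    using sphere_integral_orthogonal[OF orthogonal_transformation_rot[OF ij] sphere_measurable_continuous[OF cont] R] by blast+
  have fm: "sphere_measurable R f" by (rule sphere_measurable_continuous[OF cont])
  have gm': "sphere_measurable R (?g n)" for n
    by (intro sphere_measurable_cmult sphere_measurable_diff gm fm)
  \<comment> \<open>By the mean value theorem each difference quotient is a derivative at a rotated
    point of the same sphere, which supplies the dominating constant.\<close>
  have gbd: "\<bar>?g n w\<bar> \<le> B * (2 * R)" if w: "norm (w::C2) = R" for n w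
  proof -
    have "\<exists>z>0. z < 1 / real (Suc n) \<and> f (rot i j (1 / real (Suc n)) w) - f (rot i j 0 w) =
       (1 / real (Suc n) - 0) * f' (rot i j z w) (?X (rot i j z w))"
      using line[OF w] by (intro MVT2) auto
    then obtain z where "f (rot i j (1 / real (Suc n)) w) - f w = 1 / real (Suc n) * f' (rot i j z w) (?X (rot i j z w))"
      by auto
    then have "?g n w = f' (rot i j z w) (?X (rot i j z w))" by simp
    also have "\<bar>\<dots>\<bar> \<le> B * norm (?X (rot i j z w))" using w nrot by (intro bd) auto
    also have "\<dots> \<le> B * (2 * R)" using Xb[of "rot i j z w"] w nrot B0 by (intro mult_left_mono) auto
    finally show ?thesis by simp
  qed
  have glim: "(\<lambda>n. ?g n w) \<longlonglongrightarrow> f' w (?X w)" if w: "norm (w::C2) = R" for w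
  proof -
    have "((\<lambda>h. (f (rot i j (0 + h) w) - f (rot i j 0 w)) / h) \<longlongrightarrow> f' w (?X w)) (at 0)"
      using line[OF w, of 0] by (simp add: DERIV_def)
    moreover have "filterlim (\<lambda>n. 1 / real (Suc n)) (at 0) sequentially"
      by (intro filterlim_atI LIMSEQ_Suc[OF lim_1_over_n]) (auto intro!: always_eventually)
    ultimately have "((\<lambda>n. (f (rot i j (0 + 1 / real (Suc n)) w) - f (rot i j 0 w)) / (1 / real (Suc n))) \<longlongrightarrow> f' w (?X w)) sequentially"
      by (rule filterlim_compose)
    then show ?thesis by (simp add: mult.commute)
  qed
  note dom = sphere_integral_dominated_convergence[of R ?g, OF gm' R gbd glim]
  have "sphere_integral R (?g n) = 0" for n
  proof -
    have "sphere_integral R (?g n) = real (Suc n) * (sphere_integral R (\<lambda>w. f (rot i j (1 / real (Suc n)) w) + (-1) * f w))"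
      by (simp add: sphere_integral_cmult)
    also have "sphere_integral R (\<lambda>w. f (rot i j (1 / real (Suc n)) w) + (-1) * f w) =
       sphere_integral R (\<lambda>w. f (rot i j (1 / real (Suc n)) w)) + sphere_integral R (\<lambda>w. (-1) * f w)"
      by (intro sphere_integral_add gm sphere_measurable_cmult fm R)
    also have "\<dots> = 0" by (simp only: gi sphere_integral_cmult)
    finally show ?thesis by simp
  qed
  then have zero: "sphere_integral R (\<lambda>w. f' w (?X w)) = 0" using LIMSEQ_unique[OF dom(2)] by simp
  have eq: "f' w (?X w) = (w \<bullet> j) * f' w i - (w \<bullet> i) * f' w j" if "norm w = R" for w
    using has_derivative_linear[OF der[OF that]] by (simp add: linear_diff linear_scale)
  have "sphere_measurable R (\<lambda>w. f' w (?X w))"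
    by (rule dom(1))
  then have "sphere_integral R (\<lambda>w. (w \<bullet> j) * f' w i - (w \<bullet> i) * f' w j) = sphere_integral R (\<lambda>w. f' w (?X w))"
    using eq by (intro sphere_integral_cong(2) R) auto
  then show ?thesis using zero by simp
qed

text \<open>The derivative is a pointwise limit of continuous difference quotients; the margin
  \<open>norm i\<close> keeps the shifted points in the region where f is differentiable.\<close>

lemma sphere_measurable_directional_derivative:
  fixes f :: "C2 \<Rightarrow> real"
  assumes R: "R > R1 + norm i" "R > 0"
    and der: "\<And>w. norm w > R1 \<Longrightarrow> (f has_derivative f' w) (at w)"
    and bd: "\<And>w. norm w = R \<Longrightarrow> \<bar>f' w i\<bar> \<le> B"
  shows "sphere_measurable R (\<lambda>w. f' w i)"
proof -
  let ?g = "\<lambda>n w. real (Suc n) * (f (w + (1 / real (Suc n)) *\<^sub>R i) - f w)"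
  have big: "norm (w + (1 / real (Suc n)) *\<^sub>R i) > R1" if "norm w = R" for w n
  proof -
    have "norm ((1 / real (Suc n)) *\<^sub>R i) \<le> 1 * norm i"
      unfolding norm_scaleR by (intro mult_right_mono) auto
    moreover have "norm (w + (1 / real (Suc n)) *\<^sub>R i) \<ge> norm w - norm ((1 / real (Suc n)) *\<^sub>R i)"
      using norm_triangle_ineq2[of w "- ((1 / real (Suc n)) *\<^sub>R i)"] by simp
    ultimately show ?thesis using R that by linarith
  qed
  have big0: "norm w > R1" if "norm w = R" for w
    using R that norm_ge_zero[of i] by linarith
  have cont: "isCont f w" if "norm w > R1" for w
    using has_derivative_continuous[OF der[OF that]] .
  have gm: "sphere_measurable R (?g n)" for n
  proof (rule sphere_measurable_continuous, rule continuous_at_imp_continuous_on, rule ballI)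
    fix w :: C2 assume "w \<in> sphere 0 R"
    then have w: "norm w = R" by simp
    have "isCont (\<lambda>w. f (w + (1 / real (Suc n)) *\<^sub>R i)) w"
      by (rule isCont_o2[of w "\<lambda>w. w + (1 / real (Suc n)) *\<^sub>R i" f])
         (use cont[OF big[OF w]] in \<open>auto intro!: continuous_intros\<close>)
    then show "isCont (?g n) w" using cont[OF big0[OF w]] by (intro continuous_intros) auto
  qed
  have lim: "(\<lambda>n. ?g n w) \<longlonglongrightarrow> f' w i" if w: "norm w = R" for w
  proof -
    have "((\<lambda>t. f (w + t *\<^sub>R i)) has_derivative (\<lambda>t. f' w (t *\<^sub>R i))) (at 0)"
      by (rule has_derivative_compose[of "\<lambda>t. w + t *\<^sub>R i" "\<lambda>t. t *\<^sub>R i" 0 UNIV f "f' w"])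
         (use der[OF big0[OF w]] in \<open>auto intro!: derivative_eq_intros\<close>)
    moreover have "(\<lambda>t. f' w (t *\<^sub>R i)) = (*) (f' w i)"
      using linear_scale[OF has_derivative_linear[OF der[OF big0[OF w]]]] by (auto simp: fun_eq_iff)
    ultimately have "((\<lambda>t. f (w + t *\<^sub>R i)) has_real_derivative f' w i) (at 0)"
      by (simp only: has_field_derivative_def)
    then have "((\<lambda>h. (f (w + (0 + h) *\<^sub>R i) - f (w + 0 *\<^sub>R i)) / h) \<longlongrightarrow> f' w i) (at 0)"
      by (simp add: DERIV_def)
    moreover have "filterlim (\<lambda>n. 1 / real (Suc n)) (at 0) sequentially"
      by (intro filterlim_atI LIMSEQ_Suc[OF lim_1_over_n]) (auto intro!: always_eventually)
    ultimately have "((\<lambda>n. (f (w + (0 + 1 / real (Suc n)) *\<^sub>R i) - f (w + 0 *\<^sub>R i)) / (1 / real (Suc n))) \<longlongrightarrow> f' w i) sequentially"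
      by (rule filterlim_compose)
    then show ?thesis by (simp add: mult.commute)
  qed
  have "(\<lambda>w. indicator (sphere 0 R) w * f' w i) \<in> borel_measurable borel"
  proof (rule borel_measurable_LIMSEQ_real)
    show "\<And>n. (\<lambda>w. indicator (sphere 0 R) w * ?g n w) \<in> borel_measurable borel"
      using gm unfolding sphere_measurable_def by blast
    show "\<And>w. w \<in> space borel \<Longrightarrow> (\<lambda>n. indicator (sphere 0 R) w * ?g n w) \<longlonglongrightarrow> indicator (sphere 0 R) w * f' w i"
      using lim by (simp add: indicator_def)
  qed
  then show ?thesis unfolding sphere_measurable_def using bd by (intro conjI exI[of _ B] ballI) simp_all
qed

text \<open>Rotating in the plane of a and b, the square of one coordinate yields the vanishing of
  mixed moments, and the product of the two yields equality of the square moments. The squares sum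
  to R^2, so each moment is a quarter of R^2 times the volume 2 pi^2 R^3.\<close>

lemma sphere_integral_coord_product:
  assumes R: "R > 0" and ab: "a \<in> Basis" "b \<in> Basis"
  shows "sphere_integral R (\<lambda>w. (w \<bullet> a) * (w \<bullet> b)) = (if a = b then pi\<^sup>2 * R ^ 5 / 2 else 0)"
proof -
  let ?I = "\<lambda>a b. sphere_integral R (\<lambda>w::C2. (w \<bullet> a) * (w \<bullet> b))"
  have meas: "sphere_measurable R (\<lambda>w. (w \<bullet> a) * (w \<bullet> b))" for a b :: C2
    by (intro sphere_measurable_continuous continuous_intros)
  have bound: "\<bar>(v \<bullet> a) * (w \<bullet> b) + (w \<bullet> a) * (v \<bullet> b)\<bar> \<le> 2 * R * norm v"
    if "a \<in> Basis" "b \<in> Basis" "norm w = R" for a b v w :: C2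
  proof -
    have "\<bar>v \<bullet> a\<bar> * \<bar>w \<bullet> b\<bar> \<le> norm v * R" "\<bar>w \<bullet> a\<bar> * \<bar>v \<bullet> b\<bar> \<le> R * norm v"
      using that Basis_le_norm by (intro mult_mono; force)+
    then show ?thesis using abs_triangle_ineq[of "(v \<bullet> a) * (w \<bullet> b)" "(w \<bullet> a) * (v \<bullet> b)"]
      mult.commute[of "norm v" R] unfolding abs_mult by linarith
  qed
  have der: "((\<lambda>w. (w \<bullet> a) * (w \<bullet> b)) has_derivative (\<lambda>v. (v \<bullet> a) * (w \<bullet> b) + (w \<bullet> a) * (v \<bullet> b))) (at w)"
    for a b w :: C2
    by (auto intro!: derivative_eq_intros)
  have rot: "sphere_integral R (\<lambda>w. (w \<bullet> d) * ((c \<bullet> a) * (w \<bullet> b) + (w \<bullet> a) * (c \<bullet> b)) -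
      (w \<bullet> c) * ((d \<bullet> a) * (w \<bullet> b) + (w \<bullet> a) * (d \<bullet> b))) = 0"
    if "a \<in> Basis" "b \<in> Basis" "c \<in> Basis" "d \<in> Basis" "c \<noteq> d" for a b c d :: C2
    using sphere_integral_rotation_derivative[OF that(3-5) R der bound[OF that(1,2)]] .
  have off: "?I a b = 0" if "a \<in> Basis" "b \<in> Basis" "a \<noteq> b" for a b
  proof -
    have "sphere_integral R (\<lambda>w. 2 * ((w \<bullet> a) * (w \<bullet> b))) = 0"
      using rot[OF that(1,1) that(1,2,3)] that by (simp add: inner_Basis mult_ac)
    then show ?thesis unfolding sphere_integral_cmult by simp
  qed
  have diag: "?I a a = ?I b b" if "a \<in> Basis" "b \<in> Basis" for a b
  proof (cases "a = b")
    case False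
    have "sphere_integral R (\<lambda>w. (w \<bullet> b) * (w \<bullet> b) + (-1) * ((w \<bullet> a) * (w \<bullet> a))) = 0"
      using rot[OF that that False] that False by (simp add: inner_Basis)
    then have "?I b b + sphere_integral R (\<lambda>w. (-1) * ((w \<bullet> a) * (w \<bullet> a))) = 0"
      by (subst (asm) sphere_integral_add[OF meas sphere_measurable_cmult[OF meas] R])
    then show ?thesis unfolding sphere_integral_cmult by simp
  qed simp
  have "(\<Sum>b\<in>Basis. ?I b b) = sphere_integral R (\<lambda>w::C2. \<Sum>b\<in>Basis. (w \<bullet> b) * (w \<bullet> b))"
    by (rule sphere_integral_sum[OF meas R, symmetric])
  also have "\<dots> = sphere_integral R (\<lambda>w::C2. R\<^sup>2)"
    by (rule sphere_integral_cong(2)[OF _ sphere_measurable_const R])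
       (simp add: euclidean_inner[symmetric] power2_norm_eq_inner[symmetric])
  also have "\<dots> = 2 * pi\<^sup>2 * R ^ 5" by (simp add: sphere_integral_const[OF R] power_numeral_reduce)
  finally have "(\<Sum>b\<in>Basis. ?I b b) = 2 * pi\<^sup>2 * R ^ 5" .
  moreover have "(\<Sum>b\<in>Basis. ?I b b) = (\<Sum>b\<in>(Basis::C2 set). ?I a a)"
    by (rule sum.cong[OF refl diag]) (use ab in auto)
  ultimately show ?thesis using off[OF ab] by auto
qed

text \<open>Only the diagonal second moments survive, so integrating a quadratic form over the
  sphere takes its trace.\<close>

lemma sphere_integral_inner_linear:
  fixes J M :: "C2 \<Rightarrow> C2"
  assumes R: "R > 0" and J: "linear J" and M: "linear M"
  shows "sphere_integral R (\<lambda>w. J w \<bullet> M w) = pi\<^sup>2 * R ^ 5 / 2 * (\<Sum>a\<in>Basis. J a \<bullet> M a)"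
proof -
  have exp: "J w \<bullet> M w = (\<Sum>a\<in>Basis. \<Sum>b\<in>Basis. (J a \<bullet> M b) * ((w \<bullet> a) * (w \<bullet> b)))" for w
  proof -
    have "J w = (\<Sum>a\<in>Basis. (w \<bullet> a) *\<^sub>R J a)" "M w = (\<Sum>a\<in>Basis. (w \<bullet> a) *\<^sub>R M a)"
      by (subst euclidean_representation[of w, symmetric],
          simp only: linear_sum[OF J] linear_sum[OF M] linear_scale[OF J] linear_scale[OF M])+
    then show ?thesis
      by (simp add: inner_sum_left inner_sum_right sum_distrib_left mult_ac) (subst sum.swap, simp add: mult_ac)
  qed
  have meas: "sphere_measurable R (\<lambda>w. c * ((w \<bullet> a) * (w \<bullet> b)))" for a b :: C2 and c
    by (intro sphere_measurable_continuous continuous_intros)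
  have "sphere_integral R (\<lambda>w. J w \<bullet> M w) =
      (\<Sum>a\<in>Basis. \<Sum>b\<in>Basis. (J a \<bullet> M b) * sphere_integral R (\<lambda>w. (w \<bullet> a) * (w \<bullet> b)))"
    unfolding exp
    by (subst sphere_integral_sum[OF sphere_measurable_sum[OF meas] R], subst sphere_integral_sum[OF meas R])
       (simp only: sphere_integral_cmult)
  also have "\<dots> = (\<Sum>a\<in>Basis. (J a \<bullet> M a) * (pi\<^sup>2 * R ^ 5 / 2))"
  proof (rule sum.cong[OF refl])
    fix a :: C2 assume a: "a \<in> Basis"
    have "(\<Sum>b\<in>Basis. (J a \<bullet> M b) * sphere_integral R (\<lambda>w. (w \<bullet> a) * (w \<bullet> b))) =
      (\<Sum>b\<in>Basis. if b = a then (J a \<bullet> M a) * (pi\<^sup>2 * R ^ 5 / 2) else 0)"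
      using a by (intro sum.cong refl) (auto simp: sphere_integral_coord_product[OF R])
    then show "(\<Sum>b\<in>Basis. (J a \<bullet> M b) * sphere_integral R (\<lambda>w. (w \<bullet> a) * (w \<bullet> b))) = (J a \<bullet> M a) * (pi\<^sup>2 * R ^ 5 / 2)"
      using a by simp
  qed
  finally show ?thesis unfolding sum_distrib_right[symmetric] by (simp only: mult.commute)
qed

section \<open>Charts at infinity\<close>

lemma norm_le_sum_Basis_bound:
  fixes x :: "'a::euclidean_space" and f :: "'a \<Rightarrow> 'b::real_normed_vector"
  assumes "linear f" "\<And>b. b \<in> Basis \<Longrightarrow> norm (f b) \<le> B"
  shows "norm (f x) \<le> real DIM('a) * B * norm x"
proof -
  have "f x = (\<Sum>b\<in>Basis. (x \<bullet> b) *\<^sub>R f b)"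
    by (subst euclidean_representation[of x, symmetric])
       (simp only: linear_sum[OF assms(1)] linear_scale[OF assms(1)])
  then have "norm (f x) \<le> (\<Sum>b\<in>Basis. norm ((x \<bullet> b) *\<^sub>R f b))" by (simp only: norm_sum)
  also have "\<dots> \<le> (\<Sum>b\<in>(Basis::'a set). norm x * B)"
    unfolding norm_scaleR using assms(2) by (intro sum_mono mult_mono Basis_le_norm) auto
  finally show ?thesis by (simp add: mult_ac)
qed

lemma decays_frechet_derivative:
  assumes "decays m f"
  shows "\<exists>C. \<forall>\<^sub>F w in at_infinity. (f has_derivative frechet_derivative f (at w)) (at w) \<and>
    (\<forall>v. \<bar>frechet_derivative f (at w) v\<bar> \<le> C * norm w powr (-1-m) * norm v)"
proof -
  from decays_imp_partial[OF assms] obtain C R where "\<And>w. norm w > R \<Longrightarrow> f differentiable (at w)"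
    "\<And>w v. norm w > R \<Longrightarrow> \<bar>frechet_derivative f (at w) v\<bar> \<le> C * norm w powr (-m-1) * norm v" by metis
  moreover have "-m-1 = -1-m" by simp
  ultimately have "\<forall>\<^sub>F w in at_infinity. (f has_derivative frechet_derivative f (at w)) (at w) \<and>
      (\<forall>v. \<bar>frechet_derivative f (at w) v\<bar> \<le> C * norm w powr (-1-m) * norm v)"
    by (intro eventually_mono[OF eventually_norm_gt[of R]]) (simp add: frechet_derivative_works[symmetric])
  then show ?thesis by blast
qed

lemma decays_family_derivative:
  fixes f :: "'i \<Rightarrow> 'a::euclidean_space \<Rightarrow> real"
  assumes "finite I" "\<And>i. i \<in> I \<Longrightarrow> decays m (f i)"
  shows "\<exists>C\<ge>0. \<forall>\<^sub>F w in at_infinity. \<forall>i\<in>I. (f i has_derivative frechet_derivative (f i) (at w)) (at w) \<and>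
    (\<forall>v. \<bar>frechet_derivative (f i) (at w) v\<bar> \<le> C * norm w powr (-1-m) * norm v)"
  using assms
proof (induction I)
  case empty
  show ?case by (intro exI[of _ 0]) simp
next
  case (insert i I)
  obtain C where C: "C \<ge> 0" "\<forall>\<^sub>F w in at_infinity. \<forall>i\<in>I. (f i has_derivative frechet_derivative (f i) (at w)) (at w) \<and>
    (\<forall>v. \<bar>frechet_derivative (f i) (at w) v\<bar> \<le> C * norm w powr (-1-m) * norm v)"
    using insert by auto
  obtain D where D: "\<forall>\<^sub>F w in at_infinity. (f i has_derivative frechet_derivative (f i) (at w)) (at w) \<and>
    (\<forall>v. \<bar>frechet_derivative (f i) (at w) v\<bar> \<le> D * norm w powr (-1-m) * norm v)"
    using decays_frechet_derivative[of m "f i"] insert.prems by auto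
  have mono: "x \<le> max C D * norm w powr (-1-m) * norm v"
    if "x \<le> C * norm w powr (-1-m) * norm v \<or> x \<le> D * norm w powr (-1-m) * norm v" for x and w v :: 'a
  proof -
    have "C * norm w powr (-1-m) * norm v \<le> max C D * norm w powr (-1-m) * norm v"
      "D * norm w powr (-1-m) * norm v \<le> max C D * norm w powr (-1-m) * norm v"
      by (intro mult_right_mono; simp)+
    then show ?thesis using that by linarith
  qed
  have "\<forall>\<^sub>F w in at_infinity. \<forall>i\<in>insert i I. (f i has_derivative frechet_derivative (f i) (at w)) (at w) \<and>
    (\<forall>v. \<bar>frechet_derivative (f i) (at w) v\<bar> \<le> max C D * norm w powr (-1-m) * norm v)"
    using C(2) D by eventually_elim (simp add: mono)
  then show ?case using C(1) by (intro exI[of _ "max C D"]) simp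
qed

text \<open>\<open>G\<close> is the transition map from the chart to coordinates in which the metric
  is Euclidean plus \<open>k\<close>, and \<open>H\<close> is the pull-back of that metric.
  Derivatives are explicit parameters, so that only two of them, with symmetry of the second,
  enter.\<close>

locale asymptotic_chart =
  fixes G :: "'a::euclidean_space \<Rightarrow> 'a" and DG :: "'a \<Rightarrow> 'a \<Rightarrow> 'a" and D2G :: "'a \<Rightarrow> 'a \<Rightarrow> 'a \<Rightarrow> 'a"
    and k H :: "'a \<Rightarrow> 'a \<Rightarrow> 'a \<Rightarrow> real" and \<tau> :: real
  assumes dim: "2 \<le> DIM('a)" and \<tau>: "1 < \<tau>"
    and DG: "\<forall>\<^sub>F w in at_infinity. (G has_derivative DG w) (at w)"
    and D2G: "\<forall>\<^sub>F w in at_infinity. \<forall>u. ((\<lambda>w. DG w u) has_derivative D2G w u) (at w)"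
    and D2G_sym: "\<forall>\<^sub>F w in at_infinity. \<forall>u v. D2G w u v = D2G w v u"
    and G_lim: "filterlim G at_infinity at_infinity"
    and k_decays: "\<And>a b. a \<in> Basis \<Longrightarrow> b \<in> Basis \<Longrightarrow> decays 2 (\<lambda>y. k y a b)"
    and k_sym: "\<And>y a b. k y a b = k y b a"
    and H_eq: "\<forall>\<^sub>F w in at_infinity. \<forall>u v. H w u v = DG w u \<bullet> DG w v +
      (\<Sum>a\<in>Basis. \<Sum>b\<in>Basis. (DG w u \<bullet> a) * (DG w v \<bullet> b) * k (G w) a b)"
    and H_decays: "\<And>i j. i \<in> Basis \<Longrightarrow> j \<in> Basis \<Longrightarrow> decays \<tau> (\<lambda>w. H w i j - i \<bullet> j)"
begin

definition form :: "'a \<Rightarrow> 'a \<Rightarrow> 'a \<Rightarrow> real" where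
  "form w x y = x \<bullet> y + (\<Sum>a\<in>Basis. \<Sum>b\<in>Basis. (x \<bullet> a) * (y \<bullet> b) * k (G w) a b)"

lemma form_sym: "form w x y = form w y x"
proof -
  have "(\<Sum>a\<in>Basis. \<Sum>b\<in>Basis. (x \<bullet> a) * (y \<bullet> b) * k (G w) a b) =
     (\<Sum>b\<in>Basis. \<Sum>a\<in>Basis. (x \<bullet> a) * (y \<bullet> b) * k (G w) a b)" by (rule sum.swap)
  then show ?thesis by (simp add: form_def inner_commute k_sym[of "G w"] mult_ac)
qed

lemma form_linear: "linear (\<lambda>x. form w x y)" "linear (form w x)"
  by (auto simp: linear_iff form_def inner_simps distrib_left distrib_right sum.distrib sum_distrib_left mult_ac)

definition perturb :: "'a \<Rightarrow> real" where
  "perturb w = (\<Sum>a\<in>Basis. \<Sum>b\<in>Basis. \<bar>k (G w) a b\<bar>)"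

lemma form_near: "\<bar>form w x y - x \<bullet> y\<bar> \<le> perturb w * norm x * norm y"
proof -
  have "\<bar>form w x y - x \<bullet> y\<bar> \<le> (\<Sum>a\<in>Basis. \<Sum>b\<in>Basis. \<bar>(x \<bullet> a) * (y \<bullet> b) * k (G w) a b\<bar>)"
    unfolding form_def by simp (intro order_trans[OF sum_abs] sum_mono sum_abs)
  also have "\<dots> \<le> (\<Sum>a\<in>Basis. \<Sum>b\<in>Basis. norm x * norm y * \<bar>k (G w) a b\<bar>)"
    unfolding abs_mult by (intro sum_mono mult_right_mono mult_mono Basis_le_norm) auto
  also have "\<dots> = perturb w * norm x * norm y"
    by (simp add: perturb_def sum_distrib_right sum_distrib_left mult_ac)
  finally show ?thesis .
qed

lemma perturb_lim: "(perturb \<longlongrightarrow> 0) at_infinity"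
proof -
  have "((\<lambda>w. k (G w) a b) \<longlongrightarrow> 0) at_infinity" if "a \<in> Basis" "b \<in> Basis" for a b
    using filterlim_compose[OF decays_tendsto[OF k_decays[OF that]] G_lim] by simp
  then show ?thesis unfolding perturb_def
    by (intro tendsto_null_sum tendsto_rabs_zero)
qed

lemma DG_linear: "\<forall>\<^sub>F w in at_infinity. linear (DG w)"
  using DG by eventually_elim (rule has_derivative_linear)

text \<open>Near infinity \<open>H\<close> and \<open>form\<close> both differ from the Euclidean
  square length by a relative error of at most 1/2, and \<open>H\<close> is the pull-back of
  \<open>form\<close> by \<open>DG\<close>. Hence squared lengths change by a factor of at most 3,
  and the constant 2 is safe.\<close>

lemma DG_bounds: "\<forall>\<^sub>F w in at_infinity. \<forall>v. norm (DG w v) \<le> 2 * norm v \<and> norm v \<le> 2 * norm (DG w v)"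
proof -
  define \<eta> where "\<eta> w = (\<Sum>i\<in>Basis. \<Sum>j\<in>Basis. \<bar>H w i j - i \<bullet> j\<bar>)" for w
  have "(\<eta> \<longlongrightarrow> 0) at_infinity" unfolding \<eta>_def
    by (intro tendsto_null_sum tendsto_rabs_zero decays_tendsto[OF H_decays]) (use \<tau> in auto)
  then have "\<forall>\<^sub>F w in at_infinity. \<eta> w < 1/2" by (rule order_tendstoD) simp
  moreover have "\<forall>\<^sub>F w in at_infinity. perturb w < 1/2" by (rule order_tendstoD[OF perturb_lim]) simp
  ultimately show ?thesis using H_eq DG_linear
  proof (eventually_elim, intro allI)
    fix w v
    assume \<eta>: "\<eta> w < 1/2" and pt: "perturb w < 1/2" and lin: "linear (DG w)"
      and H: "\<forall>u v. H w u v = DG w u \<bullet> DG w v + (\<Sum>a\<in>Basis. \<Sum>b\<in>Basis. (DG w u \<bullet> a) * (DG w v \<bullet> b) * k (G w) a b)"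
    have Hf: "H w u v = form w (DG w u) (DG w v)" for u v using H by (simp add: form_def)
    have exp: "f v = (\<Sum>b\<in>Basis. (v \<bullet> b) * f b)" if "linear f" for f :: "'a \<Rightarrow> real"
      by (subst euclidean_representation[of v, symmetric])
         (simp only: linear_sum[OF that] linear_scale[OF that] real_scaleR_def)
    have "H w v v - v \<bullet> v = (\<Sum>i\<in>Basis. \<Sum>j\<in>Basis. (v \<bullet> i) * (v \<bullet> j) * (H w i j - i \<bullet> j))"
    proof -
      have l1: "linear (\<lambda>u. H w u v - u \<bullet> v)" for v
        unfolding Hf by (intro linear_compose_sub linear_compose[OF lin form_linear(1), unfolded o_def])
          (auto simp: linear_iff inner_simps)
      have l2: "linear (\<lambda>v. H w u v - u \<bullet> v)" for u
        unfolding Hf by (intro linear_compose_sub linear_compose[OF lin form_linear(2), unfolded o_def])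
          (auto simp: linear_iff inner_simps)
      show ?thesis
        by (subst exp[OF l1[of v]], subst exp[OF l2]) (simp add: sum_distrib_left mult_ac)
    qed
    then have "\<bar>H w v v - v \<bullet> v\<bar> \<le> (\<Sum>i\<in>Basis. \<Sum>j\<in>Basis. \<bar>(v \<bullet> i) * (v \<bullet> j) * (H w i j - i \<bullet> j)\<bar>)"
      by simp (intro order_trans[OF sum_abs] sum_mono sum_abs)
    also have "\<dots> \<le> (\<Sum>i\<in>Basis. \<Sum>j\<in>Basis. norm v * norm v * \<bar>H w i j - i \<bullet> j\<bar>)"
      unfolding abs_mult by (intro sum_mono mult_right_mono mult_mono Basis_le_norm) auto
    also have "\<dots> = \<eta> w * (norm v)\<^sup>2"
      by (simp add: \<eta>_def sum_distrib_right sum_distrib_left mult_ac power2_eq_square)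
    also have "\<dots> \<le> 1/2 * (norm v)\<^sup>2" using \<eta> by (intro mult_right_mono) auto
    finally have 1: "\<bar>H w v v - (norm v)\<^sup>2\<bar> \<le> 1/2 * (norm v)\<^sup>2" by (simp add: power2_norm_eq_inner)
    have "\<bar>H w v v - DG w v \<bullet> DG w v\<bar> \<le> perturb w * norm (DG w v) * norm (DG w v)"
      unfolding Hf by (rule form_near)
    also have "\<dots> = perturb w * (norm (DG w v))\<^sup>2" by (simp add: power2_eq_square)
    also have "\<dots> \<le> 1/2 * (norm (DG w v))\<^sup>2" using pt by (intro mult_right_mono) auto
    finally have 2: "\<bar>H w v v - (norm (DG w v))\<^sup>2\<bar> \<le> 1/2 * (norm (DG w v))\<^sup>2" by (simp add: power2_norm_eq_inner)
    have sq: "0 \<le> (norm v)\<^sup>2" "0 \<le> (norm (DG w v))\<^sup>2" by simp_all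
    have "(norm (DG w v))\<^sup>2 \<le> (2 * norm v)\<^sup>2" "(norm v)\<^sup>2 \<le> (2 * norm (DG w v))\<^sup>2"
      unfolding power_mult_distrib using 1 2 sq by (auto simp: abs_if split: if_splits)
    then show "norm (DG w v) \<le> 2 * norm v \<and> norm v \<le> 2 * norm (DG w v)"
      by (auto intro: power2_le_imp_le)
  qed
qed

lemma DG_preimage: "\<forall>\<^sub>F w in at_infinity. \<forall>y. \<exists>v. DG w v = y \<and> norm v \<le> 2 * norm y"
  using DG_bounds DG_linear
proof (eventually_elim, intro allI)
  fix w y assume b: "\<forall>v. norm (DG w v) \<le> 2 * norm v \<and> norm v \<le> 2 * norm (DG w v)" and lin: "linear (DG w)"
  have "inj (DG w)"
    using b by (auto simp: linear_injective_0[OF lin]) (metis mult_zero_right norm_le_zero_iff norm_zero)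
  then have "surj (DG w)" using linear_injective_imp_surjective[OF lin] by simp
  then obtain v where "DG w v = y" by (metis surjD)
  then show "\<exists>v. DG w v = y \<and> norm v \<le> 2 * norm y" using b by blast
qed

text \<open>Properness of G improves to linear growth, which is what transports decay in the
  variable G w to decay in w.\<close>

lemma G_lower: obtains c where "c > 0" "\<forall>\<^sub>F w in at_infinity. norm (G w) \<ge> c * norm w"
  using proper_expanding_lower_bound[OF _ DG DG_preimage G_lim] by (metis zero_less_numeral)

lemma decays_pullback:
  assumes "decays m f" "m \<ge> 0" shows "decays m (\<lambda>w. f (G w))"
proof -
  obtain c where c: "c > 0" "\<forall>\<^sub>F w in at_infinity. norm (G w) \<ge> c * norm w" by (rule G_lower)
  have "\<forall>\<^sub>F w in at_infinity. \<forall>v. norm (DG w v) \<le> 2 * norm v"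
    using DG_bounds by eventually_elim auto
  then show ?thesis by (rule decays_compose[OF assms c DG])
qed

text \<open>The rate shared by \<open>H\<close> minus the Euclidean metric and by the pulled-back
  \<open>k\<close>; the Koszul identity passes it on to \<open>DG\<close>.\<close>

definition \<sigma> :: real where "\<sigma> = min \<tau> 2"

lemma \<sigma>: "1 < \<sigma>" "\<sigma> \<le> \<tau>" "\<sigma> \<le> 2" using \<tau> by (auto simp: \<sigma>_def)

text \<open>The Koszul identity expresses the second derivatives of \<open>G\<close> through the first derivatives of
  the two metrics, as in the transformation law of the Christoffel symbols.\<close>

lemma D2G_bound:
  obtains C where "\<forall>\<^sub>F w in at_infinity. \<forall>i\<in>Basis. \<forall>l\<in>Basis. norm (D2G w i l) \<le> C * norm w powr (-1-\<sigma>)"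
proof -
  define dk where "dk a b w = frechet_derivative (\<lambda>w. k (G w) a b) (at w)" for a b w
  define dH where "dH i j w = frechet_derivative (\<lambda>w. H w i j - i \<bullet> j) (at w)" for i j w
  have "decays \<sigma> (case x of (a, b) \<Rightarrow> \<lambda>w. k (G w) a b)" if "x \<in> Basis \<times> Basis" for x
    using that decays_mono[OF decays_pullback[OF k_decays]] \<sigma> by auto
  from decays_family_derivative[of "Basis \<times> Basis" \<sigma> "\<lambda>x. case x of (a, b) \<Rightarrow> \<lambda>w. k (G w) a b", OF _ this]
  obtain Ck where Ck: "Ck \<ge> 0" "\<forall>\<^sub>F w in at_infinity. \<forall>a\<in>Basis. \<forall>b\<in>Basis. ((\<lambda>w. k (G w) a b) has_derivative dk a b w) (at w) \<and>
      (\<forall>v. \<bar>dk a b w v\<bar> \<le> Ck * norm w powr (-1-\<sigma>) * norm v)"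
    unfolding dk_def by auto
  have "decays \<sigma> (case x of (i, j) \<Rightarrow> \<lambda>w. H w i j - i \<bullet> j)" if "x \<in> Basis \<times> Basis" for x
    using that decays_mono[OF H_decays] \<sigma> by auto
  from decays_family_derivative[of "Basis \<times> Basis" \<sigma> "\<lambda>x. case x of (i, j) \<Rightarrow> \<lambda>w. H w i j - i \<bullet> j", OF _ this]
  obtain CH where CH: "CH \<ge> 0" "\<forall>\<^sub>F w in at_infinity. \<forall>i\<in>Basis. \<forall>j\<in>Basis. ((\<lambda>w. H w i j - i \<bullet> j) has_derivative dH i j w) (at w) \<and>
      (\<forall>v. \<bar>dH i j w v\<bar> \<le> CH * norm w powr (-1-\<sigma>) * norm v)"
    unfolding dH_def by auto
  \<comment> \<open>The bound for the derivative of \<open>H\<close> plus one term for each pair of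
    basis vectors, where the factor 4 comes from two entries of \<open>DG\<close> of size at most
    2.\<close>
  define C1 where "C1 = CH + real DIM('a) * (real DIM('a) * (4 * Ck))"
  have C1: "0 \<le> C1" using Ck(1) CH(1) by (simp add: C1_def)
  have "\<forall>\<^sub>F w in at_infinity. perturb w < 1/2" by (rule order_tendstoD[OF perturb_lim]) simp
  with Ck(2) CH(2) have "\<forall>\<^sub>F w in at_infinity. \<forall>i\<in>Basis. \<forall>l\<in>Basis. norm (D2G w i l) \<le> (6 * real DIM('a) * C1) * norm w powr (-1-\<sigma>)"
    using D2G D2G_sym DG_linear DG_bounds DG_preimage eventually_at_infinity_open[OF H_eq]
  proof (eventually_elim, intro ballI)
    fix w i l :: 'a
    assume dk: "\<forall>a\<in>Basis. \<forall>b\<in>Basis. ((\<lambda>w. k (G w) a b) has_derivative dk a b w) (at w) \<and>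
      (\<forall>v. \<bar>dk a b w v\<bar> \<le> Ck * norm w powr (-1-\<sigma>) * norm v)"
    and dH: "\<forall>i\<in>Basis. \<forall>j\<in>Basis. ((\<lambda>w. H w i j - i \<bullet> j) has_derivative dH i j w) (at w) \<and>
      (\<forall>v. \<bar>dH i j w v\<bar> \<le> CH * norm w powr (-1-\<sigma>) * norm v)"
    and pt: "perturb w < 1/2" and D2: "\<forall>u. ((\<lambda>w. DG w u) has_derivative D2G w u) (at w)"
    and sym: "\<forall>u v. D2G w u v = D2G w v u"
    and lin: "linear (DG w)"
    and bds: "\<forall>v. norm (DG w v) \<le> 2 * norm v \<and> norm v \<le> 2 * norm (DG w v)"
    and pre: "\<forall>y. \<exists>v. DG w v = y \<and> norm v \<le> 2 * norm y"
    and H: "\<forall>\<^sub>F w in nhds w. \<forall>u v. H w u v = DG w u \<bullet> DG w v +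
      (\<Sum>a\<in>Basis. \<Sum>b\<in>Basis. (DG w u \<bullet> a) * (DG w v \<bullet> b) * k (G w) a b)"
    and il: "i \<in> Basis" "l \<in> Basis"
    let ?r = "norm w powr (-1-\<sigma>)"
    \<comment> \<open>The part of the derivative of \<open>H i j\<close> along l in which
      \<open>DG\<close> is differentiated; the remainder differentiates \<open>k\<close> and is
      bounded directly.\<close>
    define S where "S i j l = form w (D2G w i l) (DG w j) + form w (DG w i) (D2G w j l)" for i j l
    have S_bound: "\<bar>S i j l\<bar> \<le> C1 * ?r" if "i \<in> Basis" "j \<in> Basis" "l \<in> Basis" for i j l
    proof -
      have "((\<lambda>w. DG w i \<bullet> DG w j + (\<Sum>a\<in>Basis. \<Sum>b\<in>Basis. (DG w i \<bullet> a) * (DG w j \<bullet> b) * k (G w) a b) - i \<bullet> j)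
        has_derivative (\<lambda>v. (DG w i \<bullet> D2G w j v + D2G w i v \<bullet> DG w j) +
          (\<Sum>a\<in>Basis. \<Sum>b\<in>Basis. ((DG w i \<bullet> a) * (DG w j \<bullet> b)) * dk a b w v +
            ((DG w i \<bullet> a) * (D2G w j v \<bullet> b) + (D2G w i v \<bullet> a) * (DG w j \<bullet> b)) * k (G w) a b) - 0)) (at w)"
        using D2 dk
        by (intro has_derivative_diff has_derivative_add has_derivative_const has_derivative_inner has_derivative_sum
            has_derivative_mult has_derivative_inner_left) auto
      then have "((\<lambda>w. H w i j - i \<bullet> j) has_derivative (\<lambda>v. (DG w i \<bullet> D2G w j v + D2G w i v \<bullet> DG w j) +
          (\<Sum>a\<in>Basis. \<Sum>b\<in>Basis. ((DG w i \<bullet> a) * (DG w j \<bullet> b)) * dk a b w v +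
            ((DG w i \<bullet> a) * (D2G w j v \<bullet> b) + (D2G w i v \<bullet> a) * (DG w j \<bullet> b)) * k (G w) a b) - 0)) (at w)"
        by (rule has_derivative_cong_nhds) (use H in \<open>auto elim: eventually_mono\<close>)
      then have "dH i j w = (\<lambda>v. (DG w i \<bullet> D2G w j v + D2G w i v \<bullet> DG w j) +
          (\<Sum>a\<in>Basis. \<Sum>b\<in>Basis. ((DG w i \<bullet> a) * (DG w j \<bullet> b)) * dk a b w v +
            ((DG w i \<bullet> a) * (D2G w j v \<bullet> b) + (D2G w i v \<bullet> a) * (DG w j \<bullet> b)) * k (G w) a b) - 0)"
        using dH that has_derivative_unique by blast
      then have "dH i j w l = S i j l + (\<Sum>a\<in>Basis. \<Sum>b\<in>Basis. ((DG w i \<bullet> a) * (DG w j \<bullet> b)) * dk a b w l)"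
        unfolding S_def form_def by (simp add: sum.distrib algebra_simps)
      then have "\<bar>S i j l\<bar> \<le> \<bar>dH i j w l\<bar> + (\<Sum>a\<in>Basis. \<Sum>b\<in>Basis. \<bar>((DG w i \<bullet> a) * (DG w j \<bullet> b)) * dk a b w l\<bar>)"
        using order_trans[OF sum_abs sum_mono[OF sum_abs], of "\<lambda>a b. ((DG w i \<bullet> a) * (DG w j \<bullet> b)) * dk a b w l" "\<lambda>_. Basis" Basis]
        by linarith
      also have "\<dots> \<le> CH * ?r + (\<Sum>a\<in>(Basis::'a set). \<Sum>b\<in>(Basis::'a set). 4 * Ck * ?r)"
      proof (intro add_mono sum_mono)
        show "\<bar>dH i j w l\<bar> \<le> CH * ?r" using dH that by (metis mult.right_neutral norm_Basis)
        fix a b :: 'a assume ab: "a \<in> Basis" "b \<in> Basis"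
        have "\<bar>DG w i \<bullet> a\<bar> \<le> 2" "\<bar>DG w j \<bullet> b\<bar> \<le> 2"
          using bds that ab Basis_le_norm[of a "DG w i"] Basis_le_norm[of b "DG w j"]
          by (metis mult.right_neutral norm_Basis order_trans)+
        moreover have "\<bar>dk a b w l\<bar> \<le> Ck * ?r" using dk ab that by (metis mult.right_neutral norm_Basis)
        ultimately have "\<bar>DG w i \<bullet> a\<bar> * \<bar>DG w j \<bullet> b\<bar> * \<bar>dk a b w l\<bar> \<le> 2 * 2 * (Ck * ?r)"
          by (intro mult_mono) auto
        then show "\<bar>((DG w i \<bullet> a) * (DG w j \<bullet> b)) * dk a b w l\<bar> \<le> 4 * Ck * ?r"
          by (simp add: abs_mult)
      qed
      also have "\<dots> = C1 * ?r" by (simp add: C1_def distrib_right)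
      finally show ?thesis .
    qed
    \<comment> \<open>By symmetry of \<open>D2G\<close> and of \<open>form\<close>, the other two
      inner products cancel in the cyclic combination.\<close>
    have koszul: "2 * form w (D2G w i l) (DG w j) = S i j l + S l j i - S i l j" for i j l
      unfolding S_def using sym form_sym by (smt (verit))
    have fb: "\<bar>form w (D2G w i l) (DG w j)\<bar> \<le> 3 / 2 * (C1 * ?r)" if "j \<in> Basis" for j
      using koszul[of i l j] S_bound[OF il(1) that il(2)] S_bound[OF il(2) that il(1)] S_bound[OF il(1) il(2) that]
      by linarith
    let ?y = "D2G w i l"
    \<comment> \<open>Testing \<open>D2G\<close> against itself, written as \<open>DG w v\<close>,
      bounds its squared norm by a multiple of its norm; one factor of the norm is then
      cancelled.\<close>
    obtain v where v: "DG w v = ?y" "norm v \<le> 2 * norm ?y" using pre by blast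
    have "norm (form w ?y (DG w v)) \<le> real DIM('a) * (3 / 2 * (C1 * ?r)) * norm v"
      by (rule norm_le_sum_Basis_bound[OF linear_compose[OF lin form_linear(2), unfolded o_def]]) (use fb in auto)
    also have "\<dots> \<le> real DIM('a) * (3 / 2 * (C1 * ?r)) * (2 * norm ?y)"
      using v(2) C1 by (intro mult_left_mono) auto
    finally have up: "form w ?y ?y \<le> (3 * real DIM('a) * C1 * ?r) * norm ?y" unfolding v(1) by (simp add: mult_ac)
    have "perturb w * norm ?y * norm ?y \<le> 1/2 * norm ?y * norm ?y"
      using pt by (intro mult_right_mono) auto
    then have "1/2 * norm ?y * norm ?y \<le> form w ?y ?y"
      using form_near[of w ?y ?y] by (simp add: power2_norm_eq_inner[symmetric] power2_eq_square)
    with up have "norm ?y * norm ?y \<le> (6 * real DIM('a) * C1 * ?r) * norm ?y" by linarith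
    then show "norm ?y \<le> (6 * real DIM('a) * C1) * ?r"
      using C1 by (cases "norm ?y = 0") (auto simp: mult_le_cancel_right)
  qed
  then show thesis by (rule that)
qed

end

section \<open>The limiting isometry of a chart\<close>

context asymptotic_chart
begin

lemma bilinear_eq_on_Basis:
  fixes f :: "'a \<Rightarrow> 'a"
  assumes lin: "linear f" and eq: "\<And>i j. i \<in> Basis \<Longrightarrow> j \<in> Basis \<Longrightarrow> f i \<bullet> f j = i \<bullet> j"
  shows "f v \<bullet> f w = v \<bullet> w"
proof -
  have exp: "f v = (\<Sum>i\<in>Basis. (v \<bullet> i) *\<^sub>R f i)" for v
    by (subst euclidean_representation[of v, symmetric])
       (simp only: linear_sum[OF lin] linear_scale[OF lin])
  have "f v \<bullet> f w = (\<Sum>i\<in>Basis. (v \<bullet> i) * (f i \<bullet> f w))"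
    by (subst exp[of v]) (simp add: inner_sum_left)
  also have "\<dots> = (\<Sum>i\<in>Basis. (v \<bullet> i) * (\<Sum>j\<in>Basis. (w \<bullet> j) * (f i \<bullet> f j)))"
    by (subst exp[of w]) (simp add: inner_sum_right)
  also have "\<dots> = (\<Sum>i\<in>Basis. (v \<bullet> i) * (\<Sum>j\<in>Basis. if j = i then w \<bullet> i else 0))"
    by (intro sum.cong refl arg_cong2[of _ _ _ _ "(*)"]) (auto simp: eq inner_Basis)
  also have "\<dots> = v \<bullet> w" by (simp add: euclidean_inner[of v w])
  finally show ?thesis .
qed

lemma D2G_linear: "\<forall>\<^sub>F w in at_infinity. \<forall>u. linear (D2G w u)"
  using D2G by eventually_elim (blast intro: has_derivative_linear)

text \<open>The entries of \<open>DG\<close> have derivatives O(|w|^(-1-\<sigma>)), so they converge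
  at infinity at rate \<sigma>.\<close>

lemma DG_limit:
  assumes ia: "i \<in> Basis" "a \<in> Basis"
  shows "\<exists>L. decays \<sigma> (\<lambda>w. DG w i \<bullet> a - L)"
proof -
  obtain C where C: "\<forall>\<^sub>F w in at_infinity. \<forall>i\<in>Basis. \<forall>l\<in>Basis. norm (D2G w i l) \<le> C * norm w powr (-1-\<sigma>)"
    by (rule D2G_bound)
  have der: "\<forall>\<^sub>F w in at_infinity. ((\<lambda>w. DG w i \<bullet> a) has_derivative (\<lambda>l. D2G w i l \<bullet> a)) (at w)"
    using D2G by eventually_elim (auto intro!: derivative_eq_intros)
  have bd: "\<forall>\<^sub>F w in at_infinity. \<forall>l. \<bar>D2G w i l \<bullet> a\<bar> \<le> (real DIM('a) * C) * norm w powr (-1-\<sigma>) * norm l"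
    using C D2G_linear
  proof (eventually_elim, intro allI)
    fix w l assume *: "\<forall>i\<in>Basis. \<forall>l\<in>Basis. norm (D2G w i l) \<le> C * norm w powr (-1-\<sigma>)" "\<forall>u. linear (D2G w u)"
    have "\<bar>D2G w i l \<bullet> a\<bar> \<le> norm (D2G w i l)" using Basis_le_norm[OF ia(2)] .
    also have "\<dots> \<le> real DIM('a) * (C * norm w powr (-1-\<sigma>)) * norm l"
      using * ia by (intro norm_le_sum_Basis_bound) auto
    finally show "\<bar>D2G w i l \<bullet> a\<bar> \<le> (real DIM('a) * C) * norm w powr (-1-\<sigma>) * norm l" by (simp add: mult.assoc)
  qed
  obtain L K where L: "\<forall>\<^sub>F w in at_infinity. \<bar>DG w i \<bullet> a - L\<bar> \<le> K * norm w powr (-\<sigma>)"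
    using limit_at_infinity_of_derivative_bound[OF dim _ der bd] \<sigma> by auto
  have "decays \<sigma> (\<lambda>w. DG w i \<bullet> a - L)"
  proof (rule decaysI[OF _ L])
    show "\<forall>\<^sub>F w in at_infinity. ((\<lambda>w. DG w i \<bullet> a - L) has_derivative (\<lambda>l. D2G w i l \<bullet> a)) (at w)"
      using der by eventually_elim (rule has_derivative_eq_rhs[OF has_derivative_diff[OF _ has_derivative_const]], auto)
    show "\<forall>\<^sub>F w in at_infinity. \<forall>l. \<bar>D2G w i l \<bullet> a\<bar> \<le> (real DIM('a) * C) * norm w powr (-\<sigma>-1) * norm l"
      using bd by (simp add: minus_diff_commute)
  qed
  then show ?thesis ..
qed

text \<open>The limit A of \<open>DG\<close> is orthogonal because \<open>H\<close> and the Gram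
  matrix of \<open>DG\<close> have the same limit, the identity. As \<sigma> > 1, the deviation of
  \<open>DG\<close> from A is integrable along rays, so G - A stays bounded.\<close>

lemma asymptotic_isometry:
  obtains A where "orthogonal_transformation A"
    "\<And>i a. i \<in> Basis \<Longrightarrow> a \<in> Basis \<Longrightarrow> decays \<sigma> (\<lambda>w. DG w i \<bullet> a - A i \<bullet> a)"
    "\<And>a. a \<in> Basis \<Longrightarrow> decays 0 (\<lambda>w. G w \<bullet> a - A w \<bullet> a)"
proof -
  \<comment> \<open>The matrix entries of the future isometry, selected from the limits whose
    existence was shown.\<close>
  define L where "L i a = (SOME L. decays \<sigma> (\<lambda>w. DG w i \<bullet> a - L))" for i a
  have L: "decays \<sigma> (\<lambda>w. DG w i \<bullet> a - L i a)" if "i \<in> Basis" "a \<in> Basis" for i a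
    unfolding L_def by (rule someI_ex[OF DG_limit[OF that]])
  define B where "B i = (\<Sum>a\<in>Basis. L i a *\<^sub>R a)" for i
  define A where "A v = (\<Sum>i\<in>Basis. (v \<bullet> i) *\<^sub>R B i)" for v
  have linA: "linear A"
    by (rule linearI) (simp_all add: A_def inner_simps scaleR_add_left sum.distrib scaleR_sum_right)
  have A_Basis: "A i = B i" if "i \<in> Basis" for i
  proof -
    have "A i = (\<Sum>j\<in>Basis. if j = i then B i else 0)"
      unfolding A_def using that by (intro sum.cong refl) (auto simp: inner_Basis)
    then show ?thesis using that by simp
  qed
  have A_inner: "A i \<bullet> a = L i a" if "i \<in> Basis" "a \<in> Basis" for i a
    unfolding A_Basis[OF that(1)] B_def using that(2) by simp
  have dA: "decays \<sigma> (\<lambda>w. DG w i \<bullet> a - A i \<bullet> a)" if "i \<in> Basis" "a \<in> Basis" for i a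
    using L[OF that] A_inner[OF that] by simp
  have lim: "((\<lambda>w. DG w i \<bullet> a) \<longlongrightarrow> A i \<bullet> a) at_infinity" if "i \<in> Basis" "a \<in> Basis" for i a
    using decays_tendsto[OF dA[OF that]] \<sigma> by (intro LIM_zero_cancel[of _ "A i \<bullet> a"]) auto
  have orth: "A i \<bullet> A j = i \<bullet> j" if ij: "i \<in> Basis" "j \<in> Basis" for i j
  proof -
    have "((\<lambda>w. \<Sum>a\<in>Basis. (DG w i \<bullet> a) * (DG w j \<bullet> a)) \<longlongrightarrow> (\<Sum>a\<in>Basis. (A i \<bullet> a) * (A j \<bullet> a))) at_infinity"
      by (intro tendsto_sum tendsto_mult lim ij)
    then have 1: "((\<lambda>w. DG w i \<bullet> DG w j) \<longlongrightarrow> A i \<bullet> A j) at_infinity"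
      by (simp only: euclidean_inner[symmetric])
    have "\<forall>\<^sub>F w in at_infinity. norm (H w i j - DG w i \<bullet> DG w j) \<le> perturb w * 2 * 2"
      using H_eq DG_bounds
    proof eventually_elim
      case (elim w)
      have p: "0 \<le> perturb w" by (auto simp: perturb_def intro: sum_nonneg)
      have "norm (DG w i) \<le> 2" "norm (DG w j) \<le> 2" using elim(2) ij by (metis mult.right_neutral norm_Basis)+
      then have "perturb w * norm (DG w i) * norm (DG w j) \<le> perturb w * 2 * 2"
        using p by (intro mult_mono mult_nonneg_nonneg) auto
      moreover have "H w i j - DG w i \<bullet> DG w j = form w (DG w i) (DG w j) - DG w i \<bullet> DG w j"
        using elim(1) by (simp add: form_def)
      ultimately show ?case using form_near[of w "DG w i" "DG w j"] by simp
    qed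
    moreover have "((\<lambda>w. perturb w * 2 * 2) \<longlongrightarrow> 0 * 2 * 2) at_infinity" by (intro tendsto_intros perturb_lim)
    ultimately have "((\<lambda>w. H w i j - DG w i \<bullet> DG w j) \<longlongrightarrow> 0) at_infinity"
      by (intro Lim_null_comparison[of "\<lambda>w. H w i j - DG w i \<bullet> DG w j" "\<lambda>w. perturb w * 2 * 2"]) auto
    moreover have "((\<lambda>w. H w i j - i \<bullet> j) \<longlongrightarrow> 0) at_infinity"
      using decays_tendsto[OF H_decays[OF ij]] \<tau> by simp
    ultimately have "((\<lambda>w. (H w i j - i \<bullet> j) - (H w i j - DG w i \<bullet> DG w j)) \<longlongrightarrow> 0 - 0) at_infinity"
      by (intro tendsto_diff)
    then have "((\<lambda>w. DG w i \<bullet> DG w j) \<longlongrightarrow> i \<bullet> j) at_infinity"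
      by (intro LIM_zero_cancel[of _ "i \<bullet> j"]) (simp add: algebra_simps)
    then show ?thesis using tendsto_unique[OF trivial_limit_at_infinity 1] by simp
  qed
  have oA: "orthogonal_transformation A"
    unfolding orthogonal_transformation_def using linA bilinear_eq_on_Basis[OF linA orth] by blast
  have "decays 0 (\<lambda>w. G w \<bullet> a - A w \<bullet> a)" if a: "a \<in> Basis" for a
  proof -
    have der: "\<forall>\<^sub>F w in at_infinity. ((\<lambda>w. G w \<bullet> a - A w \<bullet> a) has_derivative (\<lambda>v. DG w v \<bullet> a - A v \<bullet> a)) (at w)"
      using DG
    proof eventually_elim
      case (elim w)
      have "(A has_derivative A) (at w)"
        by (rule bounded_linear_imp_has_derivative) (rule linA[THEN linear_conv_bounded_linear[THEN iffD1]])
      with elim show ?case by (intro has_derivative_diff has_derivative_inner_left)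
    qed
    have "\<exists>C. \<forall>\<^sub>F w in at_infinity. \<forall>i\<in>Basis. \<bar>DG w i \<bullet> a - A i \<bullet> a\<bar> \<le> C * norm w powr (-\<sigma>)"
    proof -
      have "\<exists>C. \<forall>\<^sub>F w in at_infinity. \<forall>i\<in>I. \<bar>DG w i \<bullet> a - A i \<bullet> a\<bar> \<le> C * norm w powr (-\<sigma>)"
        if "finite I" "I \<subseteq> Basis" for I
        using that
      proof (induction I)
        case (insert i I)
        obtain C where C: "\<forall>\<^sub>F w in at_infinity. \<forall>i\<in>I. \<bar>DG w i \<bullet> a - A i \<bullet> a\<bar> \<le> C * norm w powr (-\<sigma>)"
          using insert by auto
        have "decays \<sigma> (\<lambda>w. DG w i \<bullet> a - A i \<bullet> a)" using dA insert.prems a by simp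
        from decays_imp_partial[OF this] obtain D R
          where D: "\<And>w. norm w > R \<Longrightarrow> \<bar>DG w i \<bullet> a - A i \<bullet> a\<bar> \<le> D * norm w powr (-\<sigma>)" by metis
        have "\<forall>\<^sub>F w in at_infinity. \<forall>i\<in>insert i I. \<bar>DG w i \<bullet> a - A i \<bullet> a\<bar> \<le> max C D * norm w powr (-\<sigma>)"
          using C eventually_norm_gt[of R]
        proof eventually_elim
          case (elim w)
          have "C * norm w powr (-\<sigma>) \<le> max C D * norm w powr (-\<sigma>)" "D * norm w powr (-\<sigma>) \<le> max C D * norm w powr (-\<sigma>)"
            by (intro mult_right_mono; simp)+
          then show ?case using elim D[of w] by (auto intro: order_trans)
        qed
        then show ?case by blast
      qed auto
      from this[OF finite_Basis order_refl] show ?thesis .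
    qed
    then obtain C where C: "\<forall>\<^sub>F w in at_infinity. \<forall>i\<in>Basis. \<bar>DG w i \<bullet> a - A i \<bullet> a\<bar> \<le> C * norm w powr (-\<sigma>)" by blast
    have bd: "\<forall>\<^sub>F w in at_infinity. \<forall>v. \<bar>DG w v \<bullet> a - A v \<bullet> a\<bar> \<le> (real DIM('a) * C) * norm w powr (-\<sigma>) * norm v"
      using C DG_linear
    proof (eventually_elim, intro allI)
      fix w v assume *: "\<forall>i\<in>Basis. \<bar>DG w i \<bullet> a - A i \<bullet> a\<bar> \<le> C * norm w powr (-\<sigma>)" "linear (DG w)"
      have "linear (\<lambda>v. DG w v \<bullet> a - A v \<bullet> a)"
        using *(2) linA by (auto simp: linear_iff inner_simps algebra_simps)
      then have "norm (DG w v \<bullet> a - A v \<bullet> a) \<le> real DIM('a) * (C * norm w powr (-\<sigma>)) * norm v"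
        using *(1) by (intro norm_le_sum_Basis_bound) auto
      then show "\<bar>DG w v \<bullet> a - A v \<bullet> a\<bar> \<le> (real DIM('a) * C) * norm w powr (-\<sigma>) * norm v" by (simp add: mult.assoc)
    qed
    have bd1: "\<forall>\<^sub>F w in at_infinity. \<forall>v. \<bar>DG w v \<bullet> a - A v \<bullet> a\<bar> \<le> (real DIM('a) * C) * norm w powr (-1-(\<sigma>-1)) * norm v"
      using bd by simp
    \<comment> \<open>A second use of the limit lemma, now with exponent \<sigma> - 1 > 0; b is the
      asymptotic translation of the chart.\<close>
    obtain b K where b: "\<forall>\<^sub>F w in at_infinity. \<bar>(G w \<bullet> a - A w \<bullet> a) - b\<bar> \<le> K * norm w powr (-(\<sigma>-1))"
      using limit_at_infinity_of_derivative_bound[OF dim _ der bd1] \<sigma> by auto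
    show ?thesis
    proof (rule decaysI[OF der])
      show "\<forall>\<^sub>F w in at_infinity. \<bar>G w \<bullet> a - A w \<bullet> a\<bar> \<le> (\<bar>b\<bar> + \<bar>K\<bar>) * norm w powr (-0)"
        using b eventually_norm_gt[of 1]
      proof eventually_elim
        case (elim w)
        have "norm w powr (-(\<sigma>-1)) \<le> norm w powr 0" using elim(2) \<sigma> by (intro powr_mono) auto
        moreover have nz: "norm w powr 0 = 1" using elim(2) by auto
        ultimately have "K * norm w powr (-(\<sigma>-1)) \<le> \<bar>K\<bar> * 1" by (intro mult_mono) auto
        moreover have "norm w powr (-0) = 1" using nz by simp
        ultimately show ?case using elim(1) by simp
      qed
      show "\<forall>\<^sub>F w in at_infinity. \<forall>v. \<bar>DG w v \<bullet> a - A v \<bullet> a\<bar> \<le> \<bar>real DIM('a) * C\<bar> * norm w powr (-0-1) * norm v"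
        using bd eventually_norm_gt[of 1]
      proof (eventually_elim, intro allI)
        fix w v :: 'a assume *: "\<forall>v. \<bar>DG w v \<bullet> a - A v \<bullet> a\<bar> \<le> (real DIM('a) * C) * norm w powr (-\<sigma>) * norm v" "1 < norm w"
        have "norm w powr (-\<sigma>) \<le> norm w powr (-0-1)" using *(2) \<sigma> by (intro powr_mono) auto
        then have "(real DIM('a) * C) * norm w powr (-\<sigma>) * norm v \<le> \<bar>real DIM('a) * C\<bar> * norm w powr (-0-1) * norm v"
          by (intro mult_right_mono mult_mono) auto
        then show "\<bar>DG w v \<bullet> a - A v \<bullet> a\<bar> \<le> \<bar>real DIM('a) * C\<bar> * norm w powr (-0-1) * norm v"
          using *(1) by (meson order_trans)
      qed
    qed
  qed
  with oA dA show thesis by (rule that)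
qed

end

section \<open>The leading term of the metric\<close>

text \<open>Equality of leading terms, stable under products and inverses; it permits replacing G w
  by A w in the leading term of the metric.\<close>

definition agrees :: "real \<Rightarrow> ('a::euclidean_space \<Rightarrow> real) \<Rightarrow> ('a \<Rightarrow> real) \<Rightarrow> bool" where
  "agrees m f g \<longleftrightarrow> decays m f \<and> decays m g \<and> decays (m + 1) (\<lambda>w. f w - g w)"

lemma agrees_const: "agrees 0 (\<lambda>_. c) (\<lambda>_. c)"
  by (simp add: agrees_def decays_const decays_zero)

lemma agrees_add: "agrees m f f' \<Longrightarrow> agrees m g g' \<Longrightarrow> agrees m (\<lambda>w. f w + g w) (\<lambda>w. f' w + g' w)"
  unfolding agrees_def using decays_add[of "m+1" "\<lambda>w. f w - f' w" "\<lambda>w. g w - g' w"]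
  by (auto intro: decays_add simp: algebra_simps)

lemma agrees_mult:
  assumes "agrees m f f'" "agrees n g g'"
  shows "agrees (m + n) (\<lambda>w. f w * g w) (\<lambda>w. f' w * g' w)"
proof -
  have "decays (m + n + 1) (\<lambda>w. (f w - f' w) * g w + f' w * (g w - g' w))"
    using assms unfolding agrees_def
    by (intro decays_add decays_mult'[of "m+1" _ n] decays_mult'[of m _ "n+1"]) auto
  then show ?thesis using assms unfolding agrees_def
    by (auto intro: decays_mult simp: algebra_simps)
qed

lemma agrees_mult': "agrees m f f' \<Longrightarrow> agrees n g g' \<Longrightarrow> l = m + n \<Longrightarrow> agrees l (\<lambda>w. f w * g w) (\<lambda>w. f' w * g' w)"
  using agrees_mult by blast

lemma agrees_cmult: "agrees m f f' \<Longrightarrow> agrees m (\<lambda>w. c * f w) (\<lambda>w. c * f' w)"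
  using agrees_mult[OF agrees_const] by simp

lemma agrees_diff: "agrees m f f' \<Longrightarrow> agrees m g g' \<Longrightarrow> agrees m (\<lambda>w. f w - g w) (\<lambda>w. f' w - g' w)"
  using agrees_add[OF _ agrees_cmult[of m g g' "-1"], of f f'] by simp

lemma agrees_sum:
  "(\<And>i. i \<in> I \<Longrightarrow> agrees m (f i) (g i)) \<Longrightarrow> agrees m (\<lambda>w. \<Sum>i\<in>I. f i w) (\<lambda>w. \<Sum>i\<in>I. g i w)"
  unfolding agrees_def
  by (auto intro!: decays_sum simp: sum_subtractf[symmetric])

lemma agrees_inverse:
  assumes "agrees m f f'" "c > 0" "\<forall>\<^sub>F w in at_infinity. \<bar>f w\<bar> \<ge> c * norm w powr (-m)"
    "\<forall>\<^sub>F w in at_infinity. \<bar>f' w\<bar> \<ge> c * norm w powr (-m)"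
  shows "agrees (-m) (\<lambda>w. inverse (f w)) (\<lambda>w. inverse (f' w))"
proof -
  have i: "decays (-m) (\<lambda>w. inverse (f w))" "decays (-m) (\<lambda>w. inverse (f' w))"
    using assms unfolding agrees_def by (auto intro: decays_inverse)
  have "decays (m + 1) (\<lambda>w. - (f w - f' w))"
    using assms(1) decays_minus[of "m+1" "\<lambda>w. f w - f' w"] unfolding agrees_def by blast
  from decays_mult'[OF this decays_mult[OF i], of "-m + 1"]
  have "decays (-m + 1) (\<lambda>w. - (f w - f' w) * (inverse (f w) * inverse (f' w)))" by simp
  moreover have "\<forall>\<^sub>F w in at_infinity. - (f w - f' w) * (inverse (f w) * inverse (f' w)) = inverse (f w) - inverse (f' w)"
    using assms(3,4) eventually_norm_gt[of 0]
  proof eventually_elim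
    case (elim w)
    then have "c * norm w powr (-m) > 0" using assms(2) by simp
    then have "f w \<noteq> 0" "f' w \<noteq> 0" using elim by auto
    then show ?case by (simp add: field_simps)
  qed
  ultimately have "decays (-m + 1) (\<lambda>w. inverse (f w) - inverse (f' w))" by (rule decays_cong)
  then show ?thesis using i by (simp add: agrees_def)
qed

definition lead :: "('a::euclidean_space \<Rightarrow> 'a) \<Rightarrow> ('a \<Rightarrow> 'a) \<Rightarrow> 'a \<Rightarrow> 'a \<Rightarrow> 'a \<Rightarrow> real" where
  "lead J M y a b = inverse ((y \<bullet> y) * (y \<bullet> y)) *
     ((J y \<bullet> M y) * (a \<bullet> b) - (J y \<bullet> a) * (M y \<bullet> b) - (M y \<bullet> a) * (J y \<bullet> b))"

lemma linear_Basis_expansion: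
  fixes f :: "'a::euclidean_space \<Rightarrow> real"
  assumes "linear f" shows "f x = (\<Sum>b\<in>Basis. (x \<bullet> b) * f b)"
  by (subst euclidean_representation[of x, symmetric])
     (simp only: linear_sum[OF assms] linear_scale[OF assms] real_scaleR_def)

lemma lead_linear: "linear (\<lambda>a. lead J M y a b)" "linear (lead J M y a)"
  by (auto simp: linear_iff lead_def inner_simps algebra_simps)

lemma lead_expand:
  "(\<Sum>a\<in>Basis. \<Sum>b\<in>Basis. (x \<bullet> a) * (z \<bullet> b) * lead J M y a b) = lead J M y x z"
proof -
  have 1: "lead J M y x z = (\<Sum>a\<in>Basis. (x \<bullet> a) * lead J M y a z)"
    using linear_Basis_expansion[OF lead_linear(1)[of J M y z], of x] .
  have 2: "lead J M y a z = (\<Sum>b\<in>Basis. (z \<bullet> b) * lead J M y a b)" for a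
    using linear_Basis_expansion[OF lead_linear(2)[of J M y a], of z] .
  show ?thesis unfolding 1 by (simp add: 2 sum_distrib_left mult_ac)
qed

lemma lead_orthogonal:
  fixes A :: "'a::euclidean_space \<Rightarrow> 'a"
  assumes A: "orthogonal_transformation A"
  shows "lead J M (A w) (A i) (A j) = lead (\<lambda>w. inv A (J (A w))) (\<lambda>w. inv A (M (A w))) w i j"
proof -
  have surj: "A (inv A y) = y" for y
    using orthogonal_transformation_surj[OF A] by (simp add: surj_f_inv_f)
  have pres: "A x \<bullet> A y = x \<bullet> y" for x y using A by (simp add: orthogonal_transformation_def)
  have "inv A x \<bullet> y = x \<bullet> A y" for x y using pres[of "inv A x" y] by (simp add: surj)
  moreover have "inv A x \<bullet> inv A y = x \<bullet> y" for x y using pres[of "inv A x" "inv A y"] by (simp add: surj)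
  ultimately show ?thesis by (simp add: lead_def pres)
qed

section \<open>Expansion of the metric in an arbitrary chart\<close>

context asymptotic_chart
begin

text \<open>Substituting DG = A + U into the pull-back, only the terms linear in U and the
  conjugated leading term of k have order possibly not exceeding 2. The error order min(2 \<sigma>,
  3) is greater than 2 because \<sigma> > 1.\<close>

lemma chart_expansion:
  fixes J M :: "'a \<Rightarrow> 'a"
  assumes J: "linear J" and M: "linear M"
    and kL: "\<And>a b. a \<in> Basis \<Longrightarrow> b \<in> Basis \<Longrightarrow> decays 3 (\<lambda>y. k y a b - lead J M y a b)"
  obtains A \<mu> where "orthogonal_transformation A" "2 < \<mu>"
    "\<forall>i\<in>Basis. \<forall>j\<in>Basis. decays \<mu> (\<lambda>w. H w i j - (i \<bullet> j + (A i \<bullet> (DG w j - A j) + A j \<bullet> (DG w i - A i)) +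
        lead (\<lambda>w. inv A (J (A w))) (\<lambda>w. inv A (M (A w))) w i j))"
proof -
  obtain A where A: "orthogonal_transformation A"
    and U: "\<And>i a. i \<in> Basis \<Longrightarrow> a \<in> Basis \<Longrightarrow> decays \<sigma> (\<lambda>w. DG w i \<bullet> a - A i \<bullet> a)"
    and u: "\<And>a. a \<in> Basis \<Longrightarrow> decays 0 (\<lambda>w. G w \<bullet> a - A w \<bullet> a)"
    by (rule asymptotic_isometry) blast
  have linA: "linear A" using A by (rule orthogonal_transformation_linear)
  have pres: "A x \<bullet> A y = x \<bullet> y" for x y using A by (simp add: orthogonal_transformation_def)
  have coordA: "decays (-1) (\<lambda>w. A w \<bullet> x)" for x
  proof -
    have "A w \<bullet> x = w \<bullet> adjoint A x" for w using adjoint_works[OF linA, of w x] by simp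
    then show ?thesis using decays_coord[of "adjoint A x"] by simp
  qed
  have c0: "agrees (-1) (\<lambda>w. G w \<bullet> a) (\<lambda>w. A w \<bullet> a)" if "a \<in> Basis" for a
    using decays_add[OF coordA[of a] decays_mono[OF u[OF that], of "-1"]] coordA u[OF that]
    by (simp add: agrees_def)
  have c: "agrees (-1) (\<lambda>w. G w \<bullet> x) (\<lambda>w. A w \<bullet> x)" for x
    unfolding euclidean_inner[of _ x]
    by (intro agrees_sum agrees_mult'[OF c0 agrees_const]) auto
  have cl: "agrees (-1) (\<lambda>w. J (G w) \<bullet> x) (\<lambda>w. J (A w) \<bullet> x)" if "linear J" for J :: "'a \<Rightarrow> 'a" and x
    using c[of "adjoint J x"] by (simp add: adjoint_works[OF that])
  have cc: "agrees (-2) (\<lambda>w. J (G w) \<bullet> M (G w)) (\<lambda>w. J (A w) \<bullet> M (A w))" if "linear J" "linear M" for J M :: "'a \<Rightarrow> 'a"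
  proof -
    have "agrees (-2) (\<lambda>w. \<Sum>a\<in>Basis. (J (G w) \<bullet> a) * (M (G w) \<bullet> a)) (\<lambda>w. \<Sum>a\<in>Basis. (J (A w) \<bullet> a) * (M (A w) \<bullet> a))"
      by (intro agrees_sum agrees_mult'[OF cl cl] that) auto
    then show ?thesis by (simp only: euclidean_inner[symmetric])
  qed
  have sq: "agrees (-2) (\<lambda>w. G w \<bullet> G w) (\<lambda>w. A w \<bullet> A w)"
    using cc[OF linear_ident linear_ident] by simp
  obtain d where d: "d > 0" "\<forall>\<^sub>F w in at_infinity. norm (G w) \<ge> d * norm w" by (rule G_lower)
  \<comment> \<open>One constant for both lower bounds: d^2 for |G w|^2 and 1 for |A w|^2 =
    |w|^2.\<close>
  define d' where "d' = min (d\<^sup>2) 1"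
  have d': "d' > 0" "d' \<le> d\<^sup>2" "d' \<le> 1" using d by (auto simp: d'_def)
  have pw: "norm w powr (-(-2)) = (norm w)\<^sup>2" for w :: 'a by (simp add: powr_numeral)
  have "agrees (-(-2)) (\<lambda>w. inverse (G w \<bullet> G w)) (\<lambda>w. inverse (A w \<bullet> A w))"
  proof (rule agrees_inverse[OF sq d'(1)])
    show "\<forall>\<^sub>F w in at_infinity. d' * norm w powr (-(-2)) \<le> \<bar>G w \<bullet> G w\<bar>"
      using d(2)
    proof eventually_elim
      case (elim w)
      have "d' * (norm w)\<^sup>2 \<le> d\<^sup>2 * (norm w)\<^sup>2" using d' by (intro mult_right_mono) auto
      also have "\<dots> = (d * norm w)\<^sup>2" by (simp add: power_mult_distrib)
      also have "\<dots> \<le> (norm (G w))\<^sup>2" using elim d(1) by (intro power_mono) auto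
      finally show ?case unfolding pw by (simp add: power2_norm_eq_inner)
    qed
    show "\<forall>\<^sub>F w in at_infinity. d' * norm w powr (-(-2)) \<le> \<bar>A w \<bullet> A w\<bar>"
    proof (intro always_eventually allI)
      fix w :: 'a
      have "d' * (norm w)\<^sup>2 \<le> 1 * (norm w)\<^sup>2" using d' by (intro mult_right_mono) auto
      then show "d' * norm w powr (-(-2)) \<le> \<bar>A w \<bullet> A w\<bar>"
        unfolding pw by (simp add: pres power2_norm_eq_inner)
    qed
  qed
  then have inv: "agrees 2 (\<lambda>w. inverse (G w \<bullet> G w)) (\<lambda>w. inverse (A w \<bullet> A w))" by simp
  have lead: "agrees 2 (\<lambda>w. lead J M (G w) x y) (\<lambda>w. lead J M (A w) x y)" for x y
    unfolding lead_def inverse_mult_distrib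
    by (intro agrees_mult'[OF agrees_mult'[OF inv inv refl], of "-2"] agrees_diff agrees_mult'[OF cc agrees_const, of J M] agrees_mult'[OF cl cl] J M) auto
  have main: "decays (min (2 * \<sigma>) 3) (\<lambda>w. H w i j - (i \<bullet> j + (A i \<bullet> (DG w j - A j) + A j \<bullet> (DG w i - A i)) +
        lead (\<lambda>w. inv A (J (A w))) (\<lambda>w. inv A (M (A w))) w i j))" if ij: "i \<in> Basis" "j \<in> Basis" for i j
  proof -
    let ?U = "\<lambda>i a w. DG w i \<bullet> a - A i \<bullet> a"
    let ?K = "\<lambda>a b w. k (G w) a b"
    have DG0: "decays 0 (\<lambda>w. DG w i \<bullet> a)" if "i \<in> Basis" "a \<in> Basis" for i a
      using decays_add[OF decays_mono[OF U[OF that], of 0] decays_const[of "A i \<bullet> a"]] \<sigma> by simp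
    \<comment> \<open>\<open>D1\<close> is quadratic in U, \<open>D2\<close> pairs U with k,
      \<open>D3\<close> replaces k by its leading term, and \<open>D4\<close> moves the base point
      from G w to A w. Their orders are at least 2 \<sigma>, \<sigma> + 2, 3 and 3.\<close>
    have D1: "decays (min (2 * \<sigma>) 3) (\<lambda>w. \<Sum>a\<in>Basis. ?U i a w * ?U j a w)"
      by (intro decays_sum decays_mult'[OF U U] ij) auto
    have V: "decays \<sigma> (\<lambda>w. ?U i a w * (DG w j \<bullet> b) + (A i \<bullet> a) * ?U j b w)" if "a \<in> Basis" "b \<in> Basis" for a b
      by (intro decays_add decays_mult'[OF U DG0] decays_cmult U ij that) auto
    have D2: "decays (min (2 * \<sigma>) 3) (\<lambda>w. \<Sum>a\<in>Basis. \<Sum>b\<in>Basis. (?U i a w * (DG w j \<bullet> b) + (A i \<bullet> a) * ?U j b w) * ?K a b w)"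
      by (intro decays_sum decays_mult'[OF V decays_pullback[OF k_decays]]) (use \<sigma> in auto)
    have D3: "decays (min (2 * \<sigma>) 3) (\<lambda>w. \<Sum>a\<in>Basis. \<Sum>b\<in>Basis. ((A i \<bullet> a) * (A j \<bullet> b)) * (?K a b w - lead J M (G w) a b))"
      by (intro decays_sum decays_cmult decays_mono[OF decays_pullback[OF kL]]) auto
    have D4: "decays (min (2 * \<sigma>) 3) (\<lambda>w. lead J M (G w) (A i) (A j) - lead J M (A w) (A i) (A j))"
      using lead[of "A i" "A j"] unfolding agrees_def by (auto intro: decays_mono)
    note D = decays_add[OF decays_add[OF decays_add[OF D1 D2] D3] D4]
    show ?thesis
    proof (rule decays_cong[OF D], use H_eq in eventually_elim)
      fix w :: 'a assume H: "\<forall>u v. H w u v = DG w u \<bullet> DG w v + (\<Sum>a\<in>Basis. \<Sum>b\<in>Basis. (DG w u \<bullet> a) * (DG w v \<bullet> b) * k (G w) a b)"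
      have "(\<Sum>a\<in>Basis. ?U i a w * ?U j a w) = (DG w i - A i) \<bullet> (DG w j - A j)"
        by (subst euclidean_inner) (simp add: inner_diff_left)
      also have "\<dots> = DG w i \<bullet> DG w j - (i \<bullet> j + (A i \<bullet> (DG w j - A j) + A j \<bullet> (DG w i - A i)))"
        by (simp add: inner_diff_left inner_diff_right pres inner_commute)
      finally have 1: "(\<Sum>a\<in>Basis. ?U i a w * ?U j a w) = DG w i \<bullet> DG w j - (i \<bullet> j + (A i \<bullet> (DG w j - A j) + A j \<bullet> (DG w i - A i)))" .
      have "(\<Sum>a\<in>Basis. \<Sum>b\<in>Basis. (?U i a w * (DG w j \<bullet> b) + (A i \<bullet> a) * ?U j b w) * ?K a b w) +
         (\<Sum>a\<in>Basis. \<Sum>b\<in>Basis. ((A i \<bullet> a) * (A j \<bullet> b)) * (?K a b w - lead J M (G w) a b)) =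
         (\<Sum>a\<in>Basis. \<Sum>b\<in>Basis. (DG w i \<bullet> a) * (DG w j \<bullet> b) * ?K a b w) -
         (\<Sum>a\<in>Basis. \<Sum>b\<in>Basis. (A i \<bullet> a) * (A j \<bullet> b) * lead J M (G w) a b)"
        unfolding sum.distrib[symmetric] sum_subtractf[symmetric] by (intro sum.cong refl) algebra
      also have "(\<Sum>a\<in>Basis. \<Sum>b\<in>Basis. (A i \<bullet> a) * (A j \<bullet> b) * lead J M (G w) a b) = lead J M (G w) (A i) (A j)"
        by (rule lead_expand)
      finally show "(\<Sum>a\<in>Basis. ?U i a w * ?U j a w) +
          (\<Sum>a\<in>Basis. \<Sum>b\<in>Basis. (?U i a w * (DG w j \<bullet> b) + (A i \<bullet> a) * ?U j b w) * ?K a b w) +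
          (\<Sum>a\<in>Basis. \<Sum>b\<in>Basis. ((A i \<bullet> a) * (A j \<bullet> b)) * (?K a b w - lead J M (G w) a b)) +
          (lead J M (G w) (A i) (A j) - lead J M (A w) (A i) (A j)) =
        H w i j - (i \<bullet> j + (A i \<bullet> (DG w j - A j) + A j \<bullet> (DG w i - A i)) +
          lead (\<lambda>w. inv A (J (A w))) (\<lambda>w. inv A (M (A w))) w i j)"
        using 1 H lead_orthogonal[OF A, of J M w i j] by simp
    qed
  qed
  show thesis by (rule that[OF A]) (use \<sigma> main in auto)
qed

end

definition lead_deriv :: "('a::euclidean_space \<Rightarrow> 'a) \<Rightarrow> ('a \<Rightarrow> 'a) \<Rightarrow> 'a \<Rightarrow> 'a \<Rightarrow> 'a \<Rightarrow> 'a \<Rightarrow> real" where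
  "lead_deriv J M w a b v =
     (w \<bullet> v) * (- 4 * inverse ((w \<bullet> w) ^ 3) * ((J w \<bullet> M w) * (a \<bullet> b) - (J w \<bullet> a) * (M w \<bullet> b) - (M w \<bullet> a) * (J w \<bullet> b))) +
     inverse ((w \<bullet> w) * (w \<bullet> w)) * ((J v \<bullet> M w + J w \<bullet> M v) * (a \<bullet> b) -
       (J v \<bullet> a) * (M w \<bullet> b) - (J w \<bullet> a) * (M v \<bullet> b) - (M v \<bullet> a) * (J w \<bullet> b) - (M w \<bullet> a) * (J v \<bullet> b))"

lemma lead_has_derivative:
  fixes J M :: "'a::euclidean_space \<Rightarrow> 'a"
  assumes J: "linear J" and M: "linear M" and w: "w \<noteq> 0"
  shows "((\<lambda>w. lead J M w a b) has_derivative lead_deriv J M w a b) (at w)"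
proof -
  have dJ: "(J has_derivative J) (at w)" and dM: "(M has_derivative M) (at w)"
    using J M by (auto intro!: bounded_linear_imp_has_derivative simp: linear_conv_bounded_linear)
  have s: "w \<bullet> w \<noteq> 0" using w by simp
  have ds: "((\<lambda>w. w \<bullet> w) has_derivative (\<lambda>v. 2 * (w \<bullet> v))) (at w)"
    by (auto intro!: derivative_eq_intros simp: inner_commute)
  have "((\<lambda>w. (w \<bullet> w) * (w \<bullet> w)) has_derivative (\<lambda>v. 4 * (w \<bullet> w) * (w \<bullet> v))) (at w)"
    by (rule has_derivative_eq_rhs[OF has_derivative_mult[OF ds ds]]) auto
  from Deriv.has_derivative_inverse[OF _ this]
  have di: "((\<lambda>w. inverse ((w \<bullet> w) * (w \<bullet> w))) has_derivative (\<lambda>v. (w \<bullet> v) * (- 4 * inverse ((w \<bullet> w) ^ 3)))) (at w)"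
    by (rule has_derivative_eq_rhs) (use s in \<open>auto simp: fun_eq_iff field_simps power3_eq_cube\<close>)
  have dn: "((\<lambda>w. (J w \<bullet> M w) * (a \<bullet> b) - (J w \<bullet> a) * (M w \<bullet> b) - (M w \<bullet> a) * (J w \<bullet> b)) has_derivative
      (\<lambda>v. (J w \<bullet> M v + J v \<bullet> M w) * (a \<bullet> b) - ((J w \<bullet> a) * (M v \<bullet> b) + (J v \<bullet> a) * (M w \<bullet> b)) -
         ((M w \<bullet> a) * (J v \<bullet> b) + (M v \<bullet> a) * (J w \<bullet> b)))) (at w)"
    by (intro has_derivative_diff has_derivative_mult_left has_derivative_inner has_derivative_mult has_derivative_inner_left dJ dM)
  show ?thesis unfolding lead_def
    by (rule has_derivative_eq_rhs[OF has_derivative_mult[OF di dn]])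
       (simp add: lead_deriv_def fun_eq_iff algebra_simps)
qed

text \<open>With Q = Jw . Mw, antisymmetry cancels the divergence part, -4Q + 4Q. The trace part
  remains: in dimension 4 the trace of \<open>lead\<close> is (4 - 2) Q |w|^-4, homogeneous of
  degree -2, so minus its derivative along w is 4 Q |w|^-4.\<close>

lemma lead_flux:
  fixes J M :: "'a::euclidean_space \<Rightarrow> 'a"
  assumes J: "linear J" "\<And>x y. J x \<bullet> y = - (x \<bullet> J y)" and M: "linear M" "\<And>x y. M x \<bullet> y = - (x \<bullet> M y)"
    and w: "w \<noteq> 0" and dim: "DIM('a) = 4"
  shows "(\<Sum>i\<in>Basis. \<Sum>j\<in>Basis. (lead_deriv J M w i j i - lead_deriv J M w i i j) * (w \<bullet> j)) =
    4 * inverse ((w \<bullet> w) * (w \<bullet> w)) * (J w \<bullet> M w)"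
proof -
  define s where "s = w \<bullet> w"
  define Q where "Q = J w \<bullet> M w"
  have s: "s \<noteq> 0" using w by (simp add: s_def)
  have Jw: "J w \<bullet> w = 0" "M w \<bullet> w = 0" "w \<bullet> J w = 0" "w \<bullet> M w = 0" using J(2)[of w w] M(2)[of w w] by (simp_all add: inner_commute)
  note Jl = linear_add[OF J(1)] linear_scale[OF J(1)] and Ml = linear_add[OF M(1)] linear_scale[OF M(1)]
  have lin1: "linear (\<lambda>b. lead_deriv J M w a b v)" for a v
    by (auto simp: linear_iff lead_deriv_def inner_simps algebra_simps)
  have lin2: "linear (\<lambda>v. lead_deriv J M w a b v)" for a b
    by (auto simp: linear_iff lead_deriv_def inner_simps Jl Ml algebra_simps)
  have "(\<Sum>i\<in>Basis. \<Sum>j\<in>Basis. (lead_deriv J M w i j i - lead_deriv J M w i i j) * (w \<bullet> j)) =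
     (\<Sum>i\<in>Basis. (\<Sum>j\<in>Basis. (w \<bullet> j) * lead_deriv J M w i j i) - (\<Sum>j\<in>Basis. (w \<bullet> j) * lead_deriv J M w i i j))"
    by (simp add: sum_subtractf[symmetric] algebra_simps)
  also have "\<dots> = (\<Sum>i\<in>Basis. lead_deriv J M w i w i - lead_deriv J M w i i w)"
  proof (rule sum.cong[OF refl])
    fix i :: 'a
    have "(\<Sum>j\<in>Basis. (w \<bullet> j) * lead_deriv J M w i j i) = lead_deriv J M w i w i"
      by (rule linear_Basis_expansion[OF lin1, symmetric])
    moreover have "(\<Sum>j\<in>Basis. (w \<bullet> j) * lead_deriv J M w i i j) = lead_deriv J M w i i w"
      by (rule linear_Basis_expansion[OF lin2, symmetric])
    ultimately show "(\<Sum>j\<in>Basis. (w \<bullet> j) * lead_deriv J M w i j i) - (\<Sum>j\<in>Basis. (w \<bullet> j) * lead_deriv J M w i i j) =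
      lead_deriv J M w i w i - lead_deriv J M w i i w" by simp
  qed
  also have "\<dots> = (\<Sum>i\<in>Basis. (- 4 * inverse (s ^ 3) * Q) * ((w \<bullet> i) * (w \<bullet> i)) +
      inverse (s * s) * ((w \<bullet> i) * (J i \<bullet> M w) + (w \<bullet> i) * (M i \<bullet> J w) - (J w \<bullet> i) * (M i \<bullet> w) - (M w \<bullet> i) * (J i \<bullet> w)) +
      2 * inverse (s * s) * (Q * (i \<bullet> i) - 2 * ((J w \<bullet> i) * (M w \<bullet> i))))"
  proof (rule sum.cong[OF refl])
    fix i :: 'a
    have eq: "s * inverse (s ^ 3) = inverse (s * s)" using s by (simp add: field_simps power3_eq_cube)
    have "lead_deriv J M w i i w = s * inverse (s ^ 3) * (- 4 * (Q * (i \<bullet> i) - 2 * ((J w \<bullet> i) * (M w \<bullet> i)))) +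
      inverse (s * s) * (2 * (Q * (i \<bullet> i)) - 4 * ((J w \<bullet> i) * (M w \<bullet> i)))"
      by (simp add: lead_deriv_def s_def[symmetric] Q_def[symmetric] algebra_simps)
    then have "lead_deriv J M w i i w = - (2 * inverse (s * s) * (Q * (i \<bullet> i) - 2 * ((J w \<bullet> i) * (M w \<bullet> i))))"
      unfolding eq by (simp add: algebra_simps)
    moreover have "lead_deriv J M w i w i = (- 4 * inverse (s ^ 3) * Q) * ((w \<bullet> i) * (w \<bullet> i)) +
      inverse (s * s) * ((w \<bullet> i) * (J i \<bullet> M w) + (w \<bullet> i) * (M i \<bullet> J w) - (J w \<bullet> i) * (M i \<bullet> w) - (M w \<bullet> i) * (J i \<bullet> w))"
      by (simp add: lead_deriv_def Jw s_def[symmetric] Q_def[symmetric] inner_commute algebra_simps)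
    ultimately show "lead_deriv J M w i w i - lead_deriv J M w i i w =
      (- 4 * inverse (s ^ 3) * Q) * ((w \<bullet> i) * (w \<bullet> i)) +
      inverse (s * s) * ((w \<bullet> i) * (J i \<bullet> M w) + (w \<bullet> i) * (M i \<bullet> J w) - (J w \<bullet> i) * (M i \<bullet> w) - (M w \<bullet> i) * (J i \<bullet> w)) +
      2 * inverse (s * s) * (Q * (i \<bullet> i) - 2 * ((J w \<bullet> i) * (M w \<bullet> i)))" by simp
  qed
  also have "\<dots> = (- 4 * inverse (s ^ 3) * Q) * (\<Sum>i\<in>Basis. (w \<bullet> i) * (w \<bullet> i)) +
      inverse (s * s) * ((\<Sum>i\<in>Basis. (w \<bullet> i) * (J i \<bullet> M w)) + (\<Sum>i\<in>Basis. (w \<bullet> i) * (M i \<bullet> J w)) -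
        (\<Sum>i\<in>Basis. (J w \<bullet> i) * (M i \<bullet> w)) - (\<Sum>i\<in>Basis. (M w \<bullet> i) * (J i \<bullet> w))) +
      2 * inverse (s * s) * (Q * (\<Sum>i\<in>(Basis::'a set). i \<bullet> i) - 2 * (\<Sum>i\<in>Basis. (J w \<bullet> i) * (M w \<bullet> i)))"
    by (simp only: sum.distrib sum_subtractf sum_distrib_left[symmetric])
  also have "(\<Sum>i\<in>Basis. (w \<bullet> i) * (w \<bullet> i)) = s" by (simp only: euclidean_inner[symmetric] s_def)
  also have "(\<Sum>i\<in>Basis. (J w \<bullet> i) * (M w \<bullet> i)) = Q" by (simp only: euclidean_inner[symmetric] Q_def)
  also have "(\<Sum>i\<in>Basis. (w \<bullet> i) * (J i \<bullet> M w)) = Q"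
    unfolding Q_def by (rule linear_Basis_expansion[symmetric]) (auto simp: linear_iff inner_simps Jl)
  also have "(\<Sum>i\<in>Basis. (w \<bullet> i) * (M i \<bullet> J w)) = Q"
    unfolding Q_def inner_commute[of "J w"] by (rule linear_Basis_expansion[symmetric]) (auto simp: linear_iff inner_simps Ml)
  also have "(\<Sum>i\<in>Basis. (J w \<bullet> i) * (M i \<bullet> w)) = M (J w) \<bullet> w"
    by (rule linear_Basis_expansion[symmetric]) (auto simp: linear_iff inner_simps Ml)
  also have "M (J w) \<bullet> w = - Q" unfolding Q_def by (rule M(2))
  also have "(\<Sum>i\<in>Basis. (M w \<bullet> i) * (J i \<bullet> w)) = J (M w) \<bullet> w"
    by (rule linear_Basis_expansion[symmetric]) (auto simp: linear_iff inner_simps Jl)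
  also have "J (M w) \<bullet> w = - Q" unfolding Q_def using J(2)[of "M w" w] by (simp add: inner_commute)
  also have "(\<Sum>i\<in>(Basis::'a set). i \<bullet> i) = 4" using dim by (simp add: inner_Basis)
  also have "(- 4 * inverse (s ^ 3) * Q) * s + inverse (s * s) * (Q + Q - - Q - - Q) + 2 * inverse (s * s) * (Q * 4 - 2 * Q) = 4 * inverse (s * s) * Q"
    using s by (simp add: field_simps power3_eq_cube)
  finally show ?thesis unfolding s_def Q_def .
qed

text \<open>The trace is a multiple of a sphere integral, and sphere integrals are rotation
  invariant.\<close>

lemma trace_orthogonal_conjugate:
  fixes J M A :: "C2 \<Rightarrow> C2"
  assumes J: "linear J" and M: "linear M" and A: "orthogonal_transformation A"
  shows "(\<Sum>a\<in>Basis. J (A a) \<bullet> M (A a)) = (\<Sum>a\<in>Basis. J a \<bullet> M a)"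
proof -
  have linA: "linear A" using A by (rule orthogonal_transformation_linear)
  have "sphere_measurable 1 (\<lambda>w. J w \<bullet> M w)"
    by (intro sphere_measurable_continuous continuous_intros linear_continuous_on)
       (use J M linear_conv_bounded_linear in auto)
  from sphere_integral_orthogonal(2)[OF A this]
  show ?thesis
    using sphere_integral_inner_linear[of 1 "\<lambda>w. J (A w)" "\<lambda>w. M (A w)"] sphere_integral_inner_linear[of 1 J M]
      linear_compose[OF linA J] linear_compose[OF linA M] J M by (simp add: o_def)
qed

section \<open>The mass in a chart\<close>

text \<open>Otherwise quantifiers over \<^typ>\<open>C2\<close> are split into quantifiers over complex numbers.\<close>

declare split_paired_All [simp del]

text \<open>Up to terms that vanish in the limit, the flux of the metric is that of the leading term, plus
  the divergence of the antisymmetric tensor \<open>\<omega>\<^sub>i\<^sub>j = \<langle>\<partial>\<^sub>i G, A e\<^sub>j\<rangle> - \<langle>\<partial>\<^sub>j G, A e\<^sub>i\<rangle>\<close>. Contracted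
  with the normal, the latter is a sum of derivatives of \<open>\<omega>\<^sub>i\<^sub>j\<close> along rotations, so it integrates to 0.\<close>

lemma mass_of_chart:
  fixes G :: "C2 \<Rightarrow> C2" and J M :: "C2 \<Rightarrow> C2"
  assumes chart: "asymptotic_chart G DG D2G k H \<tau>"
    and J: "linear J" "\<And>x y. J x \<bullet> y = - (x \<bullet> J y)" and M: "linear M" "\<And>x y. M x \<bullet> y = - (x \<bullet> M y)"
    and kL: "\<And>a b. a \<in> Basis \<Longrightarrow> b \<in> Basis \<Longrightarrow> decays 3 (\<lambda>y. k y a b - lead J M y a b)"
  shows "has_mass H ((\<Sum>a\<in>Basis. J a \<bullet> M a) / 2)"
proof -
  interpret asymptotic_chart G DG D2G k H \<tau> by (rule chart)
  obtain A \<mu> where A: "orthogonal_transformation A" and \<mu>: "2 < \<mu>"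
    and exp: "\<forall>i\<in>Basis. \<forall>j\<in>Basis. decays \<mu> (\<lambda>w. H w i j - (i \<bullet> j + (A i \<bullet> (DG w j - A j) + A j \<bullet> (DG w i - A i)) +
        lead (\<lambda>w. inv A (J (A w))) (\<lambda>w. inv A (M (A w))) w i j))"
    by (rule chart_expansion[OF J(1) M(1) kL]) blast+
  define J' M' where "J' = (\<lambda>w. inv A (J (A w)))" "M' = (\<lambda>w. inv A (M (A w)))"
  define e where "e i j w = H w i j - (i \<bullet> j + (A i \<bullet> (DG w j - A j) + A j \<bullet> (DG w i - A i)) + lead J' M' w i j)" for i j w
  have linA: "linear A" using A by (rule orthogonal_transformation_linear)
  have lini: "linear (inv A)" using orthogonal_transformation_inv[OF A] by (rule orthogonal_transformation_linear)
  have pres: "A x \<bullet> A y = x \<bullet> y" for x y using A unfolding orthogonal_transformation_def by blast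
  have surj: "A (inv A y) = y" for y
    using orthogonal_transformation_surj[OF A] by (simp add: surj_f_inv_f)
  have J'1: "linear J'" and M'1: "linear M'"
    unfolding J'_M'_def using linear_compose[OF linear_compose[OF linA J(1)] lini] linear_compose[OF linear_compose[OF linA M(1)] lini]
    by (simp_all add: o_def)
  have J'2: "J' x \<bullet> y = - (x \<bullet> J' y)" and M'2: "M' x \<bullet> y = - (x \<bullet> M' y)" for x y
    using pres[of "J' x" y] pres[of x "J' y"] J(2)[of "A x" "A y"] pres[of "M' x" y] pres[of x "M' y"] M(2)[of "A x" "A y"]
    by (simp_all add: J'_M'_def surj)
  define S where "S = (\<Sum>a\<in>Basis. J a \<bullet> M a)"
  have trace: "(\<Sum>a\<in>Basis. J' a \<bullet> M' a) = S"
  proof -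
    have "J' a \<bullet> M' a = J (A a) \<bullet> M (A a)" for a
      using pres[of "J' a" "M' a"] by (simp add: J'_M'_def surj)
    then show ?thesis unfolding S_def using trace_orthogonal_conjugate[OF J(1) M(1) A] by simp
  qed
  define de where "de i j w = frechet_derivative (e i j) (at w)" for i j w
  have "decays \<mu> (case x of (i, j) \<Rightarrow> e i j)" if "x \<in> Basis \<times> Basis" for x
    using that exp unfolding e_def[abs_def] J'_M'_def by auto
  from decays_family_derivative[of "Basis \<times> Basis" \<mu> "\<lambda>x. case x of (i, j) \<Rightarrow> e i j", OF _ this]
  obtain C where C: "C \<ge> 0" "\<forall>\<^sub>F w in at_infinity. \<forall>i\<in>Basis. \<forall>j\<in>Basis. (e i j has_derivative de i j w) (at w) \<and>
      (\<forall>v. \<bar>de i j w v\<bar> \<le> C * norm w powr (-1-\<mu>) * norm v)"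
    unfolding de_def by auto
  obtain C2 where C2: "\<forall>\<^sub>F w in at_infinity. \<forall>i\<in>Basis. \<forall>l\<in>Basis. norm (D2G w i l) \<le> C2 * norm w powr (-1-\<sigma>)"
    by (rule D2G_bound)
  have "\<forall>\<^sub>F w in at_infinity. (\<forall>i\<in>Basis. \<forall>j\<in>Basis. (e i j has_derivative de i j w) (at w) \<and>
      (\<forall>v. \<bar>de i j w v\<bar> \<le> C * norm w powr (-1-\<mu>) * norm v)) \<and>
      (\<forall>i\<in>Basis. \<forall>l\<in>Basis. norm (D2G w i l) \<le> C2 * norm w powr (-1-\<sigma>)) \<and>
      (\<forall>u. ((\<lambda>w. DG w u) has_derivative D2G w u) (at w)) \<and> (\<forall>u v. D2G w u v = D2G w v u)"
    using C(2) C2 D2G D2G_sym by eventually_elim blast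
  then obtain b where b: "\<And>w. b \<le> norm w \<Longrightarrow> (\<forall>i\<in>Basis. \<forall>j\<in>Basis. (e i j has_derivative de i j w) (at w) \<and>
      (\<forall>v. \<bar>de i j w v\<bar> \<le> C * norm w powr (-1-\<mu>) * norm v)) \<and>
      (\<forall>i\<in>Basis. \<forall>l\<in>Basis. norm (D2G w i l) \<le> C2 * norm w powr (-1-\<sigma>)) \<and>
      (\<forall>u. ((\<lambda>w. DG w u) has_derivative D2G w u) (at w)) \<and> (\<forall>u v. D2G w u v = D2G w v u)"
    unfolding eventually_at_infinity by blast
  define R1 where "R1 = max b 1"
  have R1: "R1 \<ge> 1" by (simp add: R1_def)
  have e_der: "(e i j has_derivative de i j w) (at w)"
    and e_bd: "\<bar>de i j w v\<bar> \<le> C * norm w powr (-1-\<mu>) * norm v"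
    and D2b: "norm (D2G w i j) \<le> C2 * norm w powr (-1-\<sigma>)" if "norm w > R1" "i \<in> Basis" "j \<in> Basis" for i j w v
  proof -
    have "b \<le> norm w" using that(1) by (simp add: R1_def)
    from b[OF this] that show "(e i j has_derivative de i j w) (at w)"
      "\<bar>de i j w v\<bar> \<le> C * norm w powr (-1-\<mu>) * norm v" "norm (D2G w i j) \<le> C2 * norm w powr (-1-\<sigma>)" by blast+
  qed
  have D2: "((\<lambda>w. DG w u) has_derivative D2G w u) (at w)" and D2sym: "D2G w u v = D2G w v u" if "norm w > R1" for w u v
  proof -
    have "b \<le> norm w" using that(1) by (simp add: R1_def)
    from b[OF this] show "((\<lambda>w. DG w u) has_derivative D2G w u) (at w)" "D2G w u v = D2G w v u" by blast+
  qed
  have H_der: "((\<lambda>w. H w i j) has_derivative (\<lambda>v. A i \<bullet> D2G w j v + A j \<bullet> D2G w i v + lead_deriv J' M' w i j v + de i j w v)) (at w)"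
    if w: "norm w > R1" and ij: "i \<in> Basis" "j \<in> Basis" for i j w
  proof -
    have "w \<noteq> 0" using w R1 by auto
    have "((\<lambda>w. i \<bullet> j + (A i \<bullet> (DG w j - A j) + A j \<bullet> (DG w i - A i)) + lead J' M' w i j + e i j w) has_derivative
      (\<lambda>v. 0 + (A i \<bullet> (D2G w j v - 0) + A j \<bullet> (D2G w i v - 0)) + lead_deriv J' M' w i j v + de i j w v)) (at w)"
      by (intro has_derivative_add has_derivative_const has_derivative_inner_right has_derivative_diff D2[OF w]
          lead_has_derivative J'1 M'1 e_der w ij \<open>w \<noteq> 0\<close>)
    then show ?thesis by (simp add: e_def)
  qed
  have partial_H: "partial l (\<lambda>w. H w i j) w = A i \<bullet> D2G w j l + A j \<bullet> D2G w i l + lead_deriv J' M' w i j l + de i j w l"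
    if "norm w > R1" "i \<in> Basis" "j \<in> Basis" for i j w l
    unfolding partial_def frechet_derivative_at[OF H_der[OF that], symmetric] by (rule refl)
  \<comment> \<open>The derivative of the antisymmetric tensor \<omega>_ij along v.\<close>
  define om where "om i j w v = D2G w i v \<bullet> A j - D2G w j v \<bullet> A i" for i j w v
  define rotm where "rotm i j w = (w \<bullet> j) * om i j w i - (w \<bullet> i) * om i j w j" for i j w
  define rest where "rest w = (\<Sum>i\<in>Basis. \<Sum>j\<in>Basis. (de i j w i - de i i w j) * (w \<bullet> j))" for w
  have flux: "mass_flux H w = inverse R * (1/2 * (\<Sum>i\<in>Basis. \<Sum>j\<in>Basis. rotm i j w) +
      4 * inverse (R ^ 4) * (J' w \<bullet> M' w) + rest w)" if w: "norm w = R" and R: "R > R1" for w R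
  proof -
    have wR1: "norm w > R1" using w R by simp
    have "w \<noteq> 0" using wR1 R1 by auto
    have "mass_flux H w = (\<Sum>i\<in>Basis. \<Sum>j\<in>Basis. inverse R * ((w \<bullet> j) * om i j w i +
       (lead_deriv J' M' w i j i - lead_deriv J' M' w i i j) * (w \<bullet> j) + (de i j w i - de i i w j) * (w \<bullet> j)))"
      unfolding mass_flux_def w
    proof (intro sum.cong refl)
      fix i j :: C2 assume ij: "i \<in> Basis" "j \<in> Basis"
      \<comment> \<open>Symmetry of \<open>D2G\<close> merges the three second-derivative terms into
        a derivative of \<omega>_ij, so no symmetric part of the deformation is left.\<close>
      show "(partial i (\<lambda>w. H w i j) w - partial j (\<lambda>w. H w i i) w) * ((w /\<^sub>R R) \<bullet> j) =
        inverse R * ((w \<bullet> j) * om i j w i + (lead_deriv J' M' w i j i - lead_deriv J' M' w i i j) * (w \<bullet> j) + (de i j w i - de i i w j) * (w \<bullet> j))"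
        unfolding partial_H[OF wR1 ij] partial_H[OF wR1 ij(1) ij(1)] om_def D2sym[OF wR1, of j i] inner_scaleR_left
        by (simp add: inner_commute[of "A _"] algebra_simps)
    qed
    also have "\<dots> = inverse R * ((\<Sum>i\<in>Basis. \<Sum>j\<in>Basis. (w \<bullet> j) * om i j w i) +
       (\<Sum>i\<in>Basis. \<Sum>j\<in>Basis. (lead_deriv J' M' w i j i - lead_deriv J' M' w i i j) * (w \<bullet> j)) + rest w)"
      by (simp only: sum.distrib sum_distrib_left[symmetric] rest_def)
    also have "(\<Sum>i\<in>Basis. \<Sum>j\<in>Basis. (lead_deriv J' M' w i j i - lead_deriv J' M' w i i j) * (w \<bullet> j)) =
       4 * inverse ((w \<bullet> w) * (w \<bullet> w)) * (J' w \<bullet> M' w)"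
      by (rule lead_flux[OF J'1 J'2 M'1 M'2 \<open>w \<noteq> 0\<close>]) simp
    also have "(w \<bullet> w) * (w \<bullet> w) = R ^ 4"
      unfolding power2_norm_eq_inner[symmetric] w by simp
    \<comment> \<open>Antisymmetry of \<omega> makes the sum half of its antisymmetrisation, whose
      terms are rotation derivatives.\<close>
    also have "(\<Sum>i\<in>Basis. \<Sum>j\<in>Basis. (w \<bullet> j) * om i j w i) = 1/2 * (\<Sum>i\<in>Basis. \<Sum>j\<in>Basis. rotm i j w)"
    proof -
      have "(\<Sum>i\<in>Basis. \<Sum>j\<in>Basis. (w \<bullet> i) * om i j w j) = (\<Sum>i\<in>Basis. \<Sum>j\<in>Basis. (w \<bullet> j) * om j i w i)"
        by (rule sum.swap)
      also have "\<dots> = - (\<Sum>i\<in>Basis. \<Sum>j\<in>Basis. (w \<bullet> j) * om i j w i)"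
        by (simp add: om_def sum_negf[symmetric] algebra_simps)
      finally show ?thesis by (simp add: rotm_def sum_subtractf)
    qed
    finally show ?thesis .
  qed
  have rot_meas: "sphere_measurable R (rotm i j)" and rot_int: "sphere_integral R (rotm i j) = 0"
    if R: "R > R1 + 1" and ij: "i \<in> Basis" "j \<in> Basis" for R i j
  proof -
    have R0: "R > 0" using R R1 by simp
    have der: "((\<lambda>w. DG w i \<bullet> A j - DG w j \<bullet> A i) has_derivative om i j w) (at w)" if "norm w > R1" for w
      unfolding om_def by (intro has_derivative_diff has_derivative_inner_left D2 that)
    define B where "B = 4 * (2 * (\<bar>C2\<bar> * R powr (-1-\<sigma>)))"
    have bd: "\<bar>om i j w v\<bar> \<le> B * norm v" if w: "norm w = R" for w v
    proof -
      have wR1: "norm w > R1" using w R by simp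
      have nA: "norm (A x) = norm x" for x by (rule orthogonal_transformation_norm[OF A])
      have n1: "norm (D2G w i l) \<le> \<bar>C2\<bar> * R powr (-1-\<sigma>)" if "i \<in> Basis" "l \<in> Basis" for i l
        using D2b[OF wR1 that] w by (meson abs_ge_self mult_right_mono order_trans powr_ge_zero)
      have "norm (om i j w v) \<le> real DIM(C2) * (2 * (\<bar>C2\<bar> * R powr (-1-\<sigma>))) * norm v"
      proof (rule norm_le_sum_Basis_bound)
        show "linear (om i j w)" using has_derivative_linear[OF der[OF wR1]] .
        fix l :: C2 assume l: "l \<in> Basis"
        have "\<bar>D2G w i l \<bullet> A j\<bar> \<le> \<bar>C2\<bar> * R powr (-1-\<sigma>)" "\<bar>D2G w j l \<bullet> A i\<bar> \<le> \<bar>C2\<bar> * R powr (-1-\<sigma>)"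
          using Cauchy_Schwarz_ineq2[of "D2G w i l" "A j"] Cauchy_Schwarz_ineq2[of "D2G w j l" "A i"]
            n1[OF ij(1) l] n1[OF ij(2) l] ij by (simp_all add: nA)
        then show "norm (om i j w l) \<le> 2 * (\<bar>C2\<bar> * R powr (-1-\<sigma>))" unfolding om_def real_norm_def by linarith
      qed
      then show ?thesis by (simp add: B_def)
    qed
    have m: "sphere_measurable R (\<lambda>w. om i j w l)" if "l \<in> Basis" for l
    proof (rule sphere_measurable_directional_derivative[OF _ R0 der])
      show "R > R1 + norm l" using R that by simp
      show "\<And>w. norm w = R \<Longrightarrow> \<bar>om i j w l\<bar> \<le> B" using bd[of _ l] that by simp
    qed
    show "sphere_measurable R (rotm i j)" unfolding rotm_def[abs_def]
      by (intro sphere_measurable_diff sphere_measurable_mult m ij sphere_measurable_continuous continuous_intros)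
    show "sphere_integral R (rotm i j) = 0"
    proof (cases "i = j")
      case True
      then have "rotm i j = (\<lambda>w. 0)" by (simp add: rotm_def om_def fun_eq_iff)
      then show ?thesis by (simp add: sphere_integral_zero)
    next
      case False
      have "R1 < R" using R by simp
      then show ?thesis unfolding rotm_def[abs_def]
        by (intro sphere_integral_rotation_derivative[OF ij False R0 der bd]) auto
    qed
  qed
  have rest_meas: "sphere_measurable R rest" and rest_bd: "\<And>w. norm w = R \<Longrightarrow> \<bar>rest w\<bar> \<le> 32 * C * R powr (-\<mu>)"
    if R: "R > R1 + 1" for R
  proof -
    have R0: "R > 0" "R > R1" using R R1 by auto
    have m: "sphere_measurable R (\<lambda>w. de i j w l)" if "i \<in> Basis" "j \<in> Basis" "l \<in> Basis" for i j l
    proof (rule sphere_measurable_directional_derivative[OF _ R0(1) e_der])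
      show "R > R1 + norm l" using R that by simp
      show "\<bar>de i j w l\<bar> \<le> C * R powr (-1-\<mu>)" if w: "norm w = R" for w
        using e_bd[of w i j l] R0 w \<open>i \<in> Basis\<close> \<open>j \<in> Basis\<close> \<open>l \<in> Basis\<close> by simp
    qed (use that in auto)
    show "sphere_measurable R rest" unfolding rest_def[abs_def]
      by (intro sphere_measurable_sum sphere_measurable_mult sphere_measurable_diff m sphere_measurable_continuous continuous_intros)
    fix w assume w: "norm (w::C2) = R"
    have wR1: "norm w > R1" using w R0 by simp
    have "\<bar>(de i j w i - de i i w j) * (w \<bullet> j)\<bar> \<le> 2 * (C * R powr (-\<mu>))" if ij: "i \<in> Basis" "j \<in> Basis" for i j
    proof -
      have "\<bar>de i j w i\<bar> \<le> C * R powr (-1-\<mu>)" "\<bar>de i i w j\<bar> \<le> C * R powr (-1-\<mu>)"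
        using e_bd[OF wR1 ij, of i] e_bd[OF wR1 ij(1) ij(1), of j] w ij by simp_all
      then have "\<bar>de i j w i - de i i w j\<bar> \<le> 2 * (C * R powr (-1-\<mu>))" by linarith
      moreover have "\<bar>w \<bullet> j\<bar> \<le> R powr 1" using Basis_le_norm[OF ij(2), of w] w R0 by simp
      ultimately have "\<bar>de i j w i - de i i w j\<bar> * \<bar>w \<bullet> j\<bar> \<le> 2 * (C * R powr (-1-\<mu>)) * R powr 1"
        by (intro mult_mono) auto
      also have "\<dots> = 2 * (C * (R powr (-1-\<mu>) * R powr 1))" by simp
      also have "R powr (-1-\<mu>) * R powr 1 = R powr (-\<mu>)" by (simp only: powr_add[symmetric]) simp
      finally show ?thesis by (simp add: abs_mult)
    qed
    then have "(\<Sum>i\<in>Basis. \<Sum>j\<in>Basis. \<bar>(de i j w i - de i i w j) * (w \<bullet> j)\<bar>) \<le>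
        (\<Sum>i\<in>(Basis::C2 set). \<Sum>j\<in>(Basis::C2 set). 2 * (C * R powr (-\<mu>)))" by (intro sum_mono)
    \<comment> \<open>16 pairs of basis vectors, each contributing at most twice C R^-\<mu>.\<close>
    also have "\<dots> = 32 * C * R powr (-\<mu>)" by simp
    finally show "\<bar>rest w\<bar> \<le> 32 * C * R powr (-\<mu>)"
      unfolding rest_def by (intro order_trans[OF order_trans[OF sum_abs sum_mono[OF sum_abs]]])
  qed
  have int: "sphere_integral R (mass_flux H) = 2 * pi\<^sup>2 * S + inverse R * sphere_integral R rest" if R: "R > R1 + 1" for R
  proof -
    have R0: "R > 0" "R > R1" using R R1 by auto
    let ?rot = "\<lambda>w. \<Sum>i\<in>Basis. \<Sum>j\<in>Basis. rotm i j w"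
    let ?Q = "\<lambda>w. J' w \<bullet> M' w"
    have Qm: "sphere_measurable R ?Q"
      by (intro sphere_measurable_continuous continuous_intros linear_continuous_on)
         (use J'1 M'1 linear_conv_bounded_linear in auto)
    have rm: "sphere_measurable R ?rot"
      by (intro sphere_measurable_sum rot_meas[OF R])
    have rot0: "sphere_integral R ?rot = 0"
    proof -
      have "sphere_integral R ?rot = (\<Sum>i\<in>Basis. sphere_integral R (\<lambda>w. \<Sum>j\<in>Basis. rotm i j w))"
        by (rule sphere_integral_sum[OF _ R0(1)]) (intro sphere_measurable_sum rot_meas[OF R])
      also have "\<dots> = (\<Sum>i\<in>Basis. \<Sum>j\<in>Basis. sphere_integral R (rotm i j))"
        by (intro sum.cong refl sphere_integral_sum[OF _ R0(1)] rot_meas[OF R])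
      finally show ?thesis by (simp add: rot_int[OF R])
    qed
    have m1: "sphere_measurable R (\<lambda>w. 1/2 * ?rot w + 4 * inverse (R ^ 4) * ?Q w)"
      by (intro sphere_measurable_add sphere_measurable_cmult rm Qm)
    have m: "sphere_measurable R (\<lambda>w. inverse R * (1/2 * ?rot w + 4 * inverse (R ^ 4) * ?Q w + rest w))"
      by (intro sphere_measurable_cmult sphere_measurable_add[OF m1 rest_meas[OF R]])
    have "sphere_integral R (mass_flux H) = sphere_integral R (\<lambda>w. inverse R * (1/2 * ?rot w + 4 * inverse (R ^ 4) * ?Q w + rest w))"
      by (rule sphere_integral_cong(2)[OF _ m R0(1)]) (use flux R0 in simp)
    also have "\<dots> = inverse R * (1/2 * sphere_integral R ?rot + 4 * inverse (R ^ 4) * sphere_integral R ?Q + sphere_integral R rest)"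
      unfolding sphere_integral_cmult sphere_integral_add[OF m1 rest_meas[OF R] R0(1)]
        sphere_integral_add[OF sphere_measurable_cmult[OF rm] sphere_measurable_cmult[OF Qm] R0(1)] by (rule refl)
    also have "sphere_integral R ?rot = 0"
      by (rule rot0)
    also have "sphere_integral R ?Q = pi\<^sup>2 * R ^ 5 / 2 * S"
      using sphere_integral_inner_linear[OF R0(1) J'1 M'1] trace by simp
    \<comment> \<open>The powers of R cancel: the leading term has a flux independent of the
      radius.\<close>
    also have "inverse R * (1/2 * 0 + 4 * inverse (R ^ 4) * (pi\<^sup>2 * R ^ 5 / 2 * S) + sphere_integral R rest) =
        2 * pi\<^sup>2 * S + inverse R * sphere_integral R rest"
      using R0 by (simp add: field_simps power_numeral_reduce)
    finally show ?thesis .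
  qed
  have "((\<lambda>R. inverse R * sphere_integral R rest) \<longlongrightarrow> 0) at_top"
  proof (rule Lim_null_comparison)
    \<comment> \<open>Sphere volume of order R^3, the bound R^-\<mu> and the factor 1/R combine to
      R^-(\<mu>-2).\<close>
    show "\<forall>\<^sub>F R in at_top. norm (inverse R * sphere_integral R rest) \<le> 64 * pi\<^sup>2 * C * R powr (-(\<mu>-2))"
      using eventually_gt_at_top[of "R1 + 1"]
    proof eventually_elim
      case (elim R)
      have R0: "R > 0" using elim R1 by simp
      have "\<bar>sphere_integral R rest\<bar> \<le> 2 * pi\<^sup>2 * R ^ 3 * (32 * C * R powr (-\<mu>))"
        by (rule sphere_integral_bound[OF rest_meas[OF elim] R0 rest_bd[OF elim]])
      then have "inverse R * \<bar>sphere_integral R rest\<bar> \<le> inverse R * (2 * pi\<^sup>2 * R ^ 3 * (32 * C * R powr (-\<mu>)))"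
        using R0 by (intro mult_left_mono) auto
      also have "\<dots> = 64 * pi\<^sup>2 * C * (R powr 2 * R powr (-\<mu>))"
        using R0 by (simp add: field_simps power_numeral_reduce powr_numeral)
      also have "R powr 2 * R powr (-\<mu>) = R powr (-(\<mu>-2))" by (simp only: powr_add[symmetric]) simp
      finally show ?case using R0 by (simp add: abs_mult)
    qed
    have "((\<lambda>R. 64 * pi\<^sup>2 * C * R powr (-(\<mu>-2))) \<longlongrightarrow> 64 * pi\<^sup>2 * C * 0) at_top"
      using \<mu> by (intro tendsto_mult tendsto_const tendsto_neg_powr filterlim_ident) auto
    then show "((\<lambda>R. 64 * pi\<^sup>2 * C * R powr (-(\<mu>-2))) \<longlongrightarrow> 0) at_top" by simp
  qed
  then have "((\<lambda>R. 1 / (4 * pi\<^sup>2) * (2 * pi\<^sup>2 * S + inverse R * sphere_integral R rest)) \<longlongrightarrow> 1 / (4 * pi\<^sup>2) * (2 * pi\<^sup>2 * S + 0)) at_top"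
    by (intro tendsto_intros)
  moreover have "\<forall>\<^sub>F R in at_top. 1 / (4 * pi\<^sup>2) * (2 * pi\<^sup>2 * S + inverse R * sphere_integral R rest) =
      1 / (4 * pi\<^sup>2) * sphere_integral R (mass_flux H)"
    using eventually_gt_at_top[of "R1 + 1"] by eventually_elim (simp add: int)
  ultimately have "((\<lambda>R. 1 / (4 * pi\<^sup>2) * sphere_integral R (mass_flux H)) \<longlongrightarrow> 1 / (4 * pi\<^sup>2) * (2 * pi\<^sup>2 * S + 0)) at_top"
    by (rule Lim_transform_eventually)
  then show ?thesis unfolding has_mass_def S_def[symmetric] by (simp add: field_simps)
qed

section \<open>The Calderbank--Singer metric in the flat chart\<close>

text \<open>Smoothness across z_1 = 0 requires the coefficient of d\<phi>_1^2, after removal of its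
  conformal part, to have an extra factor s. It is extracted with s + c = 1 and the fact that T1 - 1
  is itself divisible by s.\<close>

lemma gram_identity_1:
  fixes s c \<rho> E1 E2 P Q T1 T2 :: real
  assumes "s + c = 1" "T1 = 1 + 2 * \<rho> * (\<rho> * s) * E1"
  shows "c * P\<^sup>2 + s * T2\<^sup>2 = (s * T2 * Q + c * T1 * P)\<^sup>2 +
    s * (c * (P\<^sup>2 * (1 - 4 * \<rho> * (\<rho> * c) * E1 * (1 + \<rho> * (\<rho> * s) * E1)) - 2 * T1 * T2 * P * Q + 1) + (T2\<^sup>2 - 1) + s * (1 - T2\<^sup>2 * Q\<^sup>2))"
proof -
  have c: "c = 1 - s" using assms(1) by simp
  show ?thesis unfolding assms(2) c by algebra
qed

lemma gram_identity_2:
  fixes s c \<rho> E1 E2 P Q T1 T2 :: real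
  assumes "s + c = 1" "T2 = 1 - 2 * \<rho> * (\<rho> * c) * E2"
  shows "s * Q\<^sup>2 + c * T1\<^sup>2 = (s * T2 * Q + c * T1 * P)\<^sup>2 +
    c * (s * (Q\<^sup>2 * (1 + 4 * \<rho> * (\<rho> * s) * E2 * (1 - \<rho> * (\<rho> * c) * E2)) - 2 * T1 * T2 * P * Q + 1) + (T1\<^sup>2 - 1) + c * (1 - T1\<^sup>2 * P\<^sup>2))"
proof -
  have s: "s = 1 - c" using assms(1) by simp
  show ?thesis unfolding assms(2) s by algebra
qed

text \<open>The metric in the coordinates \<open>(\<alpha>, \<phi>\<^sub>1, \<beta>, \<phi>\<^sub>2)\<close>, where \<open>\<alpha> = |z\<^sub>1|\<close>, \<open>\<beta> = |z\<^sub>2|\<close>, \<open>s = sin\<^sup>2\<theta>\<close>,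
  \<open>c = cos\<^sup>2\<theta>\<close>; the differences from the flat metric in the coefficients of \<open>d\<phi>\<^sub>1\<^sup>2\<close> and \<open>d\<phi>\<^sub>2\<^sup>2\<close> are
  written with the factors \<open>s\<^sup>2\<close> and \<open>c\<^sup>2\<close> that make them smooth across the axes.\<close>

lemma metric_identity:
  fixes \<alpha> \<beta> q :: real
  assumes pos: "\<alpha> > 0" "\<beta> > 0" "q > 0"
    and n: "n = \<alpha>\<^sup>2 + \<beta>\<^sup>2" and s: "s = \<alpha>\<^sup>2 / n" and c: "c = \<beta>\<^sup>2 / n"
    and T1: "T1 = 1 + 2 * (1/n) * ((1/n) * s) * E1" and T2: "T2 = 1 - 2 * (1/n) * ((1/n) * c) * E2"
    and D: "D = s * T2 * Q + c * T1 * P" "D > 0"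
    and A11: "A11 = (c * (P\<^sup>2 * (1 - 4 * (1/n) * ((1/n) * c) * E1 * (1 + (1/n) * ((1/n) * s) * E1)) - 2 * T1 * T2 * P * Q + 1) + (T2\<^sup>2 - 1) + s * (1 - T2\<^sup>2 * Q\<^sup>2)) / D"
    and A22: "A22 = (s * (Q\<^sup>2 * (1 + 4 * (1/n) * ((1/n) * s) * E2 * (1 - (1/n) * ((1/n) * c) * E2)) - 2 * T1 * T2 * P * Q + 1) + (T1\<^sup>2 - 1) + c * (1 - T1\<^sup>2 * P\<^sup>2)) / D"
    and A12: "A12 = (T1 * T2 - P * Q) / D"
    and x: "x = 2 * \<alpha> * \<beta> / n\<^sup>2" and xy: "xy = 1 / n\<^sup>2"
    and dt: "dt = q * (\<alpha> * \<beta> / n) * D"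
    and B1: "B1 = - q * (\<alpha> * \<beta> / n) * (Q * f2 - P * f1)" and B1': "B1' = - q * (\<alpha> * \<beta> / n) * (Q * g2 - P * g1)"
    and B2: "B2 = - q * (c * T1 * f2 + s * T2 * f1)" and B2': "B2' = - q * (c * T1 * g2 + s * T2 * g1)"
  shows "x * dt / (2 * xy) * (4 * d / n ^ 3 / x\<^sup>2 + (B1 * B1' + B2 * B2') / dt\<^sup>2) =
    q * (D * (d + \<alpha>\<^sup>2 * f1 * g1 + \<beta>\<^sup>2 * f2 * g2) + 1/n * (A11 * (\<alpha>\<^sup>2 * f1) * (\<alpha>\<^sup>2 * g1) +
       A12 * ((\<alpha>\<^sup>2 * f1) * (\<beta>\<^sup>2 * g2) + (\<beta>\<^sup>2 * f2) * (\<alpha>\<^sup>2 * g1)) + A22 * (\<beta>\<^sup>2 * f2) * (\<beta>\<^sup>2 * g2)))"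
proof -
  have n0: "n > 0" using pos by (simp add: n add_pos_pos)
  have sc: "s + c = 1" using n0 pos by (simp add: s c n add_divide_distrib[symmetric])
  have as: "\<alpha>\<^sup>2 = n * s" "\<beta>\<^sup>2 = n * c" using n0 pos by (simp_all add: s c)
  have "(\<alpha> * \<beta> / n)\<^sup>2 = \<alpha>\<^sup>2 * \<beta>\<^sup>2 / n\<^sup>2" by (simp only: power_divide power_mult_distrib)
  also have "\<dots> = s * c" unfolding as using n0 by (simp add: power2_eq_square)
  finally have ab: "(\<alpha> * \<beta> / n)\<^sup>2 = s * c" .
  \<comment> \<open>k = sin \<theta> cos \<theta>, so k^2 = s c and only rational expressions in s
    and c remain.\<close>
  define k where "k = \<alpha> * \<beta> / n"
  have k0: "k > 0" using pos n0 by (simp add: k_def)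
  have k2: "k\<^sup>2 = s * c" using ab by (simp add: k_def)
  have xk: "x = 2 * k / n" using n0 by (simp add: x k_def power2_eq_square)
  have pre: "x * dt / (2 * xy) = q * n * k\<^sup>2 * D"
    unfolding xk dt xy k_def[symmetric] using n0 by (simp add: power2_eq_square field_simps)
  have first: "q * n * k\<^sup>2 * D * (4 * d / n ^ 3 / x\<^sup>2) = q * D * d"
    unfolding xk using n0 k0 by (simp add: power2_eq_square power3_eq_cube field_simps)
  have dt2: "dt\<^sup>2 = q\<^sup>2 * k\<^sup>2 * D\<^sup>2" unfolding dt k_def[symmetric] by (simp add: power_mult_distrib)
  have BB: "B1 * B1' + B2 * B2' = q\<^sup>2 * (s * c * (Q * f2 - P * f1) * (Q * g2 - P * g1) + (c * T1 * f2 + s * T2 * f1) * (c * T1 * g2 + s * T2 * g1))"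
    unfolding B1 B1' B2 B2' k_def[symmetric] k2[symmetric] by algebra
  have "q * n * k\<^sup>2 * D * ((B1 * B1' + B2 * B2') / dt\<^sup>2) = q * n * ((s * c * (Q * f2 - P * f1) * (Q * g2 - P * g1) + (c * T1 * f2 + s * T2 * f1) * (c * T1 * g2 + s * T2 * g1)) / D)"
    unfolding BB dt2 using D(2) k0 pos by (simp add: power2_eq_square)
  also have "(s * c * (Q * f2 - P * f1) * (Q * g2 - P * g1) + (c * T1 * f2 + s * T2 * f1) * (c * T1 * g2 + s * T2 * g1)) =
     s * (c * P\<^sup>2 + s * T2\<^sup>2) * (f1 * g1) + c * (s * Q\<^sup>2 + c * T1\<^sup>2) * (f2 * g2) + s * c * (T1 * T2 - P * Q) * (f1 * g2 + f2 * g1)"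
    by algebra
  also have "\<dots> = s * (D\<^sup>2 + s * (A11 * D)) * (f1 * g1) + c * (D\<^sup>2 + c * (A22 * D)) * (f2 * g2) + s * c * (A12 * D) * (f1 * g2 + f2 * g1)"
    using gram_identity_1[OF sc T1, of P T2 Q] gram_identity_2[OF sc T2, of Q T1 P] D(2)
    by (simp add: A11 A12 A22 D(1)[symmetric])
  also have "\<dots> / D = D * (s * f1 * g1 + c * f2 * g2) + (s * s * A11 * f1 * g1 + c * c * A22 * f2 * g2 + s * c * A12 * (f1 * g2 + f2 * g1))"
    using D(2) by (simp add: field_simps power2_eq_square)
  finally have second: "q * n * k\<^sup>2 * D * ((B1 * B1' + B2 * B2') / dt\<^sup>2) =
     q * n * (D * (s * f1 * g1 + c * f2 * g2) + (s * s * A11 * f1 * g1 + c * c * A22 * f2 * g2 + s * c * A12 * (f1 * g2 + f2 * g1)))" .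
  show ?thesis unfolding pre distrib_left[of "q * n * k\<^sup>2 * D"] first second as
    using n0 by (simp add: field_simps)
qed

text \<open>Splitting into radial and angular parts. The second identity shows that |z|^2 d\<phi> is
  smooth at z = 0, unlike d\<phi>.\<close>

lemma polar_inner:
  fixes z u u' :: complex
  assumes "z \<noteq> 0"
  shows "(u \<bullet> sgn z) * (u' \<bullet> sgn z) + (cmod z)\<^sup>2 * Im (u / z) * Im (u' / z) = u \<bullet> u'"
    and "(cmod z)\<^sup>2 * Im (u / z) = Im (cnj z * u)"
proof -
  have mult: "(t * z) \<bullet> (t' * z) = (cmod z)\<^sup>2 * (Re t * Re t' + Im t * Im t')" for t t'
    by (simp add: inner_complex_def cmod_power2) algebra
  have r: "(t * z) \<bullet> sgn z = cmod z * Re t" for t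
    using mult[of t 1] assms by (simp add: sgn_div_norm power2_eq_square)
  define t t' where t: "t = u / z" "t' = u' / z"
  have u: "u = t * z" "u' = t' * z" using assms by (simp_all add: t)
  show "(u \<bullet> sgn z) * (u' \<bullet> sgn z) + (cmod z)\<^sup>2 * Im (u / z) * Im (u' / z) = u \<bullet> u'"
    unfolding u mult r using assms by (simp add: power2_eq_square algebra_simps)
  show "(cmod z)\<^sup>2 * Im (u / z) = Im (cnj z * u)"
    unfolding u cmod_power2 using assms by (simp add: power2_eq_square algebra_simps)
qed

lemma norm_C2_power4: "norm (z::C2) ^ 4 = ((cmod (fst z))\<^sup>2 + (cmod (snd z))\<^sup>2)\<^sup>2"
proof -
  have "(norm z)\<^sup>2 = (cmod (fst z))\<^sup>2 + (cmod (snd z))\<^sup>2" by (simp add: norm_prod_def)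
  then show ?thesis by (metis numeral_Bit0 numeral_One power_add power2_eq_square mult_2 power_mult numeral_times_numeral)
qed

text \<open>With \<alpha> = |z_1| and \<beta> = |z_2| one has y + i x = (\<beta> - i \<alpha>)^-2,
  so the map is conformal in (\<alpha>, \<beta>). This explains the shape of the matrix of X and Y,
  and later X^2 + Y^2 = 4 / n^3.\<close>

lemma end_xy_has_derivative:
  assumes z: "z \<in> off_axes"
  defines "\<alpha> \<equiv> cmod (fst z)" and "\<beta> \<equiv> cmod (snd z)"
  defines "n \<equiv> \<alpha>\<^sup>2 + \<beta>\<^sup>2"
  defines "X \<equiv> 2 * \<beta> * (\<beta>\<^sup>2 - 3 * \<alpha>\<^sup>2) / n ^ 3" and "Y \<equiv> 2 * \<alpha> * (\<alpha>\<^sup>2 - 3 * \<beta>\<^sup>2) / n ^ 3"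
  shows "(end_xy has_derivative (\<lambda>u. (X * (fst u \<bullet> sgn (fst z)) + Y * (snd u \<bullet> sgn (snd z)),
     Y * (fst u \<bullet> sgn (fst z)) - X * (snd u \<bullet> sgn (snd z))))) (at z)"
proof -
  have nz: "fst z \<noteq> 0" "snd z \<noteq> 0" using z by (auto simp: off_axes_def)
  have ab: "\<alpha> > 0" "\<beta> > 0" using nz by (simp_all add: \<alpha>_def \<beta>_def)
  have n: "n > 0" using ab by (simp add: n_def add_pos_pos)
  let ?da = "\<lambda>u::C2. fst u \<bullet> sgn (fst z)" and ?db = "\<lambda>u::C2. snd u \<bullet> sgn (snd z)"
  have da: "((\<lambda>z::C2. cmod (fst z)) has_derivative ?da) (at z)"
    by (rule has_derivative_compose[OF has_derivative_fst[OF has_derivative_ident] has_derivative_norm[OF nz(1)]])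
  have db: "((\<lambda>z::C2. cmod (snd z)) has_derivative ?db) (at z)"
    by (rule has_derivative_compose[OF has_derivative_snd[OF has_derivative_ident] has_derivative_norm[OF nz(2)]])
  have da2: "((\<lambda>z::C2. (cmod (fst z))\<^sup>2) has_derivative (\<lambda>u. 2 * \<alpha> * ?da u)) (at z)"
    by (rule has_derivative_eq_rhs[OF has_derivative_power[OF da]]) (simp add: \<alpha>_def mult_ac)
  have db2: "((\<lambda>z::C2. (cmod (snd z))\<^sup>2) has_derivative (\<lambda>u. 2 * \<beta> * ?db u)) (at z)"
    by (rule has_derivative_eq_rhs[OF has_derivative_power[OF db]]) (simp add: \<beta>_def mult_ac)
  have dn: "((\<lambda>z::C2. (cmod (fst z))\<^sup>2 + (cmod (snd z))\<^sup>2) has_derivative (\<lambda>u. 2 * \<alpha> * ?da u + 2 * \<beta> * ?db u)) (at z)"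
    by (rule has_derivative_add[OF da2 db2])
  have "((\<lambda>z::C2. ((cmod (fst z))\<^sup>2 + (cmod (snd z))\<^sup>2)\<^sup>2) has_derivative (\<lambda>u. 2 * n * (2 * \<alpha> * ?da u + 2 * \<beta> * ?db u))) (at z)"
    by (rule has_derivative_eq_rhs[OF has_derivative_power[OF dn]]) (simp add: n_def \<alpha>_def \<beta>_def fun_eq_iff algebra_simps)
  from Deriv.has_derivative_inverse[OF _ this]
  have di: "((\<lambda>z::C2. inverse (((cmod (fst z))\<^sup>2 + (cmod (snd z))\<^sup>2)\<^sup>2)) has_derivative
      (\<lambda>u. - 4 / n ^ 3 * (\<alpha> * ?da u + \<beta> * ?db u))) (at z)"
    by (rule has_derivative_eq_rhs)
       (unfold \<alpha>_def[symmetric] \<beta>_def[symmetric] n_def[symmetric], use n in \<open>simp_all add: fun_eq_iff field_simps power2_eq_square power3_eq_cube\<close>)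
  have inv4: "- 4 / n ^ 3 = - 4 * inverse (n ^ 3)" "inverse (n\<^sup>2) = n * inverse (n ^ 3)"
    using n by (simp_all add: field_simps power2_eq_square power3_eq_cube)
  have fx: "((\<lambda>z::C2. 2 * (cmod (fst z) * cmod (snd z)) * inverse (((cmod (fst z))\<^sup>2 + (cmod (snd z))\<^sup>2)\<^sup>2)) has_derivative
      (\<lambda>u. X * ?da u + Y * ?db u)) (at z)"
    by (rule has_derivative_eq_rhs[OF has_derivative_mult[OF has_derivative_mult_right[OF has_derivative_mult[OF da db]] di]])
       (unfold \<alpha>_def[symmetric] \<beta>_def[symmetric] n_def[symmetric], unfold X_def Y_def inv4 divide_inverse,
        rule ext, unfold n_def, algebra)
  have fy: "((\<lambda>z::C2. ((cmod (snd z))\<^sup>2 - (cmod (fst z))\<^sup>2) * inverse (((cmod (fst z))\<^sup>2 + (cmod (snd z))\<^sup>2)\<^sup>2)) has_derivative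
      (\<lambda>u. Y * ?da u - X * ?db u)) (at z)"
    by (rule has_derivative_eq_rhs[OF has_derivative_mult[OF has_derivative_diff[OF db2 da2] di]])
       (unfold \<alpha>_def[symmetric] \<beta>_def[symmetric] n_def[symmetric], unfold X_def Y_def inv4 divide_inverse,
        rule ext, unfold n_def, algebra)
  have "end_xy = (\<lambda>z. (2 * (cmod (fst z) * cmod (snd z)) * inverse (((cmod (fst z))\<^sup>2 + (cmod (snd z))\<^sup>2)\<^sup>2),
      ((cmod (snd z))\<^sup>2 - (cmod (fst z))\<^sup>2) * inverse (((cmod (fst z))\<^sup>2 + (cmod (snd z))\<^sup>2)\<^sup>2)))"
    by (rule ext) (simp only: end_xy_def norm_C2_power4 divide_inverse mult.assoc)
  then show ?thesis using has_derivative_Pair[OF fx fy] by simp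
qed

section \<open>The metric through coefficients smooth across the axes\<close>

locale calderbank_singer = hirzebruch_jung +
  fixes ys :: "nat \<Rightarrow> ereal"
  assumes points: "cs_points es ys"
begin

abbreviation "k \<equiv> length es"

definition Y :: "nat \<Rightarrow> real" where "Y j = real_of_ereal (ys j)"

lemma ys_last: "ys (Suc k) = 0" and ys_dec: "j \<le> k \<Longrightarrow> ys (Suc j) < ys j"
  using points by (auto simp: cs_points_def)

lemma ys_pos: "j \<le> k \<Longrightarrow> 0 < ys j"
proof (induction rule: inc_induct)
  case base
  show ?case using ys_dec[of k] by (simp add: ys_last)
next
  case (step j)
  then show ?case using ys_dec[of j] by (meson less_imp_le_nat less_trans)
qed

lemma Y_pos: "j \<le> k \<Longrightarrow> ys j \<noteq> \<infinity> \<Longrightarrow> 0 < Y j"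
  using ys_pos[of j] by (cases "ys j") (auto simp: Y_def)

lemma ys_finite: "Suc j \<le> k \<Longrightarrow> ys (Suc j) \<noteq> \<infinity>"
  using ys_dec[of j] by auto

text \<open>The coordinates of (a_j, b_j) in the basis (q, p), (0, -1) of the two circle directions
  that collapse at the end.\<close>

definition al :: "nat \<Rightarrow> real" where "al j = (hj_m es j - hj_m es (Suc j)) / q"
definition be :: "nat \<Rightarrow> real" where "be j = p * al j - (hj_n es j - hj_n es (Suc j))"

abbreviation "e1 \<equiv> hj_vec es (Suc k)"
abbreviation "e2 \<equiv> hj_vec es 0"

lemma q_pos: "0 < real q" using p pq by simp

lemma hj_vec_eq: "j \<le> Suc k \<Longrightarrow> hj_vec es j = (hj_m es j, hj_n es j)"
  by (simp add: hj_vec_def hj_dir_eq[OF two_le])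

lemma e1_eq: "e1 = (real q, real p)" and e2_eq: "e2 = (0, -1)"
  using hj_vec_eq[of "Suc k"] last_dir by (auto simp: hj_vec_def hj_dir_def)

lemma cs_ab_eq: "j \<le> k \<Longrightarrow> cs_ab es j = al j *\<^sub>R e1 + be j *\<^sub>R e2"
  using q_pos unfolding cs_ab_def e1_eq e2_eq by (simp add: hj_vec_eq al_def be_def field_simps)

text \<open>The direction of index k + 2 is (0, 1) = - e2. As y_(k+1) = 0, this term dominates v_1
  near the deleted point.\<close>

lemma cs_ab_last: "cs_ab es (Suc k) = e1 + e2"
  unfolding cs_ab_def e1_eq e2_eq by (simp add: hj_vec_def hj_dir_def[of es "Suc (Suc k)"] e1_eq[unfolded hj_vec_def])

text \<open>The differences telescope to e2 - e1. With the last term this gives v_2 = cos^2 \<theta>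
  e1 - sin^2 \<theta> e2 to leading order, as for the flat metric.\<close>

lemma sum_al: "(\<Sum>j\<le>k. al j) = -1" and sum_be: "(\<Sum>j\<le>k. be j) = 1"
proof -
  have tele: "(\<Sum>j\<le>n. real_of_int (f j - f (Suc j))) = f 0 - f (Suc n)" for f :: "nat \<Rightarrow> int" and n
    by (induction n) auto
  have "(\<Sum>j\<le>k. al j) = (\<Sum>j\<le>k. real_of_int (hj_m es j - hj_m es (Suc j))) / q"
    by (simp add: al_def sum_divide_distrib)
  then show al: "(\<Sum>j\<le>k. al j) = -1" unfolding tele using q_pos by (simp add: last_dir)
  have "(\<Sum>j\<le>k. be j) = p * (\<Sum>j\<le>k. al j) - (\<Sum>j\<le>k. real_of_int (hj_n es j - hj_n es (Suc j)))"
    by (simp add: be_def sum_subtractf sum_distrib_left)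
  then show "(\<Sum>j\<le>k. be j) = 1" unfolding tele al by (simp add: last_dir)
qed

lemma al_be: "al j + be j = (level j - level (Suc j)) / q"
  using q_pos by (simp add: al_def be_def level_def field_simps)

text \<open>In the coordinates of \<^const>\<open>end_xy\<close>, \<open>rr = r\<^sup>-\<^sup>2\<close>, \<open>ss = sin\<^sup>2\<theta>\<close>, \<open>cc = cos\<^sup>2\<theta>\<close>, \<open>dd j\<close> is the distance
  from \<open>(x, y)\<close> to \<open>(0, y\<^sub>j)\<close>, and \<open>1 + (y - y\<^sub>j) / dd j = x\<^sup>2 et j\<close>. Then \<open>v\<^sub>1 = sin \<theta> cos \<theta> (QQ e1 + PP e2)\<close> and
  \<open>v\<^sub>2 = cc T1 e1 - ss T2 e2\<close>, and the lifted metric is \<open>q (|dz|\<^sup>2 + hh)\<close>, in terms of \<open>sg1 = |z\<^sub>1|\<^sup>2 d\<phi>\<^sub>1\<close>,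
  \<open>sg2 = |z\<^sub>2|\<^sup>2 d\<phi>\<^sub>2\<close>. All these functions are smooth across the axes.\<close>

definition rr :: "C2 \<Rightarrow> real" where "rr z = inverse (z \<bullet> z)"
definition ss :: "C2 \<Rightarrow> real" where "ss z = (cmod (fst z))\<^sup>2 * rr z"
definition cc :: "C2 \<Rightarrow> real" where "cc z = (cmod (snd z))\<^sup>2 * rr z"
definition dd :: "nat \<Rightarrow> C2 \<Rightarrow> real" where
  "dd j z = sqrt (4 * (rr z * ss z) * (rr z * cc z) + (rr z * cc z - rr z * ss z - Y j)\<^sup>2)"
definition et :: "nat \<Rightarrow> C2 \<Rightarrow> real" where
  "et j z = inverse (dd j z) * inverse (dd j z + (Y j - (rr z * cc z - rr z * ss z)))"
definition WW :: "(nat \<Rightarrow> real) \<Rightarrow> C2 \<Rightarrow> real" where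
  "WW f z = (\<Sum>j\<le>k. if ys j = \<infinity> then 0 else f j * inverse (dd j z))"
definition EE :: "(nat \<Rightarrow> real) \<Rightarrow> C2 \<Rightarrow> real" where
  "EE f z = (\<Sum>j\<le>k. if ys j = \<infinity> then 0 else f j * et j z)"
definition PP :: "C2 \<Rightarrow> real" where "PP z = 1 + rr z * WW be z"
definition QQ :: "C2 \<Rightarrow> real" where "QQ z = 1 + rr z * WW al z"
definition T1 :: "C2 \<Rightarrow> real" where "T1 z = 1 + 2 * rr z * (rr z * ss z) * EE al z"
definition T2 :: "C2 \<Rightarrow> real" where "T2 z = 1 - 2 * rr z * (rr z * cc z) * EE be z"
definition DD :: "C2 \<Rightarrow> real" where "DD z = ss z * T2 z * QQ z + cc z * T1 z * PP z"
definition A11 :: "C2 \<Rightarrow> real" where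
  "A11 z = (cc z * ((PP z)\<^sup>2 * (1 - 4 * rr z * (rr z * cc z) * EE al z * (1 + rr z * (rr z * ss z) * EE al z)) -
     2 * T1 z * T2 z * PP z * QQ z + 1) + ((T2 z)\<^sup>2 - 1) + ss z * (1 - (T2 z)\<^sup>2 * (QQ z)\<^sup>2)) / DD z"
definition A22 :: "C2 \<Rightarrow> real" where
  "A22 z = (ss z * ((QQ z)\<^sup>2 * (1 + 4 * rr z * (rr z * ss z) * EE be z * (1 - rr z * (rr z * cc z) * EE be z)) -
     2 * T1 z * T2 z * PP z * QQ z + 1) + ((T1 z)\<^sup>2 - 1) + cc z * (1 - (T1 z)\<^sup>2 * (PP z)\<^sup>2)) / DD z"
definition A12 :: "C2 \<Rightarrow> real" where "A12 z = (T1 z * T2 z - PP z * QQ z) / DD z"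
definition sg1 :: "C2 \<Rightarrow> C2 \<Rightarrow> real" where "sg1 z u = Im (cnj (fst z) * fst u)"
definition sg2 :: "C2 \<Rightarrow> C2 \<Rightarrow> real" where "sg2 z u = Im (cnj (snd z) * snd u)"
definition hh :: "C2 \<Rightarrow> C2 \<Rightarrow> C2 \<Rightarrow> real" where
  "hh z u v = (DD z - 1) * (u \<bullet> v) + rr z * (A11 z * sg1 z u * sg1 z v +
     A12 z * (sg1 z u * sg2 z v + sg2 z u * sg1 z v) + A22 z * sg2 z u * sg2 z v)"

lemma inner_self_C2: "z \<bullet> z = (cmod (fst z))\<^sup>2 + (cmod (snd z))\<^sup>2" for z :: C2
  by (simp add: inner_prod_def power2_norm_eq_inner)

lemma det2_comb: "det2 (a *\<^sub>R e1 + b *\<^sub>R e2) (c *\<^sub>R e1 + d *\<^sub>R e2) = - real q * (a * d - b * c)"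
  unfolding e1_eq e2_eq det2_def by (simp add: algebra_simps)

lemma cs_metric_off_axes:
  assumes z: "z \<in> off_axes" and D: "DD z > 0"
    and dd: "\<And>j. j \<le> k \<Longrightarrow> ys j \<noteq> \<infinity> \<Longrightarrow> dd j z > 0 \<and> dd j z + (Y j - (rr z * cc z - rr z * ss z)) > 0"
  shows "cs_metric es ys (end_xy z) (end_push es z u) (end_push es z v) = q * (u \<bullet> v + hh z u v)"
proof -
  define \<alpha> \<beta> where "\<alpha> = cmod (fst z)" "\<beta> = cmod (snd z)"
  define n where "n = \<alpha>\<^sup>2 + \<beta>\<^sup>2"
  have nz: "fst z \<noteq> 0" "snd z \<noteq> 0" using z by (auto simp: off_axes_def)
  have pos: "\<alpha> > 0" "\<beta> > 0" using nz by (simp_all add: \<alpha>_\<beta>_def)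
  have n: "n > 0" using pos by (simp add: n_def add_pos_pos)
  have rr: "rr z = 1 / n" by (simp add: rr_def inner_self_C2 n_def \<alpha>_\<beta>_def inverse_eq_divide)
  have ss: "ss z = \<alpha>\<^sup>2 / n" and cc: "cc z = \<beta>\<^sup>2 / n" by (simp_all add: ss_def cc_def rr \<alpha>_\<beta>_def)
  define x y where "x = 2 * \<alpha> * \<beta> / n\<^sup>2" "y = (\<beta>\<^sup>2 - \<alpha>\<^sup>2) / n\<^sup>2"
  have n4: "norm z ^ 4 = n\<^sup>2" by (simp add: norm_C2_power4 n_def \<alpha>_\<beta>_def)
  have xy: "end_xy z = (x, y)" by (simp add: end_xy_def n4 x_y_def \<alpha>_\<beta>_def)
  have y_eq: "y = rr z * cc z - rr z * ss z" by (simp add: x_y_def rr ss cc power2_eq_square diff_divide_distrib)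
  have x2: "x\<^sup>2 = 4 * (rr z * ss z) * (rr z * cc z)"
    by (simp add: x_y_def rr ss cc power2_eq_square)
  have x2y2: "x\<^sup>2 + y\<^sup>2 = 1 / n\<^sup>2"
  proof -
    have "x\<^sup>2 + y\<^sup>2 = (4 * \<alpha>\<^sup>2 * \<beta>\<^sup>2 + (\<beta>\<^sup>2 - \<alpha>\<^sup>2)\<^sup>2) / (n\<^sup>2)\<^sup>2"
      by (simp add: x_y_def power_divide power_mult_distrib add_divide_distrib)
    also have "4 * \<alpha>\<^sup>2 * \<beta>\<^sup>2 + (\<beta>\<^sup>2 - \<alpha>\<^sup>2)\<^sup>2 = n\<^sup>2" unfolding n_def by algebra
    finally show ?thesis using n by (simp add: power2_eq_square)
  qed
  have dd_eq: "sqrt (x\<^sup>2 + (y - Y j)\<^sup>2) = dd j z" for j by (simp add: dd_def x2 y_eq)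
  have dd_sq: "(dd j z)\<^sup>2 = x\<^sup>2 + (y - Y j)\<^sup>2" for j
    unfolding dd_eq[symmetric] by simp
  \<comment> \<open>Rationalisation: x^2 = (dd + (Y - y)) (dd - (Y - y)) exhibits the factor x^2,
    which vanishes on the axes.\<close>
  have eta: "(y - Y j) / dd j z = - (1 - x\<^sup>2 * et j z)" if "j \<le> k" "ys j \<noteq> \<infinity>" for j
  proof -
    have p: "dd j z > 0" "dd j z + (Y j - y) > 0" using dd[OF that] by (simp_all add: y_eq)
    have "x\<^sup>2 = (dd j z + (Y j - y)) * (dd j z - (Y j - y))" using dd_sq[of j] by algebra
    moreover have "et j z = inverse (dd j z) * inverse (dd j z + (Y j - y))" by (simp only: et_def y_eq)
    ultimately have "x\<^sup>2 * et j z = (dd j z - (Y j - y)) / dd j z"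
      using p by (simp add: divide_inverse)
    then show ?thesis using p by (simp add: diff_divide_distrib)
  qed
  \<comment> \<open>For y_(k+1) = 0 the distance is |(x, y)| = 1 / n with n = |z|^2.\<close>
  have last0: "sqrt (x\<^sup>2 + (y - real_of_ereal (ys (Suc k)))\<^sup>2) = 1 / n"
    unfolding ys_last using x2y2 n by (simp add: real_sqrt_divide)
  have fin_last: "ys (Suc k) \<noteq> \<infinity>" by (simp add: ys_last)
  have set: "{0..length es + 1} = insert (Suc k) {..k}" by auto
  have v1: "cs_v1 es ys (x, y) = (x / 2 * (n + WW al z)) *\<^sub>R e1 + (x / 2 * (n + WW be z)) *\<^sub>R e2"
  proof -
    have "(\<Sum>j=0..length es + 1. if ys j = \<infinity> then 0 else (1 / sqrt (x\<^sup>2 + (y - real_of_ereal (ys j))\<^sup>2)) *\<^sub>R cs_ab es j) =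
       n *\<^sub>R (e1 + e2) + (\<Sum>j\<le>k. if ys j = \<infinity> then 0 else (1 / sqrt (x\<^sup>2 + (y - real_of_ereal (ys j))\<^sup>2)) *\<^sub>R cs_ab es j)"
      unfolding set using fin_last by (subst sum.insert) (auto simp: last0 cs_ab_last)
    also have "(\<Sum>j\<le>k. if ys j = \<infinity> then 0 else (1 / sqrt (x\<^sup>2 + (y - real_of_ereal (ys j))\<^sup>2)) *\<^sub>R cs_ab es j) =
       (\<Sum>j\<le>k. (if ys j = \<infinity> then 0 else al j * inverse (dd j z)) *\<^sub>R e1 + (if ys j = \<infinity> then 0 else be j * inverse (dd j z)) *\<^sub>R e2)"
      by (intro sum.cong refl) (auto simp: Y_def[symmetric] dd_eq cs_ab_eq scaleR_add_right divide_inverse mult.commute)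
    also have "\<dots> = WW al z *\<^sub>R e1 + WW be z *\<^sub>R e2"
      by (simp only: sum.distrib WW_def scaleR_sum_left)
    finally have S: "(\<Sum>j=0..length es + 1. if ys j = \<infinity> then 0 else (1 / sqrt (x\<^sup>2 + (y - real_of_ereal (ys j))\<^sup>2)) *\<^sub>R cs_ab es j) =
       n *\<^sub>R (e1 + e2) + (WW al z *\<^sub>R e1 + WW be z *\<^sub>R e2)" .
    show ?thesis unfolding cs_v1_def prod.case S by (simp add: scaleR_add_right scaleR_add_left distrib_left)
  qed
  have v2: "cs_v2 es ys (x, y) = (1/2 * (y * n + 1 + x\<^sup>2 * EE al z)) *\<^sub>R e1 + (1/2 * (y * n - 1 + x\<^sup>2 * EE be z)) *\<^sub>R e2"
  proof -
    have "(\<Sum>j=0..length es + 1. if ys j = \<infinity> then - cs_ab es j else ((y - real_of_ereal (ys j)) / sqrt (x\<^sup>2 + (y - real_of_ereal (ys j))\<^sup>2)) *\<^sub>R cs_ab es j) =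
       (y * n) *\<^sub>R (e1 + e2) + (\<Sum>j\<le>k. if ys j = \<infinity> then - cs_ab es j else ((y - real_of_ereal (ys j)) / sqrt (x\<^sup>2 + (y - real_of_ereal (ys j))\<^sup>2)) *\<^sub>R cs_ab es j)"
      unfolding set using fin_last last0 by (subst sum.insert) (auto simp: ys_last cs_ab_last)
    also have "(\<Sum>j\<le>k. if ys j = \<infinity> then - cs_ab es j else ((y - real_of_ereal (ys j)) / sqrt (x\<^sup>2 + (y - real_of_ereal (ys j))\<^sup>2)) *\<^sub>R cs_ab es j) =
       (\<Sum>j\<le>k. (x\<^sup>2 * (if ys j = \<infinity> then 0 else al j * et j z) - al j) *\<^sub>R e1 + (x\<^sup>2 * (if ys j = \<infinity> then 0 else be j * et j z) - be j) *\<^sub>R e2)"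
    proof (intro sum.cong refl)
      \<comment> \<open>For an infinite point the summand is -(a_j, b_j), which is the finite
        formula with the correction term absent.\<close>
      fix j assume j: "j \<in> {..k}"
      then show "(if ys j = \<infinity> then - cs_ab es j else ((y - real_of_ereal (ys j)) / sqrt (x\<^sup>2 + (y - real_of_ereal (ys j))\<^sup>2)) *\<^sub>R cs_ab es j) =
        (x\<^sup>2 * (if ys j = \<infinity> then 0 else al j * et j z) - al j) *\<^sub>R e1 + (x\<^sup>2 * (if ys j = \<infinity> then 0 else be j * et j z) - be j) *\<^sub>R e2"
        by (cases "ys j = \<infinity>")
           (simp_all add: cs_ab_eq eta Y_def[symmetric] dd_eq scaleR_add_right scaleR_diff_left left_diff_distrib mult.assoc,
            simp_all add: algebra_simps)
    qed
    also have "\<dots> = (x\<^sup>2 * EE al z - (\<Sum>j\<le>k. al j)) *\<^sub>R e1 + (x\<^sup>2 * EE be z - (\<Sum>j\<le>k. be j)) *\<^sub>R e2"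
      by (simp only: sum.distrib scaleR_sum_left[symmetric] EE_def sum_distrib_left sum_subtractf)
    finally have S: "(\<Sum>j=0..length es + 1. if ys j = \<infinity> then - cs_ab es j else ((y - real_of_ereal (ys j)) / sqrt (x\<^sup>2 + (y - real_of_ereal (ys j))\<^sup>2)) *\<^sub>R cs_ab es j) =
       (y * n) *\<^sub>R (e1 + e2) + ((x\<^sup>2 * EE al z - (\<Sum>j\<le>k. al j)) *\<^sub>R e1 + (x\<^sup>2 * EE be z - (\<Sum>j\<le>k. be j)) *\<^sub>R e2)" .
    show ?thesis unfolding cs_v2_def prod.case S sum_al sum_be
      by (simp add: scaleR_add_right scaleR_add_left distrib_left algebra_simps)
  qed
  define K where "K = \<alpha> * \<beta> / n"
  have c1: "x / 2 * (n + WW al z) = K * QQ z" "x / 2 * (n + WW be z) = K * PP z"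
    using n by (simp_all add: x_y_def K_def QQ_def PP_def rr field_simps power2_eq_square)
  have yn: "y * n + 1 = 2 * cc z" "y * n - 1 = - 2 * ss z"
  proof -
    have "y * n = (\<beta>\<^sup>2 - \<alpha>\<^sup>2) / n" using n by (simp add: x_y_def power2_eq_square)
    moreover have "1 = (\<alpha>\<^sup>2 + \<beta>\<^sup>2) / n" using n by (simp flip: n_def)
    ultimately show "y * n + 1 = 2 * cc z" "y * n - 1 = - 2 * ss z"
      by (simp_all add: ss cc diff_divide_distrib add_divide_distrib)
  qed
  have c2: "1/2 * (y * n + 1 + x\<^sup>2 * EE al z) = cc z * T1 z"
    unfolding yn x2 T1_def by (simp add: algebra_simps)
  have "y * n - 1 + x\<^sup>2 * EE be z = - 2 * ss z + x\<^sup>2 * EE be z" using yn by simp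
  then have c3: "1/2 * (y * n - 1 + x\<^sup>2 * EE be z) = - (ss z * T2 z)"
    unfolding x2 T2_def by (simp add: algebra_simps)
  note v1' = v1[unfolded c1] and v2' = v2[unfolded c2 c3]
  define X0 Y0 where "X0 = 2 * \<beta> * (\<beta>\<^sup>2 - 3 * \<alpha>\<^sup>2) / n ^ 3" "Y0 = 2 * \<alpha> * (\<alpha>\<^sup>2 - 3 * \<beta>\<^sup>2) / n ^ 3"
  define da db where "da u = fst u \<bullet> sgn (fst z)" "db u = snd u \<bullet> sgn (snd z)" for u :: C2
  have fd: "frechet_derivative end_xy (at z) u = (X0 * da u + Y0 * db u, Y0 * da u - X0 * db u)" for u
    using frechet_derivative_at[OF end_xy_has_derivative[OF z]]
    by (simp add: X0_Y0_def da_db_def \<alpha>_\<beta>_def n_def fun_eq_iff)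
  have XY: "X0\<^sup>2 + Y0\<^sup>2 = 4 / n ^ 3"
  proof -
    have "X0\<^sup>2 + Y0\<^sup>2 = (4 * \<beta>\<^sup>2 * (\<beta>\<^sup>2 - 3 * \<alpha>\<^sup>2)\<^sup>2 + 4 * \<alpha>\<^sup>2 * (\<alpha>\<^sup>2 - 3 * \<beta>\<^sup>2)\<^sup>2) / (n ^ 3)\<^sup>2"
      by (simp add: X0_Y0_def power_divide power_mult_distrib add_divide_distrib)
    also have "4 * \<beta>\<^sup>2 * (\<beta>\<^sup>2 - 3 * \<alpha>\<^sup>2)\<^sup>2 + 4 * \<alpha>\<^sup>2 * (\<alpha>\<^sup>2 - 3 * \<beta>\<^sup>2)\<^sup>2 = 4 * n ^ 3" unfolding n_def by algebra
    also have "4 * N / N\<^sup>2 = 4 / N" for N :: real by (simp add: power2_eq_square)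
    finally show ?thesis .
  qed
  define d where "d = da u * da v + db u * db v"
  have dxy: "(X0 * da u + Y0 * db u, Y0 * da u - X0 * db u) \<bullet> (X0 * da v + Y0 * db v, Y0 * da v - X0 * db v) = 4 * d / n ^ 3"
  proof -
    have "(X0 * da u + Y0 * db u, Y0 * da u - X0 * db u) \<bullet> (X0 * da v + Y0 * db v, Y0 * da v - X0 * db v) = (X0\<^sup>2 + Y0\<^sup>2) * d"
      unfolding inner_Pair inner_real_def d_def by algebra
    then show ?thesis by (simp add: XY)
  qed
  define f1 f2 g1 g2 where fg: "f1 = Im (fst u / fst z)" "f2 = Im (snd u / snd z)" "g1 = Im (fst v / fst z)" "g2 = Im (snd v / snd z)"
  have dt: "end_dt es z u = f1 *\<^sub>R e1 + f2 *\<^sub>R e2" "end_dt es z v = g1 *\<^sub>R e1 + g2 *\<^sub>R e2"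
    by (simp_all add: end_dt_def fg)
  have det: "det2 (cs_v1 es ys (x, y)) (cs_v2 es ys (x, y)) = q * K * DD z"
    unfolding v1' v2' det2_comb DD_def by (simp add: algebra_simps)
  have B1: "det2 (cs_v1 es ys (x, y)) (f1 *\<^sub>R e1 + f2 *\<^sub>R e2) = - q * K * (QQ z * f2 - PP z * f1)" for f1 f2
    unfolding v1' det2_comb by (simp add: algebra_simps)
  have B2: "det2 (cs_v2 es ys (x, y)) (f1 *\<^sub>R e1 + f2 *\<^sub>R e2) = - q * (cc z * T1 z * f2 + ss z * T2 z * f1)" for f1 f2
    unfolding v2' det2_comb by (simp add: algebra_simps)
  have sg: "\<alpha>\<^sup>2 * f1 = sg1 z u" "\<beta>\<^sup>2 * f2 = sg2 z u" "\<alpha>\<^sup>2 * g1 = sg1 z v" "\<beta>\<^sup>2 * g2 = sg2 z v"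
    unfolding fg \<alpha>_\<beta>_def sg1_def sg2_def using polar_inner(2) nz by auto
  have uv: "d + \<alpha>\<^sup>2 * f1 * g1 + \<beta>\<^sup>2 * f2 * g2 = u \<bullet> v"
    unfolding inner_prod_def[of u v] polar_inner(1)[OF nz(1), of "fst u" "fst v", symmetric]
      polar_inner(1)[OF nz(2), of "snd u" "snd v", symmetric] d_def da_db_def fg \<alpha>_\<beta>_def by simp
  have "cs_metric es ys (end_xy z) (end_push es z u) (end_push es z v) =
    x * (q * K * DD z) / (2 * (1 / n\<^sup>2)) * (4 * d / n ^ 3 / x\<^sup>2 +
      ((- q * K * (QQ z * f2 - PP z * f1)) * (- q * K * (QQ z * g2 - PP z * g1)) +
       (- q * (cc z * T1 z * f2 + ss z * T2 z * f1)) * (- q * (cc z * T1 z * g2 + ss z * T2 z * g1))) / (q * K * DD z)\<^sup>2)"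
    unfolding cs_metric_def end_push_def xy Let_def prod.case fst_conv snd_conv fd dxy dt det B1 B2 x2y2 by (rule refl)
  also have "\<dots> = q * (DD z * (d + \<alpha>\<^sup>2 * f1 * g1 + \<beta>\<^sup>2 * f2 * g2) + 1/n * (A11 z * (\<alpha>\<^sup>2 * f1) * (\<alpha>\<^sup>2 * g1) +
       A12 z * ((\<alpha>\<^sup>2 * f1) * (\<beta>\<^sup>2 * g2) + (\<beta>\<^sup>2 * f2) * (\<alpha>\<^sup>2 * g1)) + A22 z * (\<beta>\<^sup>2 * f2) * (\<beta>\<^sup>2 * g2)))"
    unfolding K_def
    by (rule metric_identity[OF pos q_pos n_def, where s = "ss z" and c = "cc z" and ?E1.0 = "EE al z" and ?E2.0 = "EE be z"
          and ?T1.0 = "T1 z" and ?T2.0 = "T2 z" and P = "PP z" and Q = "QQ z"])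
       (simp_all only: ss[symmetric] cc[symmetric] rr[symmetric] T1_def T2_def DD_def A11_def A22_def A12_def x_y_def D[unfolded DD_def T1_def T2_def])
  also have "\<dots> = q * (u \<bullet> v + hh z u v)"
    unfolding uv unfolding sg hh_def rr by (simp add: algebra_simps)
  finally show ?thesis .
qed

end

section \<open>Asymptotics of the Calderbank--Singer metric\<close>

text \<open>An expansion up to order |w|^-4 with constant term c; the term \<open>f2\<close> of
  order |w|^-2 may depend on direction.\<close>

definition expands :: "('a::euclidean_space \<Rightarrow> real) \<Rightarrow> real \<Rightarrow> ('a \<Rightarrow> real) \<Rightarrow> bool" where
  "expands f c f2 \<longleftrightarrow> decays 2 f2 \<and> decays 4 (\<lambda>w. f w - c - f2 w)"

lemma expands_diff_decays: "expands f c f2 \<Longrightarrow> decays 2 (\<lambda>w. f w - c)"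
  using decays_add[OF decays_mono[of 4 "\<lambda>w. f w - c - f2 w" 2], of f2] by (simp add: expands_def)

lemma expands_decays: "expands f c f2 \<Longrightarrow> decays 0 f"
  using decays_add[OF decays_mono[OF expands_diff_decays, of f c f2 0] decays_const[of c]] by simp

lemma expands_cong:
  assumes "expands f c f2" "\<forall>\<^sub>F w in at_infinity. f w = g w" "c = d" "\<forall>\<^sub>F w in at_infinity. f2 w = g2 w"
  shows "expands g d g2"
proof -
  have f2: "decays 2 f2" and f: "decays 4 (\<lambda>w. f w - c - f2 w)" using assms(1) by (auto simp: expands_def)
  have "decays 2 g2" by (rule decays_cong[OF f2 assms(4)])
  moreover have "decays 4 (\<lambda>w. g w - d - g2 w)"
    by (rule decays_cong[OF f], use assms(2,4) in eventually_elim) (simp add: assms(3))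
  ultimately show ?thesis by (simp add: expands_def)
qed

lemma expands_const: "expands (\<lambda>_. c) c (\<lambda>_. 0)"
  by (simp add: expands_def decays_zero)

lemma expands_add:
  assumes "expands f c f2" "expands g d g2"
  shows "expands (\<lambda>w. f w + g w) (c + d) (\<lambda>w. f2 w + g2 w)"
proof -
  have "decays 4 (\<lambda>w. (f w - c - f2 w) + (g w - d - g2 w))"
    using assms by (intro decays_add) (auto simp: expands_def)
  then show ?thesis using assms by (simp add: expands_def decays_add algebra_simps)
qed

lemma expands_cmult: "expands f c f2 \<Longrightarrow> expands (\<lambda>w. a * f w) (a * c) (\<lambda>w. a * f2 w)"
  using decays_cmult[of 4 "\<lambda>w. f w - c - f2 w" a]
  by (auto simp: expands_def decays_cmult right_diff_distrib)

lemma expands_diff: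
  assumes "expands f c f2" "expands g d g2"
  shows "expands (\<lambda>w. f w - g w) (c - d) (\<lambda>w. f2 w - g2 w)"
  using expands_add[OF assms(1) expands_cmult[OF assms(2), of "-1"]] by simp

lemma expands_mult:
  assumes f: "expands f c f2" and g: "expands g d g2"
  shows "expands (\<lambda>w. f w * g w) (c * d) (\<lambda>w. c * g2 w + d * f2 w)"
proof -
  have "decays 4 (\<lambda>w. (f w - c - f2 w) * g w + c * (g w - d - g2 w) + f2 w * (g w - d))"
    using f g expands_decays[OF g] expands_diff_decays[OF g]
    by (intro decays_add decays_cmult decays_mult'[of 4 _ 0 _ 4] decays_mult'[of 2 _ 2 _ 4]) (auto simp: expands_def)
  then show ?thesis using f g by (simp add: expands_def decays_add decays_cmult algebra_simps)
qed

text \<open>For factors such as \<open>ss\<close> and \<open>cc\<close>, which are bounded but have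
  no limit at infinity; the other factor must therefore have constant term 0.\<close>

lemma expands_decays_mult:
  assumes "decays 0 s" "expands f 0 f2"
  shows "expands (\<lambda>w. s w * f w) 0 (\<lambda>w. s w * f2 w)"
  using decays_mult[OF assms(1), of 2 f2] decays_mult[OF assms(1), of 4 "\<lambda>w. f w - f2 w"] assms(2)
  by (simp add: expands_def right_diff_distrib)

lemma decays_inverse_limit:
  assumes f: "decays 0 f" "(f \<longlongrightarrow> l) at_infinity" and l: "l \<noteq> 0"
  shows "decays 0 (\<lambda>w. inverse (f w))"
proof -
  have "\<forall>\<^sub>F w in at_infinity. \<bar>f w\<bar> > \<bar>l\<bar> / 2"
    using l by (intro order_tendstoD(1)[OF tendsto_rabs[OF f(2)]]) simp
  then have "\<forall>\<^sub>F w in at_infinity. \<bar>l\<bar> / 2 * norm w powr (-0) \<le> \<bar>f w\<bar>"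
    using eventually_norm_gt[of 0] by eventually_elim auto
  from decays_inverse[OF f(1) _ this] l show ?thesis by simp
qed

lemma decays_tendsto_const:
  assumes "decays m (\<lambda>w. f w - l)" "m > 0" shows "(f \<longlongrightarrow> l) at_infinity"
  using decays_tendsto[OF assms] by (simp add: LIM_zero_iff)

text \<open>Dividing by 1 + O(|w|^-2) changes a quantity without constant term only at order
  4.\<close>

lemma expands_divide:
  assumes f: "expands f 0 f2" and d: "decays 2 (\<lambda>w. d w - 1)"
  shows "expands (\<lambda>w. f w / d w) 0 f2"
proof -
  have d0: "decays 0 d" using decays_add[OF decays_mono[OF d] decays_const, of 1] by simp
  have lim: "(d \<longlongrightarrow> 1) at_infinity" by (rule decays_tendsto_const[OF d]) simp
  have i: "decays 0 (\<lambda>w. inverse (d w))" by (rule decays_inverse_limit[OF d0 lim]) simp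
  have f2: "decays 2 f2" "decays 4 (\<lambda>w. f w - f2 w)" using f by (auto simp: expands_def)
  have "decays 4 (\<lambda>w. (f w - f2 w) * inverse (d w) - f2 w * ((d w - 1) * inverse (d w)))"
    by (intro decays_diff decays_mult'[OF f2(2) i] decays_mult'[OF f2(1) decays_mult[OF d i]]) auto
  moreover have "\<forall>\<^sub>F w in at_infinity. d w > 0" using order_tendstoD(1)[OF lim] by simp
  then have "\<forall>\<^sub>F w in at_infinity. (f w - f2 w) * inverse (d w) - f2 w * ((d w - 1) * inverse (d w)) = f w / d w - 0 - f2 w"
    by eventually_elim (simp add: field_simps)
  ultimately have "decays 4 (\<lambda>w. f w / d w - 0 - f2 w)" by (rule decays_cong)
  then show ?thesis using f2 by (simp add: expands_def)
qed

section \<open>Expansion of the coefficient functions\<close>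

context calderbank_singer
begin

lemma decays_fst: "decays (-2) (\<lambda>z::C2. (cmod (fst z))\<^sup>2)" and decays_snd: "decays (-2) (\<lambda>z::C2. (cmod (snd z))\<^sup>2)"
proof -
  have "decays (-2) (\<lambda>z::C2. (z \<bullet> a) * (z \<bullet> a) + (z \<bullet> b) * (z \<bullet> b))" for a b :: C2
    by (intro decays_add decays_mult'[OF decays_coord decays_coord]) auto
  note this[of "(1,0)" "(\<i>,0)"] this[of "(0,1)" "(0,\<i>)"]
  then show "decays (-2) (\<lambda>z::C2. (cmod (fst z))\<^sup>2)" "decays (-2) (\<lambda>z::C2. (cmod (snd z))\<^sup>2)"
    by (simp_all add: inner_prod_def inner_complex_def cmod_power2 flip: power2_eq_square)
qed

lemma rr_decays: "decays 2 rr" unfolding rr_def by (rule decays_inner_self)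

lemma ss_decays: "decays 0 ss" and cc_decays: "decays 0 cc"
  using decays_mult[OF decays_fst rr_decays] decays_mult[OF decays_snd rr_decays]
  by (simp_all add: ss_def[abs_def] cc_def[abs_def])

lemma ss_cc: "z \<noteq> 0 \<Longrightarrow> ss z + cc z = 1"
  by (simp add: ss_def cc_def rr_def inner_self_C2[symmetric] flip: distrib_right)

lemma ss_cc_eventually: "\<forall>\<^sub>F z in at_infinity. ss z + cc z = 1"
  using eventually_norm_gt[of 0] by eventually_elim (auto intro: ss_cc)

lemma rs_decays: "decays 2 (\<lambda>z. rr z * ss z)" and rc_decays: "decays 2 (\<lambda>z. rr z * cc z)"
  using decays_mult[OF rr_decays ss_decays] decays_mult[OF rr_decays cc_decays] by simp_all

lemma y_decays: "decays 2 (\<lambda>z. rr z * cc z - rr z * ss z)"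
  by (intro decays_diff rs_decays rc_decays)

text \<open>The difference is written as dd - Y = (dd^2 - Y^2) / (dd + Y), where dd^2 - Y^2 = x^2 +
  y (y - 2Y) visibly has order 2.\<close>

lemma dd_decays:
  assumes "Y j > 0"
  shows "decays 0 (dd j)" "decays 2 (\<lambda>z. dd j z - Y j)"
proof -
  define g where "g z = 4 * (rr z * ss z) * (rr z * cc z) + (rr z * cc z - rr z * ss z - Y j)\<^sup>2" for z
  have y0: "decays 0 (\<lambda>z. (rr z * cc z - rr z * ss z) - 2 * Y j)"
    by (intro decays_diff decays_mono[OF y_decays] decays_const) simp
  have "decays 2 (\<lambda>z. 4 * ((rr z * ss z) * (rr z * cc z)) + (rr z * cc z - rr z * ss z) * ((rr z * cc z - rr z * ss z) - 2 * Y j))"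
    by (intro decays_add decays_cmult decays_mult'[OF rs_decays rc_decays] decays_mult'[OF y_decays y0]) auto
  moreover have "4 * ((rr z * ss z) * (rr z * cc z)) + (rr z * cc z - rr z * ss z) * ((rr z * cc z - rr z * ss z) - 2 * Y j) = g z - (Y j)\<^sup>2" for z
    unfolding g_def by algebra
  ultimately have g: "decays 2 (\<lambda>z. g z - (Y j)\<^sup>2)" by simp
  have g0: "decays 0 g" using decays_add[OF decays_mono[OF g] decays_const, of "(Y j)\<^sup>2"] by simp
  have lim: "(g \<longlongrightarrow> (Y j)\<^sup>2) at_infinity" by (rule decays_tendsto_const[OF g]) simp
  have "(Y j)\<^sup>2 / 2 < (Y j)\<^sup>2" using assms by simp
  from order_tendstoD(1)[OF lim this] have "\<forall>\<^sub>F z in at_infinity. (Y j)\<^sup>2 / 2 \<le> g z"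
    by eventually_elim simp
  from decays_sqrt[OF g0 _ this] assms have "decays 0 (\<lambda>z. sqrt (g z))" by simp
  moreover have dd: "dd j z = sqrt (g z)" for z by (simp add: dd_def g_def)
  ultimately show d0: "decays 0 (dd j)" by (simp add: dd[abs_def])
  have s0: "decays 0 (\<lambda>z. dd j z + Y j)" by (intro decays_add d0 decays_const)
  have nn: "g z \<ge> 0" and ddn: "dd j z \<ge> 0" for z
    by (simp_all add: g_def dd_def rr_def ss_def cc_def)
  have "\<forall>\<^sub>F z in at_infinity. Y j * norm z powr (-0) \<le> \<bar>dd j z + Y j\<bar>"
    using eventually_norm_gt[of 0] by eventually_elim (use assms ddn in auto)
  from decays_inverse[OF s0 assms this] have i: "decays 0 (\<lambda>z. inverse (dd j z + Y j))" by simp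
  have "decays 2 (\<lambda>z. (g z - (Y j)\<^sup>2) * inverse (dd j z + Y j))"
    by (rule decays_mult'[OF g i]) simp
  moreover have "(g z - (Y j)\<^sup>2) * inverse (dd j z + Y j) = dd j z - Y j" for z
  proof -
    have "g z = (dd j z)\<^sup>2" using nn[of z] by (simp add: dd)
    then have "g z - (Y j)\<^sup>2 = (dd j z - Y j) * (dd j z + Y j)" by (simp add: power2_eq_square algebra_simps)
    then show ?thesis using assms ddn[of z] by simp
  qed
  ultimately show "decays 2 (\<lambda>z. dd j z - Y j)" by simp
qed

lemma dd_inverse_decays:
  assumes "Y j > 0"
  shows "decays 0 (\<lambda>z. inverse (dd j z))" "decays 2 (\<lambda>z. inverse (dd j z) - inverse (Y j))" "\<forall>\<^sub>F z in at_infinity. dd j z > 0"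
proof -
  have lim: "(dd j \<longlongrightarrow> Y j) at_infinity"
    by (rule decays_tendsto_const[OF dd_decays(2)[OF assms]]) simp
  show i: "decays 0 (\<lambda>z. inverse (dd j z))"
    by (rule decays_inverse_limit[OF dd_decays(1)[OF assms] lim]) (use assms in simp)
  show pos: "\<forall>\<^sub>F z in at_infinity. dd j z > 0" using order_tendstoD(1)[OF lim assms] .
  have "decays 2 (\<lambda>z. (- inverse (Y j)) * ((dd j z - Y j) * inverse (dd j z)))"
    by (intro decays_cmult decays_mult'[OF dd_decays(2)[OF assms] i]) simp
  moreover have "\<forall>\<^sub>F z in at_infinity. (- inverse (Y j)) * ((dd j z - Y j) * inverse (dd j z)) = inverse (dd j z) - inverse (Y j)"
    using pos by eventually_elim (use assms in \<open>simp add: field_simps\<close>)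
  ultimately show "decays 2 (\<lambda>z. inverse (dd j z) - inverse (Y j))" by (rule decays_cong)
qed

lemma et_decays:
  assumes "Y j > 0"
  shows "decays 0 (et j)" "\<forall>\<^sub>F z in at_infinity. dd j z + (Y j - (rr z * cc z - rr z * ss z)) > 0"
proof -
  have "decays 2 (\<lambda>z. (dd j z - Y j) - (rr z * cc z - rr z * ss z))"
    by (intro decays_diff[OF dd_decays(2)[OF assms] y_decays])
  moreover have "(\<lambda>z. (dd j z - Y j) - (rr z * cc z - rr z * ss z)) =
      (\<lambda>z. (dd j z + (Y j - (rr z * cc z - rr z * ss z))) - 2 * Y j)" by (rule ext) linarith
  ultimately have d: "decays 2 (\<lambda>z. (dd j z + (Y j - (rr z * cc z - rr z * ss z))) - 2 * Y j)" by (simp only:)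
  have lim: "((\<lambda>z. dd j z + (Y j - (rr z * cc z - rr z * ss z))) \<longlongrightarrow> 2 * Y j) at_infinity"
    by (rule decays_tendsto_const[OF d]) simp
  have d0: "decays 0 (\<lambda>z. dd j z + (Y j - (rr z * cc z - rr z * ss z)))"
    using decays_add[OF decays_mono[OF d, of 0] decays_const[of "2 * Y j"]] by (simp only: diff_add_cancel)
  show "\<forall>\<^sub>F z in at_infinity. dd j z + (Y j - (rr z * cc z - rr z * ss z)) > 0"
    using order_tendstoD(1)[OF lim] assms by simp
  have i: "decays 0 (\<lambda>z. inverse (dd j z + (Y j - (rr z * cc z - rr z * ss z))))"
    by (rule decays_inverse_limit[OF d0 lim]) (use assms in simp)
  show "decays 0 (et j)" unfolding et_def
    by (rule decays_mult'[OF dd_inverse_decays(1)[OF assms] i]) simp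
qed

text \<open>\<open>om al\<close> and \<open>om be\<close> are the numbers \<omega>_1 and \<omega>_2
  of the overview; an infinite y_0 contributes 0.\<close>

definition om :: "(nat \<Rightarrow> real) \<Rightarrow> real" where
  "om f = (\<Sum>j\<le>k. if ys j = \<infinity> then 0 else f j * inverse (Y j))"

lemma WW_decays: "decays 2 (\<lambda>z. WW f z - om f)"
proof -
  have "decays 2 (\<lambda>z. \<Sum>j\<le>k. if ys j = \<infinity> then 0 else f j * (inverse (dd j z) - inverse (Y j)))"
  proof (rule decays_sum)
    fix j assume "j \<in> {..k}"
    then show "decays 2 (\<lambda>z. if ys j = \<infinity> then 0 else f j * (inverse (dd j z) - inverse (Y j)))"
      using dd_inverse_decays(2)[OF Y_pos, of j] by (cases "ys j = \<infinity>") (simp_all add: decays_zero decays_cmult)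
  qed
  moreover have "(\<Sum>j\<le>k. if ys j = \<infinity> then 0 else f j * (inverse (dd j z) - inverse (Y j))) = WW f z - om f" for z
    unfolding WW_def om_def sum_subtractf[symmetric] by (intro sum.cong) (auto simp: right_diff_distrib)
  ultimately show ?thesis by simp
qed

lemma EE_decays: "decays 0 (EE f)"
  unfolding EE_def
proof (rule decays_sum)
  fix j assume "j \<in> {..k}"
  then show "decays 0 (\<lambda>z. if ys j = \<infinity> then 0 else f j * et j z)"
    using et_decays(1)[OF Y_pos, of j] by (cases "ys j = \<infinity>") (simp_all add: decays_zero decays_cmult)
qed

lemma rWW_expands: "expands (\<lambda>z. 1 + rr z * WW f z) 1 (\<lambda>z. rr z * om f)"
proof -
  have "decays 4 (\<lambda>z. rr z * (WW f z - om f))" using decays_mult[OF rr_decays WW_decays, of f] by simp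
  moreover have "decays 2 (\<lambda>z. rr z * om f)" using decays_cmult[OF rr_decays, of "om f"] by (simp add: mult.commute)
  ultimately show ?thesis by (simp add: expands_def right_diff_distrib)
qed

lemma PP_expands: "expands PP 1 (\<lambda>z. rr z * om be)" and QQ_expands: "expands QQ 1 (\<lambda>z. rr z * om al)"
  unfolding PP_def[abs_def] QQ_def[abs_def] by (rule rWW_expands)+

lemma rsE_decays: "decays 4 (\<lambda>z. rr z * (rr z * ss z) * EE f z)" and rcE_decays: "decays 4 (\<lambda>z. rr z * (rr z * cc z) * EE f z)"
  by (rule decays_mult'[OF decays_mult[OF rr_decays rs_decays] EE_decays]
      decays_mult'[OF decays_mult[OF rr_decays rc_decays] EE_decays]; simp)+

text \<open>The corrections carry two factors r^-2 and so do not enter at order 2.\<close>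

lemma T1_expands: "expands T1 1 (\<lambda>_. 0)" and T2_expands: "expands T2 1 (\<lambda>_. 0)"
  using decays_cmult[OF rsE_decays, of 2 al] decays_cmult[OF rcE_decays, of "-2" be]
  by (simp_all add: expands_def decays_zero T1_def T2_def mult.assoc)

lemma DD_expands: "expands (\<lambda>z. DD z - 1) 0 (\<lambda>z. ss z * (rr z * om al) + cc z * (rr z * om be))"
proof -
  have 1: "expands (\<lambda>z. T2 z * QQ z - 1) 0 (\<lambda>z. rr z * om al)"
    using expands_diff[OF expands_mult[OF T2_expands QQ_expands] expands_const, of 1] by simp
  have 2: "expands (\<lambda>z. T1 z * PP z - 1) 0 (\<lambda>z. rr z * om be)"
    using expands_diff[OF expands_mult[OF T1_expands PP_expands] expands_const, of 1] by simp
  have E: "expands (\<lambda>z. ss z * (T2 z * QQ z - 1) + cc z * (T1 z * PP z - 1)) (0 + 0) (\<lambda>z. ss z * (rr z * om al) + cc z * (rr z * om be))"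
    by (intro expands_add expands_decays_mult ss_decays cc_decays 1 2)
  show ?thesis
  proof (rule expands_cong[OF E])
    show "\<forall>\<^sub>F z in at_infinity. ss z * (T2 z * QQ z - 1) + cc z * (T1 z * PP z - 1) = DD z - 1"
      using ss_cc_eventually
    proof eventually_elim
      case (elim z)
      have "ss z * (T2 z * QQ z - 1) + cc z * (T1 z * PP z - 1) = DD z - (ss z + cc z)"
        by (simp add: DD_def algebra_simps)
      then show ?case by (simp add: elim)
    qed
  qed auto
qed

lemma DD_decays: "decays 2 (\<lambda>z. DD z - 1)" using expands_diff_decays[OF DD_expands] by simp

lemma square_expands: "expands f 1 f2 \<Longrightarrow> expands (\<lambda>w. (f w)\<^sup>2) 1 (\<lambda>w. 2 * f2 w)"
  using expands_mult[of f 1 f2 f 1 f2] by (simp add: power2_eq_square)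

lemma correction_expands:
  assumes a: "decays 4 a" and b: "decays 0 b"
  shows "expands (\<lambda>z. 1 + c * (a z * b z)) 1 (\<lambda>_. 0)"
  using decays_cmult[OF decays_mult'[OF a b], of 4 c] by (simp add: expands_def decays_zero)

lemma TTPQ_expands: "expands (\<lambda>z. 2 * T1 z * T2 z * PP z * QQ z) 2 (\<lambda>z. 2 * (rr z * om al) + 2 * (rr z * om be))"
  using expands_cmult[OF expands_mult[OF expands_mult[OF expands_mult[OF T1_expands T2_expands] PP_expands] QQ_expands], of 2]
  by (simp add: mult.assoc distrib_left)

text \<open>The constants cancel in each bracket (1 - 2 + 1 in the first). At order 2 the first and
  the last bracket both give -2 \<open>om al\<close> r^-2, and their weights \<open>cc\<close> and
  \<open>ss\<close> add up to 1.\<close>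

lemma A11_expands: "expands A11 0 (\<lambda>z. -2 * (rr z * om al))"
proof -
  have b: "decays 0 (\<lambda>z. 1 + rr z * (rr z * ss z) * EE al z)"
    by (intro decays_add decays_const decays_mono[OF rsE_decays]) simp
  have "expands (\<lambda>z. 1 + -4 * ((rr z * (rr z * cc z) * EE al z) * (1 + rr z * (rr z * ss z) * EE al z))) 1 (\<lambda>_. 0)"
    by (rule correction_expands[OF rcE_decays b])
  then have c: "expands (\<lambda>z. 1 - 4 * rr z * (rr z * cc z) * EE al z * (1 + rr z * (rr z * ss z) * EE al z)) 1 (\<lambda>_. 0)"
    by (simp add: mult.assoc)
  have 1: "expands (\<lambda>z. (PP z)\<^sup>2 * (1 - 4 * rr z * (rr z * cc z) * EE al z * (1 + rr z * (rr z * ss z) * EE al z)) -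
     2 * T1 z * T2 z * PP z * QQ z + 1) 0 (\<lambda>z. -2 * (rr z * om al))"
    using expands_add[OF expands_diff[OF expands_mult[OF square_expands[OF PP_expands] c] TTPQ_expands] expands_const[of 1]]
    by simp
  have 2: "expands (\<lambda>z. (T2 z)\<^sup>2 - 1) 0 (\<lambda>_. 0)"
    using expands_diff[OF square_expands[OF T2_expands] expands_const[of 1]] by simp
  have 3: "expands (\<lambda>z. 1 - (T2 z)\<^sup>2 * (QQ z)\<^sup>2) 0 (\<lambda>z. -2 * (rr z * om al))"
    using expands_diff[OF expands_const[of 1] expands_mult[OF square_expands[OF T2_expands] square_expands[OF QQ_expands]]] by simp
  have E: "expands (\<lambda>z. cc z * ((PP z)\<^sup>2 * (1 - 4 * rr z * (rr z * cc z) * EE al z * (1 + rr z * (rr z * ss z) * EE al z)) -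
     2 * T1 z * T2 z * PP z * QQ z + 1) + ((T2 z)\<^sup>2 - 1) + ss z * (1 - (T2 z)\<^sup>2 * (QQ z)\<^sup>2)) (0 + 0 + 0)
     (\<lambda>z. cc z * (-2 * (rr z * om al)) + 0 + ss z * (-2 * (rr z * om al)))"
    by (intro expands_add expands_decays_mult ss_decays cc_decays 1 2 3)
  have "\<forall>\<^sub>F z in at_infinity. cc z * (-2 * (rr z * om al)) + 0 + ss z * (-2 * (rr z * om al)) = -2 * (rr z * om al)"
    using ss_cc_eventually
  proof eventually_elim
    case (elim z)
    have "cc z * (-2 * (rr z * om al)) + 0 + ss z * (-2 * (rr z * om al)) = (ss z + cc z) * (-2 * (rr z * om al))" by algebra
    then show ?case by (simp add: elim)
  qed
  from expands_divide[OF expands_cong[OF E always_eventually[OF allI[OF refl]] _ this] DD_decays]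
  show ?thesis by (simp add: A11_def[abs_def])
qed

lemma A22_expands: "expands A22 0 (\<lambda>z. -2 * (rr z * om be))"
proof -
  have b: "decays 0 (\<lambda>z. 1 - rr z * (rr z * cc z) * EE be z)"
    by (intro decays_diff decays_const decays_mono[OF rcE_decays]) simp
  have "expands (\<lambda>z. 1 + 4 * ((rr z * (rr z * ss z) * EE be z) * (1 - rr z * (rr z * cc z) * EE be z))) 1 (\<lambda>_. 0)"
    by (rule correction_expands[OF rsE_decays b])
  then have c: "expands (\<lambda>z. 1 + 4 * rr z * (rr z * ss z) * EE be z * (1 - rr z * (rr z * cc z) * EE be z)) 1 (\<lambda>_. 0)"
    by (simp add: mult.assoc)
  have 1: "expands (\<lambda>z. (QQ z)\<^sup>2 * (1 + 4 * rr z * (rr z * ss z) * EE be z * (1 - rr z * (rr z * cc z) * EE be z)) -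
     2 * T1 z * T2 z * PP z * QQ z + 1) 0 (\<lambda>z. -2 * (rr z * om be))"
    using expands_add[OF expands_diff[OF expands_mult[OF square_expands[OF QQ_expands] c] TTPQ_expands] expands_const[of 1]]
    by simp
  have 2: "expands (\<lambda>z. (T1 z)\<^sup>2 - 1) 0 (\<lambda>_. 0)"
    using expands_diff[OF square_expands[OF T1_expands] expands_const[of 1]] by simp
  have 3: "expands (\<lambda>z. 1 - (T1 z)\<^sup>2 * (PP z)\<^sup>2) 0 (\<lambda>z. -2 * (rr z * om be))"
    using expands_diff[OF expands_const[of 1] expands_mult[OF square_expands[OF T1_expands] square_expands[OF PP_expands]]] by simp
  have E: "expands (\<lambda>z. ss z * ((QQ z)\<^sup>2 * (1 + 4 * rr z * (rr z * ss z) * EE be z * (1 - rr z * (rr z * cc z) * EE be z)) -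
     2 * T1 z * T2 z * PP z * QQ z + 1) + ((T1 z)\<^sup>2 - 1) + cc z * (1 - (T1 z)\<^sup>2 * (PP z)\<^sup>2)) (0 + 0 + 0)
     (\<lambda>z. ss z * (-2 * (rr z * om be)) + 0 + cc z * (-2 * (rr z * om be)))"
    by (intro expands_add expands_decays_mult ss_decays cc_decays 1 2 3)
  have "\<forall>\<^sub>F z in at_infinity. ss z * (-2 * (rr z * om be)) + 0 + cc z * (-2 * (rr z * om be)) = -2 * (rr z * om be)"
    using ss_cc_eventually
  proof eventually_elim
    case (elim z)
    have "ss z * (-2 * (rr z * om be)) + 0 + cc z * (-2 * (rr z * om be)) = (ss z + cc z) * (-2 * (rr z * om be))" by algebra
    then show ?case by (simp add: elim)
  qed
  from expands_divide[OF expands_cong[OF E always_eventually[OF allI[OF refl]] _ this] DD_decays]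
  show ?thesis by (simp add: A22_def[abs_def])
qed

lemma A12_expands: "expands A12 0 (\<lambda>z. - (rr z * (om al + om be)))"
proof -
  have "expands (\<lambda>z. T1 z * T2 z - PP z * QQ z) 0 (\<lambda>z. - (rr z * (om al + om be)))"
    using expands_diff[OF expands_mult[OF T1_expands T2_expands] expands_mult[OF PP_expands QQ_expands]]
    by (simp add: distrib_left)
  from expands_divide[OF this DD_decays] show ?thesis by (simp add: A12_def[abs_def])
qed

lemma sg_decays: "decays (-1) (\<lambda>z. sg1 z u)" "decays (-1) (\<lambda>z. sg2 z u)"
proof -
  have "sg1 z u = z \<bullet> (- \<i> * fst u, 0)" "sg2 z u = z \<bullet> (0, - \<i> * snd u)" for z
    by (simp_all add: sg1_def sg2_def inner_prod_def inner_complex_def)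
  then show "decays (-1) (\<lambda>z. sg1 z u)" "decays (-1) (\<lambda>z. sg2 z u)"
    by (simp_all add: decays_coord)
qed

definition Jz :: "C2 \<Rightarrow> C2" where "Jz z = (\<i> * fst z, \<i> * snd z)"
definition Mz :: "C2 \<Rightarrow> C2" where "Mz z = (om al *\<^sub>R (\<i> * fst z), om be *\<^sub>R (\<i> * snd z))"

lemma J_inner: "Jz z \<bullet> u = sg1 z u + sg2 z u" and M_inner: "Mz z \<bullet> u = om al * sg1 z u + om be * sg2 z u"
  and JM_inner: "Jz z \<bullet> Mz z = om al * (cmod (fst z))\<^sup>2 + om be * (cmod (snd z))\<^sup>2"
  by (simp_all add: Jz_def Mz_def sg1_def sg2_def inner_prod_def inner_complex_def cmod_power2 algebra_simps)
     (simp_all add: power2_eq_square algebra_simps)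

lemma quadratic_decays:
  assumes "decays m A" and g: "\<And>u. decays (-1) (g u)" "\<And>u. decays (-1) (h u)"
  shows "decays m (\<lambda>z. rr z * (A z * (g u z * h v z)))"
  using decays_mult[OF rr_decays decays_mult[OF assms(1) decays_mult[OF g(1) g(2)]], of u v] by simp

text \<open>The leading part of DD - 1 is |z|^-4 (Jz . Mz), and the leading terms of the three
  coefficients assemble to - (Jz . u)(Mz . v) - (Mz . u)(Jz . v); together they are
  \<open>lead\<close>.\<close>

lemma hh_decays: "decays 2 (\<lambda>z. hh z u v)" and hh_lead: "decays 4 (\<lambda>z. hh z u v - lead Jz Mz z u v)"
proof -
  note sg = sg_decays
  have split: "rr z * (A * a1 * b1 + B * (a1 * b2 + a2 * b1) + C * a2 * b2) =
      rr z * (A * (a1 * b1)) + rr z * (B * (a1 * b2)) + rr z * (B * (a2 * b1)) + rr z * (C * (a2 * b2))" for z A B C a1 a2 b1 b2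
    by (simp add: algebra_simps)
  have dA: "decays m (\<lambda>z. rr z * (A z * sg1 z u * sg1 z v + B z * (sg1 z u * sg2 z v + sg2 z u * sg1 z v) + C z * sg2 z u * sg2 z v))"
    if "decays m A" "decays m B" "decays m C" for m A B C
    unfolding split by (intro decays_add quadratic_decays that sg)
  have D: "decays 2 (\<lambda>z. (DD z - 1) * (u \<bullet> v))"
    using decays_cmult[OF DD_decays, of "u \<bullet> v"] by (simp add: mult.commute)
  show "decays 2 (\<lambda>z. hh z u v)" unfolding hh_def
    using expands_diff_decays[OF A11_expands] expands_diff_decays[OF A12_expands] expands_diff_decays[OF A22_expands]
    by (intro decays_add D dA) simp_all
  have D4: "decays 4 (\<lambda>z. (DD z - 1 - (ss z * (rr z * om al) + cc z * (rr z * om be))) * (u \<bullet> v))"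
    using DD_expands decays_cmult[of 4 "\<lambda>z. DD z - 1 - (ss z * (rr z * om al) + cc z * (rr z * om be))" "u \<bullet> v"]
    by (simp add: expands_def mult.commute)
  have "decays 4 (\<lambda>z. (DD z - 1 - (ss z * (rr z * om al) + cc z * (rr z * om be))) * (u \<bullet> v) +
      rr z * ((A11 z + 2 * (rr z * om al)) * sg1 z u * sg1 z v + (A12 z + rr z * (om al + om be)) * (sg1 z u * sg2 z v + sg2 z u * sg1 z v) +
        (A22 z + 2 * (rr z * om be)) * sg2 z u * sg2 z v))"
    by (rule decays_add[OF D4 dA]) (use A11_expands A12_expands A22_expands in \<open>simp_all add: expands_def\<close>)
  moreover have "(DD z - 1 - (ss z * (rr z * om al) + cc z * (rr z * om be))) * (u \<bullet> v) +
      rr z * ((A11 z + 2 * (rr z * om al)) * sg1 z u * sg1 z v + (A12 z + rr z * (om al + om be)) * (sg1 z u * sg2 z v + sg2 z u * sg1 z v) +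
        (A22 z + 2 * (rr z * om be)) * sg2 z u * sg2 z v) = hh z u v - lead Jz Mz z u v" for z
    unfolding lead_def JM_inner unfolding J_inner M_inner hh_def ss_def cc_def inverse_mult_distrib rr_def[symmetric] by algebra
  ultimately show "decays 4 (\<lambda>z. hh z u v - lead Jz Mz z u v)" by simp
qed

lemma lift_eventually:
  "\<forall>\<^sub>F z in at_infinity. DD z > 0 \<and> (\<forall>j\<le>k. ys j \<noteq> \<infinity> \<longrightarrow> dd j z > 0 \<and> dd j z + (Y j - (rr z * cc z - rr z * ss z)) > 0)"
proof -
  have "(DD \<longlongrightarrow> 1) at_infinity" by (rule decays_tendsto_const[OF DD_decays]) simp
  then have "\<forall>\<^sub>F z in at_infinity. DD z > 0" using order_tendstoD(1) by fastforce
  moreover have "\<forall>\<^sub>F z in at_infinity. \<forall>j\<in>{..k}. ys j \<noteq> \<infinity> \<longrightarrow> dd j z > 0 \<and> dd j z + (Y j - (rr z * cc z - rr z * ss z)) > 0"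
  proof (rule eventually_ball_finite, simp, rule ballI)
    fix j assume "j \<in> {..k}"
    then show "\<forall>\<^sub>F z in at_infinity. ys j \<noteq> \<infinity> \<longrightarrow> dd j z > 0 \<and> dd j z + (Y j - (rr z * cc z - rr z * ss z)) > 0"
      using dd_inverse_decays(3)[OF Y_pos, of j] et_decays(2)[OF Y_pos, of j]
      by (cases "ys j = \<infinity>") (simp_all add: eventually_conj)
  qed
  ultimately show ?thesis by eventually_elim auto
qed

end

section \<open>The mass of the Calderbank--Singer metric\<close>

text \<open>A value of \<open>frechet_derivative\<close> is meaningful only where the derivative
  exists, so differentiability is a separate hypothesis; the basis directions then control all
  directions.\<close>

lemma decays_of_bigo:
  fixes f :: "'a::euclidean_space \<Rightarrow> real"
  assumes diff: "\<forall>\<^sub>F w in at_infinity. f differentiable (at w)"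
    and f: "(\<lambda>w. f w - c) \<in> O[at_infinity](\<lambda>w. norm w powr (-m))"
    and df: "\<And>k. k \<in> Basis \<Longrightarrow> (\<lambda>w. frechet_derivative f (at w) k) \<in> O[at_infinity](\<lambda>w. norm w powr (-m-1))"
  shows "decays m (\<lambda>w. f w - c)"
proof -
  obtain C where C: "\<forall>\<^sub>F w in at_infinity. \<bar>f w - c\<bar> \<le> C * norm w powr (-m)"
    using landau_o.bigE[OF f] by auto
  have "\<exists>B. \<forall>\<^sub>F w in at_infinity. \<bar>frechet_derivative f (at w) k\<bar> \<le> B * norm w powr (-m-1)" if "k \<in> Basis" for k
    using landau_o.bigE[OF df[OF that]] by auto
  then obtain B where B: "\<And>k. k \<in> Basis \<Longrightarrow> \<forall>\<^sub>F w in at_infinity. \<bar>frechet_derivative f (at w) k\<bar> \<le> B k * norm w powr (-m-1)"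
    by metis
  have ev: "\<forall>\<^sub>F w in at_infinity. \<forall>k\<in>Basis. \<bar>frechet_derivative f (at w) k\<bar> \<le> B k * norm w powr (-m-1)"
    using B by (intro eventually_ball_finite) auto
  show ?thesis
  proof (rule decaysI[OF _ C])
    show "\<forall>\<^sub>F w in at_infinity. ((\<lambda>w. f w - c) has_derivative frechet_derivative f (at w)) (at w)"
      using diff by eventually_elim (auto intro!: derivative_eq_intros simp: frechet_derivative_works[symmetric])
    show "\<forall>\<^sub>F w in at_infinity. \<forall>v. \<bar>frechet_derivative f (at w) v\<bar> \<le> (\<Sum>k\<in>Basis. B k) * norm w powr (-m-1) * norm v"
      using diff ev
    proof eventually_elim
      case (elim w)
      show ?case
      proof
        fix v
        have "frechet_derivative f (at w) v = (\<Sum>k\<in>Basis. (v \<bullet> k) * frechet_derivative f (at w) k)"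
          by (rule linear_Basis_expansion) (rule linear_frechet_derivative[OF elim(1)])
        also have "\<bar>\<dots>\<bar> \<le> (\<Sum>k\<in>Basis. \<bar>(v \<bullet> k) * frechet_derivative f (at w) k\<bar>)" by (rule sum_abs)
        also have "\<dots> \<le> (\<Sum>k\<in>Basis. norm v * (B k * norm w powr (-m-1)))"
          unfolding abs_mult using elim(2) by (intro sum_mono mult_mono Basis_le_norm) auto
        also have "\<dots> = (\<Sum>k\<in>Basis. B k) * norm w powr (-m-1) * norm v"
          by (simp add: sum_distrib_left sum_distrib_right mult_ac)
        finally show "\<bar>frechet_derivative f (at w) v\<bar> \<le> (\<Sum>k\<in>Basis. B k) * norm w powr (-m-1) * norm v" .
      qed
    qed
  qed
qed

lemma decays_imp_bigo:
  fixes f :: "'a::euclidean_space \<Rightarrow> real"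
  assumes "decays m (\<lambda>w. f w - c)"
  shows "(\<lambda>w. f w - c) \<in> O[at_infinity](\<lambda>w. norm w powr (-m))"
    and "(\<lambda>w. frechet_derivative f (at w) k) \<in> O[at_infinity](\<lambda>w. norm w powr (-m-1))"
proof -
  from decaysE[OF assms] obtain C R f' where f: "C > 0" "R \<ge> 1" "\<And>w. norm w > R \<Longrightarrow> ((\<lambda>w. f w - c) has_derivative f' w) (at w)"
    "\<And>w. norm w > R \<Longrightarrow> \<bar>f w - c\<bar> \<le> C * norm w powr (-m)"
    "\<And>w v. norm w > R \<Longrightarrow> \<bar>f' w v\<bar> \<le> C * norm w powr (-m-1) * norm v" by metis
  show "(\<lambda>w. f w - c) \<in> O[at_infinity](\<lambda>w. norm w powr (-m))"
    by (rule landau_o.bigI[OF f(1)], use eventually_norm_gt[of R] in eventually_elim) (simp add: f(4))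
  have fd: "frechet_derivative f (at w) = f' w" if "norm w > R" for w
    using has_derivative_add[OF f(3)[OF that] has_derivative_const[of c]] frechet_derivative_at[of f "f' w" w] by simp
  show "(\<lambda>w. frechet_derivative f (at w) k) \<in> O[at_infinity](\<lambda>w. norm w powr (-m-1))"
  proof (rule bigoI[of _ "C * norm k"], use eventually_norm_gt[of R] in eventually_elim)
    case (elim w)
    then show ?case using f(5)[OF elim, of k] by (simp add: fd mult_ac)
  qed
qed

lemma Ck_on_const: "Ck_on n (\<lambda>_. c) S"
  by (induction n arbitrary: c) (simp_all add: frechet_derivative_const)

lemma Ck_on_ident: "Ck_on n (\<lambda>x. x) S"
  by (cases n) (simp_all add: frechet_derivative_ident Ck_on_const)

lemma Ck_on_imp_derivatives:
  assumes C2: "Ck_on (Suc (Suc 0)) F D" and D: "open D" "w \<in> D"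
  defines "DF \<equiv> \<lambda>w. frechet_derivative F (at w)"
  defines "D2F \<equiv> \<lambda>w u. frechet_derivative (\<lambda>x. DF x u) (at w)"
  shows "(F has_derivative DF w) (at w)" "((\<lambda>x. DF x u) has_derivative D2F w u) (at w)" "D2F w u v = D2F w v u"
proof -
  have 1: "(F has_derivative DF w) (at w)" if "w \<in> D" for w
    using C2 that by (simp add: DF_def frechet_derivative_works[symmetric])
  have 2: "((\<lambda>x. DF x u) has_derivative D2F w u) (at w)" if "w \<in> D" for w u
    using C2 that by (simp add: DF_def D2F_def frechet_derivative_works[symmetric])
  show "(F has_derivative DF w) (at w)" "((\<lambda>x. DF x u) has_derivative D2F w u) (at w)" using 1 2 D by blast+
  have 3: "isCont (\<lambda>x. D2F x u v) w" for u v
    using C2 D by (simp add: DF_def D2F_def continuous_on_eq_continuous_at)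
  show "D2F w u v = D2F w v u"
  proof (rule euclidean_eqI)
    fix b :: 'b assume "b \<in> Basis"
    show "D2F w u v \<bullet> b = D2F w v u \<bullet> b"
      by (rule second_derivative_symmetric[OF D, of "\<lambda>w. F w \<bullet> b" "\<lambda>w u. DF w u \<bullet> b" "\<lambda>w u v. D2F w u v \<bullet> b"])
         (intro has_derivative_inner_left 1 2 continuous_intros 3; assumption)+
  qed
qed

text \<open>Density of the complement of the axes makes the \<open>Lim\<close> defining the end
  metric unique.\<close>

lemma off_axes_limit: "at z within off_axes \<noteq> bot"
proof -
  \<comment> \<open>Shifting by s (1, 1), each coordinate has zero real part for a single value of
    s.\<close>
  have "\<forall>\<^sub>F s in at_right 0. s \<noteq> - Re (fst z)" "\<forall>\<^sub>F s in at_right 0. s \<noteq> - Re (snd z)" "\<forall>\<^sub>F s in at_right (0::real). s \<noteq> 0"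
    by (rule eventually_neq_at_within)+
  then have ev: "\<forall>\<^sub>F s in at_right 0. z + s *\<^sub>R (1, 1) \<in> off_axes \<and> z + s *\<^sub>R (1, 1) \<noteq> z"
    by eventually_elim (auto simp: off_axes_def complex_eq_iff prod_eq_iff)
  have "((\<lambda>s. z + s *\<^sub>R (1, 1)) \<longlongrightarrow> z) (at_right 0)" by (rule tendsto_eq_intros refl | simp add: zero_prod_def)+
  then have lim: "filterlim (\<lambda>s. z + s *\<^sub>R (1, 1)) (at z within off_axes) (at_right 0)"
    unfolding filterlim_at using ev by blast
  show ?thesis
  proof
    assume "at z within off_axes = bot"
    then have "\<forall>\<^sub>F w in at z within off_axes. False" by simp
    from eventually_compose_filterlim[OF this lim] show False by (simp add: eventually_False)
  qed
qed

lemma decays_isCont: "decays m f \<Longrightarrow> \<forall>\<^sub>F w in at_infinity. isCont f w"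
  by (erule decaysE, rule eventually_mono[OF eventually_norm_gt]) (rule has_derivative_continuous)

section \<open>Normalisation and the mass in a given chart\<close>

context calderbank_singer
begin

lemma sg_isCont: "isCont (\<lambda>z. sg1 z u) w" "isCont (\<lambda>z. sg2 z u) w"
  by (auto simp: sg1_def sg2_def intro!: continuous_intros)

text \<open>The formula found off the axes is continuous across them near infinity, so it also
  computes the limit on the axes.\<close>

lemma cs_end_metric_eq: "\<forall>\<^sub>F z in at_infinity. \<forall>u v. cs_end_metric es ys z u v = q * (u \<bullet> v + hh z u v)"
proof -
  have "decays 0 DD" using decays_add[OF decays_mono[OF DD_decays, of 0] decays_const[of 1]] by simp
  note cont = decays_isCont[OF this] decays_isCont[OF rr_decays] decays_isCont[OF expands_decays[OF A11_expands]]
    decays_isCont[OF expands_decays[OF A12_expands]] decays_isCont[OF expands_decays[OF A22_expands]]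
  show ?thesis using cont eventually_at_infinity_open[OF lift_eventually]
  proof eventually_elim
    case (elim z)
    show ?case
    proof (intro allI)
      fix u v
      have "isCont (\<lambda>z. q * (u \<bullet> v + hh z u v)) z"
        unfolding hh_def by (intro continuous_intros elim sg_isCont)
      then have lim: "((\<lambda>z. q * (u \<bullet> v + hh z u v)) \<longlongrightarrow> q * (u \<bullet> v + hh z u v)) (at z within off_axes)"
        unfolding isCont_def by (rule tendsto_within_subset) simp
      have "\<forall>\<^sub>F w in at z within off_axes. q * (u \<bullet> v + hh w u v) = cs_metric es ys (end_xy w) (end_push es w u) (end_push es w v)"
        unfolding eventually_at_filter using elim(6)
      proof eventually_elim
        case (elim w)
        have "cs_metric es ys (end_xy w) (end_push es w u) (end_push es w v) = q * (u \<bullet> v + hh w u v)" if "w \<in> off_axes"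
          by (rule cs_metric_off_axes[OF that]) (use elim in simp_all)
        then show ?case by simp
      qed
      from Lim_transform_eventually[OF lim this] show "cs_end_metric es ys z u v = q * (u \<bullet> v + hh z u v)"
        unfolding cs_end_metric_def by (rule tendsto_Lim[OF off_axes_limit])
    qed
  qed
qed

lemma hh_sym: "hh z u v = hh z v u"
  unfolding hh_def inner_commute[of u] by (simp add: algebra_simps)

lemma hh_linear: "linear (hh z u)"
proof (rule linearI)
  have sg: "sg1 z (a + b) = sg1 z a + sg1 z b" "sg2 z (a + b) = sg2 z a + sg2 z b"
    "sg1 z (r *\<^sub>R a) = r * sg1 z a" "sg2 z (r *\<^sub>R a) = r * sg2 z a" for a b r
    by (simp_all add: sg1_def sg2_def algebra_simps)
  show "hh z u (a + b) = hh z u a + hh z u b" for a b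
    unfolding hh_def sg inner_add_right by algebra
  show "hh z u (r *\<^sub>R a) = r *\<^sub>R hh z u a" for r a
    unfolding hh_def sg inner_scaleR_right real_scaleR_def by algebra
qed

lemma hh_expansion: "hh z u v = (\<Sum>a\<in>Basis. \<Sum>b\<in>Basis. (u \<bullet> a) * (v \<bullet> b) * hh z a b)"
proof -
  have "hh z u v = (\<Sum>b\<in>Basis. (v \<bullet> b) * hh z b u)"
    unfolding hh_sym[of z _ u] by (rule linear_Basis_expansion[OF hh_linear])
  also have "\<dots> = (\<Sum>b\<in>Basis. (v \<bullet> b) * (\<Sum>a\<in>Basis. (u \<bullet> a) * hh z b a))"
    by (intro sum.cong refl arg_cong2[of _ _ _ _ "(*)"] linear_Basis_expansion hh_linear)
  also have "\<dots> = (\<Sum>b\<in>Basis. \<Sum>a\<in>Basis. (u \<bullet> a) * (v \<bullet> b) * hh z a b)"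
    by (simp add: sum_distrib_left hh_sym[of z] mult_ac)
  also have "\<dots> = (\<Sum>a\<in>Basis. \<Sum>b\<in>Basis. (u \<bullet> a) * (v \<bullet> b) * hh z a b)" by (rule sum.swap)
  finally show ?thesis .
qed

lemma om_sum: "om al + om be = (\<Sum>j\<le>k. (if ys j = \<infinity> then 0 else inverse (Y j)) * (level j - level (Suc j))) / q"
proof -
  have "om al + om be = (\<Sum>j\<le>k. (if ys j = \<infinity> then 0 else inverse (Y j)) * (al j + be j))"
    unfolding om_def sum.distrib[symmetric] by (intro sum.cong) (auto simp: algebra_simps)
  then show ?thesis unfolding al_be by (simp add: sum_divide_distrib)
qed

lemma om_nonpos: "om al + om be \<le> 0" and om_zero: "om al + om be = 0 \<longleftrightarrow> p = q - 1"
proof -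
  \<comment> \<open>Reciprocals of a decreasing sequence increase; the value 0 for an infinite y_0
    fits this order.\<close>
  define u where "u j = (if ys j = \<infinity> then 0 else inverse (Y j))" for j
  have u: "u j < u (Suc j)" if "j < k" for j
  proof -
    have Y: "ys (Suc j) \<noteq> \<infinity>" "Y (Suc j) > 0" using ys_finite[of j] Y_pos[of "Suc j"] that by auto
    show ?thesis
    proof (cases "ys j = \<infinity>")
      case False
      then have "Y (Suc j) < Y j" using Y ys_dec[of j] ys_pos[of j] ys_pos[of "Suc j"] that
        by (cases "ys j"; cases "ys (Suc j)") (auto simp: Y_def)
      then show ?thesis using False Y by (simp add: u_def less_imp_inverse_less)
    qed (use Y in \<open>simp add: u_def\<close>)
  qed
  have om: "om al + om be = (\<Sum>j\<le>k. u j * (level j - level (Suc j))) / q"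
    unfolding om_sum u_def by (rule refl)
  show "om al + om be \<le> 0" "om al + om be = 0 \<longleftrightarrow> p = q - 1"
    using level_sum_nonpos[of u, OF u] q_pos unfolding om by (auto simp: divide_le_0_iff)
qed

lemma chart_exists:
  "chart_at_infinity p q es ys (\<lambda>w. w)" "asymp_euclidean 2 (chart_metric es ys (1 / q) (\<lambda>w. w))"
proof -
  \<comment> \<open>A real number below y_k, which may be infinite; |w| > 1 / sqrt r then places w
    in the end.\<close>
  obtain r where r: "0 < ereal r" "ereal r < ys k" using ereal_dense2[OF ys_pos[of k]] by auto
  have r0: "r > 0" using r by simp
  have in_end: "w \<in> cs_end es ys" if "1 / sqrt r < norm w" for w
  proof -
    have w: "0 < norm w" using that r0 by (meson divide_pos_pos less_trans real_sqrt_gt_zero zero_less_one)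
    have "1 < norm w * sqrt r" using that r0 by (simp add: divide_less_eq)
    then have "1 < (norm w * sqrt r)\<^sup>2" by (simp add: one_less_power)
    then have "1 / (norm w)\<^sup>2 < r" using w r0 by (simp add: power_mult_distrib divide_less_eq mult.commute)
    then have "ereal (1 / (norm w)\<^sup>2) < ereal r" by simp
    also note r(2)
    finally show ?thesis using w by (auto simp: cs_end_def)
  qed
  show "chart_at_infinity p q es ys (\<lambda>w. w)"
    unfolding chart_at_infinity_def Let_def
  proof (intro conjI exI[of _ "1 / sqrt r"])
    show "filterlim (\<lambda>w::C2. w) at_infinity at_infinity" by (rule filterlim_ident)
  qed (use r0 in_end in \<open>auto simp: Ck_on_ident frechet_derivative_ident\<close>)
  show "asymp_euclidean 2 (chart_metric es ys (1 / q) (\<lambda>w. w))"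
    unfolding asymp_euclidean_def partial_def[abs_def]
  proof (intro ballI)
    fix i j :: C2
    have "\<forall>\<^sub>F w in at_infinity. hh w i j = chart_metric es ys (1 / q) (\<lambda>w. w) w i j - i \<bullet> j"
      using cs_end_metric_eq by eventually_elim (use q_pos in \<open>simp add: chart_metric_def frechet_derivative_ident\<close>)
    from decays_cong[OF hh_decays this]
    have "decays 2 (\<lambda>w. chart_metric es ys (1 / q) (\<lambda>w. w) w i j - i \<bullet> j)" .
    from decays_imp_bigo[OF this]
    show "(\<lambda>w. chart_metric es ys (1 / q) (\<lambda>w. w) w i j - i \<bullet> j) \<in> O[at_infinity](\<lambda>w. norm w powr - 2) \<and>
       (\<forall>k\<in>Basis. (\<lambda>w. frechet_derivative (\<lambda>w. chart_metric es ys (1 / q) (\<lambda>w. w) w i j) (at w) k) \<in> O[at_infinity](\<lambda>w. norm w powr (- 2 - 1)))"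
      by blast
  qed
qed

text \<open>\<open>lead\<close> is homogeneous of degree -2 in the point and linear in M, so a
  dilation is absorbed into M.\<close>

lemma lead_scale:
  assumes "\<mu> > 0" shows "lead Jz Mz (y /\<^sub>R \<mu>) a b = lead Jz (\<lambda>y. \<mu>\<^sup>2 *\<^sub>R Mz y) y a b"
proof -
  have JM: "Jz (y /\<^sub>R \<mu>) = Jz y /\<^sub>R \<mu>" "Mz (y /\<^sub>R \<mu>) = Mz y /\<^sub>R \<mu>"
    by (simp_all add: Jz_def Mz_def scaleR_conv_of_real mult_ac)
  have "\<mu> * inverse \<mu> = 1" using assms by simp
  then show ?thesis
    unfolding lead_def JM inner_scaleR_left inner_scaleR_right inverse_mult_distrib inverse_inverse_eq by algebra
qed

lemma JM_antisym: "linear Jz" "linear Mz" "Jz x \<bullet> y = - (x \<bullet> Jz y)" "Mz x \<bullet> y = - (x \<bullet> Mz y)"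
  by (auto intro!: linearI simp: Jz_def Mz_def inner_prod_def inner_complex_def algebra_simps scaleR_conv_of_real)

text \<open>Dilating F by \<mu> with \<mu>^2 = c q turns the leading part c q |dz|^2 of the metric
  into the Euclidean one; by \<open>lead_scale\<close> the mass picks up the factor c q.\<close>

lemma mass_of_cs_chart:
  assumes c: "0 < c" and \<tau>: "1 < \<tau>" and chart: "chart_at_infinity p q es ys F"
    and asymp: "asymp_euclidean \<tau> (chart_metric es ys c F)"
  shows "has_mass (chart_metric es ys c F) (c * q * (om al + om be))"
proof -
  define \<mu> where "\<mu> = sqrt (c * q)"
  have cq: "c * q > 0" using c q_pos by simp
  have \<mu>: "\<mu> > 0" "\<mu>\<^sup>2 = c * q" "\<mu> * \<mu> = c * q" using cq by (simp_all add: \<mu>_def)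
  define DF where "DF w = frechet_derivative F (at w)" for w
  define D2F where "D2F w u = frechet_derivative (\<lambda>x. DF x u) (at w)" for w u
  define G where "G w = \<mu> *\<^sub>R F w" for w
  define DG where "DG w u = \<mu> *\<^sub>R DF w u" for w u
  define D2G where "D2G w u v = \<mu> *\<^sub>R D2F w u v" for w u v
  define K where "K y a b = hh (y /\<^sub>R \<mu>) a b" for y a b
  define H where "H = chart_metric es ys c F"
  from chart obtain R0 where C2: "Ck_on (Suc (Suc 0)) F {w. R0 < norm w}" and lim: "filterlim F at_infinity at_infinity"
    unfolding chart_at_infinity_def Let_def by blast
  have op: "open {w::C2. R0 < norm w}" by (intro open_Collect_less continuous_intros)
  have der: "(F has_derivative DF w) (at w)" "((\<lambda>x. DF x u) has_derivative D2F w u) (at w)" "D2F w u v = D2F w v u"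
    if "R0 < norm w" for w u v
    using Ck_on_imp_derivatives[OF C2 op, of w] that unfolding DF_def D2F_def by blast+
  have large: "\<forall>\<^sub>F w::C2 in at_infinity. R0 < norm w" by (rule eventually_norm_gt)
  have KG: "K (G w) a b = hh (F w) a b" for w a b using \<mu> by (simp add: K_def G_def)
  have H_eq: "\<forall>\<^sub>F w in at_infinity. \<forall>u v. H w u v = DG w u \<bullet> DG w v +
      (\<Sum>a\<in>Basis. \<Sum>b\<in>Basis. (DG w u \<bullet> a) * (DG w v \<bullet> b) * K (G w) a b)"
    using eventually_compose_filterlim[OF cs_end_metric_eq lim]
  proof eventually_elim
    case (elim w)
    show ?case
    proof (intro allI)
      fix u v
      have "H w u v = c * (q * (DF w u \<bullet> DF w v + hh (F w) (DF w u) (DF w v)))"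
        using elim by (simp add: H_def chart_metric_def DF_def)
      also have "hh (F w) (DF w u) (DF w v) = (\<Sum>a\<in>Basis. \<Sum>b\<in>Basis. (DF w u \<bullet> a) * (DF w v \<bullet> b) * hh (F w) a b)"
        by (rule hh_expansion)
      also have "c * (q * (DF w u \<bullet> DF w v + \<dots>)) = DG w u \<bullet> DG w v +
          (\<Sum>a\<in>Basis. \<Sum>b\<in>Basis. (DG w u \<bullet> a) * (DG w v \<bullet> b) * K (G w) a b)"
      proof -
        have "(\<Sum>a\<in>Basis. \<Sum>b\<in>Basis. (DG w u \<bullet> a) * (DG w v \<bullet> b) * K (G w) a b) =
            (c * q) * (\<Sum>a\<in>Basis. \<Sum>b\<in>Basis. (DF w u \<bullet> a) * (DF w v \<bullet> b) * hh (F w) a b)"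
          unfolding KG DG_def inner_scaleR_left inner_scaleR_right sum_distrib_left \<mu>(3)[symmetric]
          by (intro sum.cong refl) algebra
        moreover have "DG w u \<bullet> DG w v = (c * q) * (DF w u \<bullet> DF w v)"
          unfolding DG_def inner_scaleR_left inner_scaleR_right \<mu>(3)[symmetric] by (rule mult.assoc[symmetric])
        ultimately show ?thesis by (simp only: distrib_left mult.assoc)
      qed
      finally show "H w u v = DG w u \<bullet> DG w v +
          (\<Sum>a\<in>Basis. \<Sum>b\<in>Basis. (DG w u \<bullet> a) * (DG w v \<bullet> b) * K (G w) a b)" .
    qed
  qed
  have scale: "decays m (\<lambda>y. f (y /\<^sub>R \<mu>))" if "decays m f" "m \<ge> 0" for m and f :: "C2 \<Rightarrow> real"
  proof (rule decays_compose[OF that, of "1 / \<mu>" _ "\<lambda>_ v. v /\<^sub>R \<mu>" "1 / \<mu>"])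
    show "\<forall>\<^sub>F y::C2 in at_infinity. ((\<lambda>y. y /\<^sub>R \<mu>) has_derivative (\<lambda>v. v /\<^sub>R \<mu>)) (at y)"
      by (intro always_eventually allI derivative_intros)
  qed (use \<mu> in \<open>simp_all add: divide_inverse\<close>)
  have K_decays: "decays 2 (\<lambda>y. K y a b)" for a b
    unfolding K_def by (rule scale[OF hh_decays]) simp
  have K_lead: "decays 3 (\<lambda>y. K y a b - lead Jz (\<lambda>y. \<mu>\<^sup>2 *\<^sub>R Mz y) y a b)" for a b
    using decays_mono[OF scale[OF hh_lead], of 3 a b] unfolding K_def lead_scale[OF \<mu>(1)] by simp
  have G_lim: "filterlim G at_infinity at_infinity"
    using filterlim_tendsto_pos_mult_at_top[OF tendsto_const \<mu>(1) lim[unfolded filterlim_at_infinity_conv_norm_at_top]] \<mu>(1)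
    unfolding filterlim_at_infinity_conv_norm_at_top by (simp add: G_def)
  have "\<forall>\<^sub>F y in at_infinity. (\<lambda>y. K y a b) differentiable (at y)" for a b
    by (rule decaysE[OF K_decays[of a b]], rule eventually_mono[OF eventually_norm_gt]) (auto simp: differentiable_def)
  then have "\<forall>\<^sub>F y in at_infinity. \<forall>a\<in>Basis. \<forall>b\<in>Basis. (\<lambda>y. K y a b) differentiable (at y)"
    by (intro eventually_ball_finite finite_Basis ballI)
  from eventually_compose_filterlim[OF this G_lim]
  \<comment> \<open>Differentiability of \<open>H\<close> is read off the pull-back formula, since
    \<open>asymp_euclidean\<close> speaks only of values of
    \<open>frechet_derivative\<close>.\<close>
  have H_diff: "\<forall>\<^sub>F w in at_infinity. (\<lambda>w. H w i j) differentiable (at w)" for i j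
    using large eventually_at_infinity_open[OF H_eq]
  proof eventually_elim
    case (elim w)
    have dG: "G differentiable (at w)"
      unfolding G_def[abs_def] differentiable_def using has_derivative_scaleR_right[OF der(1)[OF elim(2)]] by blast
    have dD: "(\<lambda>w. DG w u \<bullet> b) differentiable (at w)" for u b
      unfolding DG_def differentiable_def
      using has_derivative_inner_left[OF has_derivative_scaleR_right[OF der(2)[OF elim(2)]]] by blast
    have dDD: "(\<lambda>w. DG w i \<bullet> DG w j) differentiable (at w)"
      unfolding DG_def differentiable_def
      using has_derivative_inner[OF has_derivative_scaleR_right[OF der(2)[OF elim(2)]] has_derivative_scaleR_right[OF der(2)[OF elim(2)]]] by blast
    have "(\<lambda>w. DG w i \<bullet> DG w j + (\<Sum>a\<in>Basis. \<Sum>b\<in>Basis. (DG w i \<bullet> a) * (DG w j \<bullet> b) * K (G w) a b)) differentiable (at w)"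
      using elim(1) by (intro differentiable_add dDD differentiable_sum ballI differentiable_mult dD
          differentiable_compose[of "\<lambda>y. K y _ _" G] dG finite_Basis) blast
    then obtain D where "((\<lambda>w. DG w i \<bullet> DG w j + (\<Sum>a\<in>Basis. \<Sum>b\<in>Basis. (DG w i \<bullet> a) * (DG w j \<bullet> b) * K (G w) a b)) has_derivative D) (at w)"
      unfolding differentiable_def by blast
    moreover have "\<forall>\<^sub>F x in nhds w. DG x i \<bullet> DG x j + (\<Sum>a\<in>Basis. \<Sum>b\<in>Basis. (DG x i \<bullet> a) * (DG x j \<bullet> b) * K (G x) a b) = H x i j"
      using elim(3) by eventually_elim simp
    ultimately show ?case unfolding differentiable_def by (blast intro: has_derivative_cong_nhds)
  qed
  have H_decays: "decays \<tau> (\<lambda>w. H w i j - i \<bullet> j)" if "i \<in> Basis" "j \<in> Basis" for i j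
    using asymp that unfolding asymp_euclidean_def partial_def[abs_def] H_def[symmetric]
    by (intro decays_of_bigo H_diff) blast+
  have "asymptotic_chart G DG D2G K H \<tau>"
  proof
    show "2 \<le> DIM(C2)" by (simp add: Basis_C2)
    show "\<forall>\<^sub>F w in at_infinity. (G has_derivative DG w) (at w)"
      using large unfolding G_def[abs_def] DG_def by eventually_elim (intro has_derivative_scaleR_right der)
    show "\<forall>\<^sub>F w in at_infinity. \<forall>u. ((\<lambda>w. DG w u) has_derivative D2G w u) (at w)"
      using large unfolding D2G_def DG_def by eventually_elim (intro allI has_derivative_scaleR_right der)
    show "\<forall>\<^sub>F w in at_infinity. \<forall>u v. D2G w u v = D2G w v u"
      using large unfolding D2G_def by eventually_elim (intro allI arg_cong[of _ _ "(*\<^sub>R) \<mu>"] der)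
    show "K y a b = K y b a" for y a b unfolding K_def by (rule hh_sym)
  qed (use \<tau> G_lim K_decays H_eq H_decays in blast)+
  from mass_of_chart[OF this JM_antisym(1) JM_antisym(3) _ _ K_lead]
  have "has_mass H ((\<Sum>a\<in>Basis. Jz a \<bullet> \<mu>\<^sup>2 *\<^sub>R Mz a) / 2)"
    using JM_antisym by (simp add: linear_compose_scale_right)
  \<comment> \<open>Each complex coordinate has two real basis vectors, so the trace is 2 c q
    (\<open>om al\<close> + \<open>om be\<close>).\<close>
  moreover have "(\<Sum>a\<in>Basis. Jz a \<bullet> \<mu>\<^sup>2 *\<^sub>R Mz a) / 2 = c * q * (om al + om be)"
    unfolding \<mu>(2) by (simp add: Basis_C2 Jz_def Mz_def inner_prod_def inner_complex_def algebra_simps)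
  ultimately show ?thesis by (simp add: H_def)
qed

end

theorem theorem3:
  fixes p q :: nat and es :: "nat list" and ys :: "nat \<Rightarrow> ereal"
  assumes "0 < p" and "p < q" and "coprime p q"
    and "hj_expansion p q es"
    and "cs_points es ys"
  shows "(\<exists>F c \<tau>. 0 < c \<and> 1 < \<tau> \<and> chart_at_infinity p q es ys F \<and>
            asymp_euclidean \<tau> (chart_metric es ys c F)) \<and>
         (\<forall>F c \<tau>. 0 < c \<and> 1 < \<tau> \<and> chart_at_infinity p q es ys F \<and>
            asymp_euclidean \<tau> (chart_metric es ys c F) \<longrightarrow>
            (\<exists>m. has_mass (chart_metric es ys c F) m \<and> m \<le> 0 \<and> (m = 0 \<longleftrightarrow> p = q - 1))) \<and>
         (p = q - 1 \<longleftrightarrow> crepant p q es)"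
proof (intro conjI allI impI)
  interpret calderbank_singer p q es ys using assms by unfold_locales
  show "\<exists>F c \<tau>. 0 < c \<and> 1 < \<tau> \<and> chart_at_infinity p q es ys F \<and> asymp_euclidean \<tau> (chart_metric es ys c F)"
    by (rule exI[of _ "\<lambda>w. w"], rule exI[of _ "1 / q"], rule exI[of _ 2]) (use chart_exists q_pos in simp)
  show "p = q - 1 \<longleftrightarrow> crepant p q es" by (rule crepant_iff)
  fix F c \<tau>
  assume A: "0 < c \<and> 1 < \<tau> \<and> chart_at_infinity p q es ys F \<and> asymp_euclidean \<tau> (chart_metric es ys c F)"
  have "has_mass (chart_metric es ys c F) (c * q * (om al + om be))"
    using A by (intro mass_of_cs_chart) auto
  moreover have "c * q > 0" using A q_pos by simp
  then have "c * q * (om al + om be) \<le> 0" "c * q * (om al + om be) = 0 \<longleftrightarrow> p = q - 1"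
    using om_nonpos om_zero by (auto simp: mult_le_0_iff)
  ultimately show "\<exists>m. has_mass (chart_metric es ys c F) m \<and> m \<le> 0 \<and> (m = 0 \<longleftrightarrow> p = q - 1)" by blast
qed

end
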